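(* Let $m,n\in\mathbf N$, $A_0,\dots,A_{m-1}\in\mathbb G^\infty_{n\times n}$, $t_0\in I$, and let $F\in\mathcal R^{n\times n\prime}$ satisfy $F=0$ for $t<t_0$. Then there exists a unique solution $X\in\mathcal R^{n\times n\prime}$ of the Cauchy problem $$X^{(m)}-A_{m-1}X^{(m-1)}-\dots-A_0X=F,\qquad X^{(k)}=0\ \text{ for } t<t_0,\quad 0\le k\le m-1 .$$ Furthermore, $X=\sum_{i=1}^m X_iT_i$, where $\{X_i\}_{i=1}^m$ is the fundamental system of solutions of the corresponding homogeneous differential equation, $T_i$ is the primitive of the distribution $Z_iF$ equal to $0$ for $t<t_0$, and $Z_i$ is the $i$-th element of the first column of $R^{-1}$, where $$R=\begin{pmatrix}X_1&\dots&X_m\\ &\dots&\\ X_1^{(m-1)}&\dots&X_m^{(m-1)}\end{pmatrix}.$$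
   Context: $I=(a,b)\subset\mathbf R$ is an open interval (e.g. $I=\mathbf R$), $\mathbf N_0=\mathbf N\cup\{0\}$. $\mathbb G$ is the algebra of essentially bounded $g:I\to\mathbf C$ possessing both limits $g(t\pm)=\operatorname{ess\,lim}_{s\to t\pm}g(s)$ at every $t\in I$; $\sigma_t(g):=g(t+)-g(t-)$. $\mathbb G^\infty$ is the algebra of $g\in\mathbb G$ such that for every $k\in\mathbf N$ there is $g^{(k)}\in\mathbb G$ with $g^{(k)}(t\pm)=\operatorname{ess\,lim}_{s\to t\pm,\,s\ne t}\frac{g^{(k-1)}(s)-g^{(k-1)}(t\pm)}{s-t}$ for all $t\in I$ ($g^{(0)}=g$), with the norms $\|g\|_k=\max_{0\le i\le k}\|g^{(i)}\|_{L_\infty}$, $k\in\mathbf N_0$. For $g\in\mathbb G$, $\operatorname{supp}(g)$ is the closure in $I$ of $\{t: g(t-)\ne0\text{ or }g(t+)\ne0\}$. $\mathcal R$ is the space of $\varphi\in\mathbb G^\infty$ with compact support in $I$, with the locally convex inductive limit topology of the countably normed spaces $\mathbb G^\infty(J)$ (functions extended by zero outside $J$, norms $\|\cdot\|_k$), $J$ running over bounded subintervals with $\bar J\subset I$. $\mathcal R'$ is the space of continuous linear functionals $f:\mathcal R\to\mathbf C$, $\varphi\mapsto(f,\varphi)$, with the weak* topology. Product: for $g\in\mathbb G^\infty$ and $f\in\mathcal R'$, $(gf,\varphi)=(fg,\varphi):=(f,g\varphi)$, $\varphi\in\mathcal R$. Derivative: let $\mathbb C$ be the bounded continuous functions on $I$;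 $\mathbb F_k\subset\mathbb G^\infty$ is the set of $g$ with $g^{(i)}\in\mathbb C$ for all $i\ne k$ and $g^{(k)}$ piecewise continuous; $\mathbb F$ is the linear span of all $\mathbb F_k$, $k\in\mathbf N_0$; $\mathcal R_F=\mathcal R\cap\mathbb F$, which is dense in $\mathcal R$. $\Delta\subset\mathcal R'$ is the set of $g\in\mathcal R'$ for which there is $c:I\to\mathbf C$ with $(g,\varphi)=\sum_{t\in I}c(t)\sigma_t(\varphi)$ for all $\varphi\in\mathcal R_F$ (a sum with finitely many nonzero terms). For $f\in\mathcal R'$ let $(\frac{df}{dt},\varphi):=-(f,\varphi')$, with $\varphi'$ defined almost everywhere; a derivative of $f$ is any element $f'$ of $D(f):=\frac{df}{dt}+\Delta$ (differentiation is multivalued). Higher derivatives are defined inductively: $f^{(0)}=f$, $f^{(k+1)}\in D(f^{(k)})$; $f$ together with a given $m$-th derivative $f^{(m)}$ determines the intermediate derivatives uniquely. $\mathcal R^{n\times n\prime}$ is the space of $n\times n$ matrices of elements of $\mathcal R'$, $\mathbb G^\infty_{n\times n}$ the $n\times n$ matrices with entries in $\mathbb G^\infty$; operations are entrywise, with matrix products as usual. "$F=0$ for $t<t_0$" means $(F,\varphi)=0$ for all $\varphi\in\mathcal R$ with $\operatorname{supp}(\varphi)\subset(a,t_0)$. A solution of the $m$-th order equation is $X\in\mathcal R^{n\times n\prime}$ possessing an $m$-th derivative $X^{(m)}$ (with intermediate derivatives $X',\dots,X^{(m-1)}$) such that $(X^{(m)}-A_{m-1}X^{(m-1)}-\dots-A_0X,\varphi)=(F,\varphi)$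 for all $\varphi\in\mathcal R$; the initial conditions refer to these derivatives. A primitive of a distribution $H$ is a $T$ having $H$ as one of its derivatives, i.e. $H\in D(T)$ (entrywise). A fundamental system of the homogeneous equation consists of $m$ classical $n\times n$ matrix-valued solutions $X_i$ on $I$ for which the matrix $R(t)$, built from $n\times n$ blocks, is invertible for all $t\in I$; "element" and "column" of $R^{-1}$ refer to its $n\times n$ blocks.
   Formalization: Z_i is taken as the i-th element of the last block column of R^{-1}, not the first: with R as displayed, the first column gives a wrong X for m ≥ 2 (e.g. n=1, m=2, A_0=A_1=0, X_1=1, X_2=t); for m=1 the two coincide. *)

theory Defs
  imports "HOL-Probability.Essential_Supremum" "HOL-Library.Function_Algebras"
begin

text \<open>
  Throughout, \<open>I\<close> is an open interval of the real line. Elements of the function algebras below are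
  classes of functions modulo equality almost everywhere on \<open>I\<close>; they are represented by functions
  on the reals, and every notion depends only on the class of the representative on \<open>I\<close>.
\<close>

section \<open>Essential one-sided limits and the algebra of regulated functions\<close>

text \<open>Convergence along these filters is convergence of a one-sided limit off a null set.\<close>

definition ess_at_right :: "real \<Rightarrow> real filter" where
  "ess_at_right t = inf (at_right t) (ae_filter lebesgue)"

definition ess_at_left :: "real \<Rightarrow> real filter" where
  "ess_at_left t = inf (at_left t) (ae_filter lebesgue)"

definition rlim :: "(real \<Rightarrow> 'a::t2_space) \<Rightarrow> real \<Rightarrow> 'a" where
  "rlim g t = Lim (ess_at_right t) g"

definition llim :: "(real \<Rightarrow> 'a::t2_space) \<Rightarrow> real \<Rightarrow> 'a" where
  "llim g t = Lim (ess_at_left t) g"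

definition jump :: "real \<Rightarrow> (real \<Rightarrow> complex) \<Rightarrow> complex" where
  "jump t g = rlim g t - llim g t"

definition G_fun :: "real set \<Rightarrow> (real \<Rightarrow> complex) set" where
  "G_fun I = {g. g \<in> borel_measurable (lebesgue_on I)
      \<and> (\<exists>C. AE s in lebesgue_on I. norm (g s) \<le> C)
      \<and> (\<forall>t\<in>I. (\<exists>l. (g \<longlongrightarrow> l) (ess_at_right t)) \<and> (\<exists>l. (g \<longlongrightarrow> l) (ess_at_left t)))}"

text \<open>\<open>G_deriv I g h\<close>: the function \<open>h\<close> is a first derivative of \<open>g\<close> in the algebra; the class of
  \<open>h\<close> is determined by its one-sided limits.\<close>

definition G_deriv :: "real set \<Rightarrow> (real \<Rightarrow> complex) \<Rightarrow> (real \<Rightarrow> complex) \<Rightarrow> bool" where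
  "G_deriv I g h \<longleftrightarrow> g \<in> G_fun I \<and> h \<in> G_fun I \<and>
     (\<forall>t\<in>I. ((\<lambda>s. (g s - rlim g t) / of_real (s - t)) \<longlongrightarrow> rlim h t) (ess_at_right t)
          \<and> ((\<lambda>s. (g s - llim g t) / of_real (s - t)) \<longlongrightarrow> llim h t) (ess_at_left t))"

definition G_inf :: "real set \<Rightarrow> (real \<Rightarrow> complex) set" where
  "G_inf I = {g \<in> G_fun I. \<exists>d. d 0 = g \<and> (\<forall>k::nat. G_deriv I (d k) (d (Suc k)))}"

definition dG :: "real set \<Rightarrow> (real \<Rightarrow> complex) \<Rightarrow> (real \<Rightarrow> complex)" where
  "dG I g = (SOME h. G_deriv I g h)"

definition Linf_norm :: "real set \<Rightarrow> (real \<Rightarrow> complex) \<Rightarrow> real" where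
  "Linf_norm I g = real_of_ereal (esssup (lebesgue_on I) (\<lambda>s. ereal (norm (g s))))"

definition G_norm :: "real set \<Rightarrow> nat \<Rightarrow> (real \<Rightarrow> complex) \<Rightarrow> real" where
  "G_norm I k g = Max ((\<lambda>i. Linf_norm I ((dG I ^^ i) g)) ` {..k})"

definition G_supp :: "real set \<Rightarrow> (real \<Rightarrow> complex) \<Rightarrow> real set" where
  "G_supp I g = I \<inter> closure {t \<in> I. llim g t \<noteq> 0 \<or> rlim g t \<noteq> 0}"

section \<open>Test functions and distributions\<close>

definition test_fun :: "real set \<Rightarrow> (real \<Rightarrow> complex) set" where
  "test_fun I = {\<phi> \<in> G_inf I. compact (G_supp I \<phi>)}"

text \<open>The step space of \<open>J\<close>, i.e. the test functions on \<open>I\<close> that vanish outside \<open>J\<close>.\<close>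

definition G_inf_on :: "real set \<Rightarrow> real set \<Rightarrow> (real \<Rightarrow> complex) set" where
  "G_inf_on I J = {\<phi> \<in> G_inf I. AE s in lebesgue_on I. s \<notin> J \<longrightarrow> \<phi> s = 0}"

text \<open>Locally convex inductive limit topology: a base of neighbourhoods of \<open>0\<close> is given by the
  absolutely convex sets whose trace on each step space is a neighbourhood of \<open>0\<close> there.\<close>

definition abs_convex :: "(real \<Rightarrow> complex) set \<Rightarrow> bool" where
  "abs_convex U \<longleftrightarrow> (\<forall>\<phi>\<in>U. \<forall>\<psi>\<in>U. \<forall>u v. norm u + norm v \<le> 1
     \<longrightarrow> (\<lambda>s. u * \<phi> s + v * \<psi> s) \<in> U)"

definition test_nhd0 :: "real set \<Rightarrow> (real \<Rightarrow> complex) set \<Rightarrow> bool" where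
  "test_nhd0 I U \<longleftrightarrow> U \<subseteq> test_fun I \<and> abs_convex U \<and>
     (\<forall>J. is_interval J \<and> bounded J \<and> closure J \<subseteq> I \<longrightarrow>
        (\<exists>k. \<exists>\<epsilon>>0. {\<phi> \<in> G_inf_on I J. G_norm I k \<phi> < \<epsilon>} \<subseteq> U))"

definition test_open :: "real set \<Rightarrow> (real \<Rightarrow> complex) set \<Rightarrow> bool" where
  "test_open I W \<longleftrightarrow> W \<subseteq> test_fun I \<and>
     (\<forall>\<phi>\<in>W. \<exists>U. test_nhd0 I U \<and> (\<forall>\<psi>\<in>U. \<phi> + \<psi> \<in> W))"

definition test_topology :: "real set \<Rightarrow> (real \<Rightarrow> complex) topology" where
  "test_topology I = topology (test_open I)"

lemma test_nhd0_Int: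
  assumes "test_nhd0 I U" "test_nhd0 I V"
  shows "test_nhd0 I (U \<inter> V)"
  unfolding test_nhd0_def
proof (intro conjI allI impI)
  show "U \<inter> V \<subseteq> test_fun I" using assms by (auto simp: test_nhd0_def)
  show "abs_convex (U \<inter> V)"
    unfolding abs_convex_def
  proof (intro ballI allI impI IntI)
    fix \<phi> \<psi> and u v :: complex
    assume *: "\<phi> \<in> U \<inter> V" "\<psi> \<in> U \<inter> V" "norm u + norm v \<le> 1"
    show "(\<lambda>s. u * \<phi> s + v * \<psi> s) \<in> U"
      using assms(1) * unfolding test_nhd0_def abs_convex_def by simp
    show "(\<lambda>s. u * \<phi> s + v * \<psi> s) \<in> V"
      using assms(2) * unfolding test_nhd0_def abs_convex_def by simp
  qed
  fix J :: "real set" assume J: "is_interval J \<and> bounded J \<and> closure J \<subseteq> I"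
  obtain k e where k: "e > 0" "{\<phi> \<in> G_inf_on I J. G_norm I k \<phi> < e} \<subseteq> U"
    using assms(1) J unfolding test_nhd0_def by blast
  obtain l d where l: "d > 0" "{\<phi> \<in> G_inf_on I J. G_norm I l \<phi> < d} \<subseteq> V"
    using assms(2) J unfolding test_nhd0_def by blast
  have mono: "G_norm I i \<phi> \<le> G_norm I (max k l) \<phi>" if "i \<le> max k l" for i \<phi>
    unfolding G_norm_def using that by (intro Max_mono) auto
  have "{\<phi> \<in> G_inf_on I J. G_norm I (max k l) \<phi> < min e d} \<subseteq> U \<inter> V"
  proof
    fix \<phi> assume \<phi>: "\<phi> \<in> {\<phi> \<in> G_inf_on I J. G_norm I (max k l) \<phi> < min e d}"
    then have "G_norm I k \<phi> < e" "G_norm I l \<phi> < d"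
      using mono[of k \<phi>] mono[of l \<phi>] by simp_all
    with \<phi> show "\<phi> \<in> U \<inter> V" using k(2) l(2) by blast
  qed
  then show "\<exists>k. \<exists>\<epsilon>>0. {\<phi> \<in> G_inf_on I J. G_norm I k \<phi> < \<epsilon>} \<subseteq> U \<inter> V"
    using k(1) l(1) by (intro exI[of _ "max k l"] exI[of _ "min e d"] conjI) simp_all
qed

lemma istopology_test_open: "istopology (test_open I)"
proof -
  have "test_open I (S \<inter> T)" if S: "test_open I S" and T: "test_open I T" for S T
    unfolding test_open_def
  proof (intro conjI ballI)
    show "S \<inter> T \<subseteq> test_fun I" using S unfolding test_open_def by blast
    fix \<phi> assume \<phi>: "\<phi> \<in> S \<inter> T"
    obtain U where U: "test_nhd0 I U" "\<forall>\<psi>\<in>U. \<phi> + \<psi> \<in> S"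
      using S \<phi> unfolding test_open_def by blast
    obtain V where V: "test_nhd0 I V" "\<forall>\<psi>\<in>V. \<phi> + \<psi> \<in> T"
      using T \<phi> unfolding test_open_def by blast
    have "\<forall>\<psi>\<in>U \<inter> V. \<phi> + \<psi> \<in> S \<inter> T" using U(2) V(2) by blast
    then show "\<exists>U. test_nhd0 I U \<and> (\<forall>\<psi>\<in>U. \<phi> + \<psi> \<in> S \<inter> T)"
      using test_nhd0_Int[OF U(1) V(1)] by blast
  qed
  moreover have "test_open I (\<Union>K)" if K: "\<forall>S\<in>K. test_open I S" for K
    unfolding test_open_def
  proof (intro conjI ballI)
    show "\<Union>K \<subseteq> test_fun I" using K unfolding test_open_def by blast
    fix \<phi> assume "\<phi> \<in> \<Union>K"
    then obtain S where S: "S \<in> K" "\<phi> \<in> S" by blast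
    then obtain U where "test_nhd0 I U" "\<forall>\<psi>\<in>U. \<phi> + \<psi> \<in> S"
      using K unfolding test_open_def by blast
    with S(1) show "\<exists>U. test_nhd0 I U \<and> (\<forall>\<psi>\<in>U. \<phi> + \<psi> \<in> \<Union>K)" by blast
  qed
  ultimately show ?thesis unfolding istopology_def by simp
qed

text \<open>Functionals are given the value \<open>0\<close> off the test functions, so that equality of distributions
  is equality of functions.\<close>

definition distributions :: "real set \<Rightarrow> ((real \<Rightarrow> complex) \<Rightarrow> complex) set" where
  "distributions I = {f. (\<forall>\<phi>. \<phi> \<notin> test_fun I \<longrightarrow> f \<phi> = 0)
      \<and> (\<forall>\<phi>\<in>test_fun I. \<forall>\<psi>\<in>test_fun I. f (\<phi> + \<psi>) = f \<phi> + f \<psi>)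
      \<and> (\<forall>\<phi>\<in>test_fun I. \<forall>c. f (\<lambda>s. c * \<phi> s) = c * f \<phi>)
      \<and> continuous_map (test_topology I) euclidean f}"

definition zero_before :: "real set \<Rightarrow> real \<Rightarrow> ((real \<Rightarrow> complex) \<Rightarrow> complex) \<Rightarrow> bool" where
  "zero_before I t0 f \<longleftrightarrow> (\<forall>\<phi>\<in>test_fun I. G_supp I \<phi> \<subseteq> {..<t0} \<longrightarrow> f \<phi> = 0)"

text \<open>The product is meaningful whenever \<open>g * \<phi>\<close> is a test function for every test function \<open>\<phi>\<close>; this
  includes functions that are only locally in \<^term>\<open>G_inf I\<close>, such as unbounded classical solutions of
  differential equations.\<close>

definition dist_mult ::
  "real set \<Rightarrow> (real \<Rightarrow> complex) \<Rightarrow> ((real \<Rightarrow> complex) \<Rightarrow> complex) \<Rightarrow> ((real \<Rightarrow> complex) \<Rightarrow> complex)" where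
  "dist_mult I g f = (\<lambda>\<phi>. if \<phi> \<in> test_fun I then f (g * \<phi>) else 0)"

section \<open>The multivalued derivative\<close>

definition ess_continuous :: "real set \<Rightarrow> (real \<Rightarrow> complex) \<Rightarrow> bool" where
  "ess_continuous I g \<longleftrightarrow>
     (\<exists>h. continuous_on I h \<and> bounded (h ` I) \<and> (AE s in lebesgue_on I. g s = h s))"

text \<open>Only used for members of \<^term>\<open>G_fun I\<close>, for which the one-sided limits at the
  exceptional points exist.\<close>

definition ess_piecewise_continuous :: "real set \<Rightarrow> (real \<Rightarrow> complex) \<Rightarrow> bool" where
  "ess_piecewise_continuous I g \<longleftrightarrow>
     (\<exists>h S. finite S \<and> continuous_on (I - S) h \<and> (AE s in lebesgue_on I. g s = h s))"

definition F_k :: "real set \<Rightarrow> nat \<Rightarrow> (real \<Rightarrow> complex) set" where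
  "F_k I k = {g \<in> G_inf I. (\<forall>i. i \<noteq> k \<longrightarrow> ess_continuous I ((dG I ^^ i) g))
                \<and> ess_piecewise_continuous I ((dG I ^^ k) g)}"

definition F_span :: "real set \<Rightarrow> (real \<Rightarrow> complex) set" where
  "F_span I = module.span (\<lambda>(c::complex) g s. c * g s) (\<Union>k. F_k I k)"

definition test_fun_F :: "real set \<Rightarrow> (real \<Rightarrow> complex) set" where
  "test_fun_F I = test_fun I \<inter> F_span I"

definition Delta :: "real set \<Rightarrow> ((real \<Rightarrow> complex) \<Rightarrow> complex) set" where
  "Delta I = {g \<in> distributions I. \<exists>c::real \<Rightarrow> complex. \<forall>\<phi>\<in>test_fun_F I.
      g \<phi> = (\<Sum>t\<in>{t \<in> I. jump t \<phi> \<noteq> 0}. c t * jump t \<phi>)}"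

definition ddt :: "real set \<Rightarrow> ((real \<Rightarrow> complex) \<Rightarrow> complex) \<Rightarrow> ((real \<Rightarrow> complex) \<Rightarrow> complex)" where
  "ddt I f = (\<lambda>\<phi>. if \<phi> \<in> test_fun I then - f (dG I \<phi>) else 0)"

definition D :: "real set \<Rightarrow> ((real \<Rightarrow> complex) \<Rightarrow> complex) \<Rightarrow> ((real \<Rightarrow> complex) \<Rightarrow> complex) set" where
  "D I f = {ddt I f + \<delta> | \<delta>. \<delta> \<in> Delta I}"

section \<open>Matrices\<close>

type_synonym 'n mat_dist = "((real \<Rightarrow> complex) \<Rightarrow> complex)^'n^'n"

definition mat_distributions :: "real set \<Rightarrow> 'n::finite mat_dist set" where
  "mat_distributions I = {X. \<forall>i j. X $ i $ j \<in> distributions I}"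

definition mat_G_inf :: "real set \<Rightarrow> (real \<Rightarrow> complex^'n::finite^'n) set" where
  "mat_G_inf I = {A. \<forall>i j. (\<lambda>t. A t $ i $ j) \<in> G_inf I}"

definition mat_zero_before :: "real set \<Rightarrow> real \<Rightarrow> 'n::finite mat_dist \<Rightarrow> bool" where
  "mat_zero_before I t0 X \<longleftrightarrow> (\<forall>i j. zero_before I t0 (X $ i $ j))"

definition mat_D :: "real set \<Rightarrow> 'n::finite mat_dist \<Rightarrow> 'n mat_dist set" where
  "mat_D I X = {Y. \<forall>i j. Y $ i $ j \<in> D I (X $ i $ j)}"

definition mat_mult ::
  "real set \<Rightarrow> (real \<Rightarrow> complex^'n::finite^'n) \<Rightarrow> 'n mat_dist \<Rightarrow> 'n mat_dist" where
  "mat_mult I A X = (\<chi> i j. \<Sum>l\<in>UNIV. dist_mult I (\<lambda>t. A t $ i $ l) (X $ l $ j))"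

section \<open>The Cauchy problem\<close>

text \<open>In the witness below, \<open>DX k\<close> is the \<open>k\<close>-th derivative of \<open>X\<close>.\<close>

definition cauchy_solution ::
  "real set \<Rightarrow> nat \<Rightarrow> real \<Rightarrow> (nat \<Rightarrow> real \<Rightarrow> complex^'n::finite^'n) \<Rightarrow> 'n mat_dist \<Rightarrow> 'n mat_dist \<Rightarrow> bool" where
  "cauchy_solution I m t0 A F X \<longleftrightarrow> X \<in> mat_distributions I \<and>
     (\<exists>DX. DX 0 = X \<and> (\<forall>k<m. DX (Suc k) \<in> mat_D I (DX k))
         \<and> DX m - (\<Sum>k<m. mat_mult I (A k) (DX k)) = F
         \<and> (\<forall>k<m. mat_zero_before I t0 (DX k)))"

text \<open>Primitive of \<open>H\<close> vanishing for \<open>t < t0\<close>.\<close>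

definition primitive_from :: "real set \<Rightarrow> real \<Rightarrow> 'n::finite mat_dist \<Rightarrow> 'n mat_dist \<Rightarrow> bool" where
  "primitive_from I t0 H T \<longleftrightarrow> T \<in> mat_distributions I \<and> H \<in> mat_D I T \<and> mat_zero_before I t0 T"

section \<open>Fundamental systems\<close>

definition nderiv :: "nat \<Rightarrow> (real \<Rightarrow> 'a::real_normed_vector) \<Rightarrow> (real \<Rightarrow> 'a)" where
  "nderiv k X = ((\<lambda>f t. vector_derivative f (at t)) ^^ k) X"

text \<open>The coefficients are determined only almost everywhere but have one-sided limits everywhere, so
  a classical solution has ordinary derivatives up to order \<open>m - 1\<close>, and at every point both
  one-sided derivatives of order \<open>m\<close>, given by the equation with the one-sided limits of the
  coefficients.\<close>

definition classical_solution ::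
  "real set \<Rightarrow> nat \<Rightarrow> (nat \<Rightarrow> real \<Rightarrow> complex^'n::finite^'n) \<Rightarrow> (real \<Rightarrow> complex^'n^'n) \<Rightarrow> bool" where
  "classical_solution I m A X \<longleftrightarrow> (\<forall>t\<in>I.
     (\<forall>k. Suc k < m \<longrightarrow> nderiv k X differentiable (at t)) \<and>
     (nderiv (m - 1) X has_vector_derivative (\<Sum>k<m. rlim (A k) t ** nderiv k X t)) (at_right t) \<and>
     (nderiv (m - 1) X has_vector_derivative (\<Sum>k<m. llim (A k) t ** nderiv k X t)) (at_left t))"

text \<open>An \<open>m \<times> m\<close> block matrix is a function of the block row and the block column, both
  counted from \<open>0\<close>.\<close>

definition is_block_inverse ::
  "nat \<Rightarrow> (nat \<Rightarrow> nat \<Rightarrow> complex^'n::finite^'n) \<Rightarrow> (nat \<Rightarrow> nat \<Rightarrow> complex^'n^'n) \<Rightarrow> bool" where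
  "is_block_inverse m R S \<longleftrightarrow> (\<forall>i<m. \<forall>j<m.
      (\<Sum>l<m. R i l ** S l j) = (if i = j then mat 1 else 0) \<and>
      (\<Sum>l<m. S i l ** R l j) = (if i = j then mat 1 else 0))"

definition block_invertible :: "nat \<Rightarrow> (nat \<Rightarrow> nat \<Rightarrow> complex^'n::finite^'n) \<Rightarrow> bool" where
  "block_invertible m R \<longleftrightarrow> (\<exists>S. is_block_inverse m R S)"

definition block_inverse ::
  "nat \<Rightarrow> (nat \<Rightarrow> nat \<Rightarrow> complex^'n::finite^'n) \<Rightarrow> (nat \<Rightarrow> nat \<Rightarrow> complex^'n^'n)" where
  "block_inverse m R = (SOME S. is_block_inverse m R S)"

definition wronski :: "(nat \<Rightarrow> real \<Rightarrow> complex^'n::finite^'n) \<Rightarrow> real \<Rightarrow> nat \<Rightarrow> nat \<Rightarrow> complex^'n^'n" where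
  "wronski Xs t = (\<lambda>k i. nderiv k (Xs i) t)"

definition fundamental_system ::
  "real set \<Rightarrow> nat \<Rightarrow> (nat \<Rightarrow> real \<Rightarrow> complex^'n::finite^'n) \<Rightarrow> (nat \<Rightarrow> real \<Rightarrow> complex^'n^'n) \<Rightarrow> bool" where
  "fundamental_system I m A Xs \<longleftrightarrow> (\<forall>i<m. classical_solution I m A (Xs i)) \<and>
     (\<forall>t\<in>I. block_invertible m (wronski Xs t))"

text \<open>\<open>Zcoef m Xs i\<close> is the \<open>i\<close>-th block of the last block column of the inverse of the Wronski
  matrix: with the derivatives of order \<open>m - 1\<close> in the last block row, the inhomogeneity enters the
  equivalent first-order system in its last block row. The first column would be correct only for
  \<open>m = 1\<close>, where the two coincide.\<close>

definition Zcoef ::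
  "nat \<Rightarrow> (nat \<Rightarrow> real \<Rightarrow> complex^'n::finite^'n) \<Rightarrow> nat \<Rightarrow> real \<Rightarrow> complex^'n^'n" where
  "Zcoef m Xs i t = block_inverse m (wronski Xs t) i (m - 1)"

end

theory Submission
  imports Defs
begin

text \<open>
  A distribution lies in \<^const>\<open>Delta\<close> exactly when it vanishes on all test functions without jumps
  (their derivatives may jump): splines with finitely many jumps are dense, and each is a bounded smooth
  function plus pieces with a single jump of a single order. Hence \<open>g \<in> D I f\<close> means \<open>g \<psi> = - f \<psi>'\<close> for
  jump-free \<open>\<psi>\<close>, which gives the product rule for continuous multipliers. A distribution \<open>H\<close> vanishing before
  \<^term>\<open>t0\<close> has exactly one primitive vanishing there, \<open>\<phi> \<longmapsto> - H (\<integral> (\<phi> - (\<integral>\<phi>) e))\<close> with a unit mass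
  \<open>e\<close> placed before \<^term>\<open>t0\<close>.

  The equation is equivalent to a first-order system \<open>v' = B v + f\<close>. With the Wronski matrix \<open>R\<close> and \<open>S = R^-1\<close>,
  which satisfies \<open>S' = - S B\<close>, variation of constants turns the system into \<open>(S v)' = S f\<close>, so that
  \<open>T = S v\<close> is the primitive of \<open>S f\<close> and \<open>v = R T\<close>.
\<close>

section \<open>Essential one-sided limits\<close>

text \<open>\<open>Delta\<close> is tested only on \<open>test_fun_F\<close>, which is spanned by
  functions all of whose derivatives are bounded on the whole of \<open>I\<close>, and its
  coefficients are arbitrary. Two obstacles follow. A jump-free test function must be approximated
  by splines that are jump-free themselves, since otherwise the unknown coefficients enter; a direct
  approximation fails here, while approximating the derivative and integrating succeeds. And a piece
  with a single jump must be bounded with all its derivatives even when \<open>I\<close> is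
  unbounded. A truncated polynomial is not, and cutting it off again would create new jumps; a
  smooth decaying correction is the way out. The coefficients of the equation may jump, and a
  multiplier with a jump cannot be moved under the derivative, because its product with a jump-free
  test function need not be jump-free. Only \<open>R\<close> and \<open>S\<close> are moved, and
  both are continuous. For \<open>S\<close>, which is given merely as a pointwise inverse, this
  comes from the adjoint system.\<close>

definition side :: "bool \<Rightarrow> real \<Rightarrow> real \<Rightarrow> real set" where
  "side b t d = (if b then {t<..<t+d} else {t-d<..<t})"

definition at_side :: "bool \<Rightarrow> real \<Rightarrow> real filter" where
  "at_side b t = (if b then at_right t else at_left t)"

text \<open>The Boolean names the side, \<open>True\<close> for the right, so that each argument
  about one-sided limits is written once.\<close>

definition es :: "bool \<Rightarrow> real \<Rightarrow> real filter" where
  "es b t = (if b then ess_at_right t else ess_at_left t)"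

definition slim :: "bool \<Rightarrow> (real \<Rightarrow> complex) \<Rightarrow> real \<Rightarrow> complex" where
  "slim b g t = Lim (es b t) g"

lemma rlim_slim: "rlim g t = slim True g t" and llim_slim: "llim g t = slim False g t"
  by (simp_all add: rlim_def llim_def slim_def es_def)

lemma jump_slim: "jump t g = slim True g t - slim False g t"
  by (simp add: jump_def rlim_slim llim_slim)

lemma side_mono: "d \<le> e \<Longrightarrow> side b t d \<subseteq> side b t e"
  by (auto simp: side_def)

lemma eventually_at_side: "eventually P (at_side b t) \<longleftrightarrow> (\<exists>d>0. \<forall>s\<in>side b t d. P s)"
proof (cases b)
  case True
  have "(\<exists>e>t. \<forall>y>t. y < e \<longrightarrow> P y) \<longleftrightarrow> (\<exists>d>0. \<forall>s\<in>{t<..<t+d}. P s)"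
  proof
    assume "\<exists>e>t. \<forall>y>t. y < e \<longrightarrow> P y"
    then obtain e where "e > t" "\<forall>y>t. y < e \<longrightarrow> P y" by blast
    then show "\<exists>d>0. \<forall>s\<in>{t<..<t+d}. P s" by (intro exI[of _ "e - t"]) auto
  next
    assume "\<exists>d>0. \<forall>s\<in>{t<..<t+d}. P s"
    then obtain d where "d > 0" "\<forall>s\<in>{t<..<t+d}. P s" by blast
    then show "\<exists>e>t. \<forall>y>t. y < e \<longrightarrow> P y" by (intro exI[of _ "t + d"]) auto
  qed
  then show ?thesis using True by (simp add: at_side_def side_def eventually_at_right_field)
next
  case False
  have "(\<exists>e<t. \<forall>y>e. y < t \<longrightarrow> P y) \<longleftrightarrow> (\<exists>d>0. \<forall>s\<in>{t-d<..<t}. P s)"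
  proof
    assume "\<exists>e<t. \<forall>y>e. y < t \<longrightarrow> P y"
    then obtain e where "e < t" "\<forall>y>e. y < t \<longrightarrow> P y" by blast
    then show "\<exists>d>0. \<forall>s\<in>{t-d<..<t}. P s" by (intro exI[of _ "t - e"]) auto
  next
    assume "\<exists>d>0. \<forall>s\<in>{t-d<..<t}. P s"
    then obtain d where "d > 0" "\<forall>s\<in>{t-d<..<t}. P s" by blast
    then show "\<exists>e<t. \<forall>y>e. y < t \<longrightarrow> P y" by (intro exI[of _ "t - d"]) auto
  qed
  then show ?thesis using False by (simp add: at_side_def side_def eventually_at_left_field)
qed

lemma es_inf: "es b t = inf (at_side b t) (ae_filter lebesgue)"
  by (simp add: es_def at_side_def ess_at_right_def ess_at_left_def)

lemma es_le: "es b t \<le> at_side b t"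
  by (simp add: es_inf)

lemma eventually_es:
  "eventually P (es b t) \<longleftrightarrow> (\<exists>d>0. AE s in lebesgue. s \<in> side b t d \<longrightarrow> P s)"
proof
  assume "eventually P (es b t)"
  then obtain Q R where Q: "eventually Q (at_side b t)" and R: "AE s in lebesgue. R s"
    and QR: "\<forall>s. Q s \<and> R s \<longrightarrow> P s" unfolding es_inf eventually_inf by blast
  then obtain d where d: "d > 0" "\<forall>s\<in>side b t d. Q s" unfolding eventually_at_side by blast
  from R have "AE s in lebesgue. s \<in> side b t d \<longrightarrow> P s" by eventually_elim (use QR d in blast)
  with d show "\<exists>d>0. AE s in lebesgue. s \<in> side b t d \<longrightarrow> P s" by blast
next
  assume "\<exists>d>0. AE s in lebesgue. s \<in> side b t d \<longrightarrow> P s"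
  then obtain d where d: "d > 0" "AE s in lebesgue. s \<in> side b t d \<longrightarrow> P s" by blast
  then have "eventually (\<lambda>s. s \<in> side b t d) (at_side b t)" unfolding eventually_at_side by blast
  with d show "eventually P (es b t)" unfolding es_inf eventually_inf by blast
qed

lemma side_not_null: "d > 0 \<Longrightarrow> \<not> (AE s in lebesgue. s \<notin> side b t d)"
proof
  assume d: "d > 0" and "AE s in lebesgue. s \<notin> side b t d"
  moreover have "side b t d \<in> sets lebesgue" by (simp add: side_def)
  ultimately have "emeasure lebesgue (side b t d) = 0"
    by (subst (asm) AE_iff_measurable[of "side b t d"]) auto
  then show False using d by (auto simp: side_def split: if_splits)
qed

text \<open>A null set cannot exhaust a one-sided interval, which has positive measure. Uniqueness
  of essential limits rests on this.\<close>

lemma es_ne [simp]: "es b t \<noteq> bot"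
proof
  assume "es b t = bot"
  then have "eventually (\<lambda>_. False) (es b t)" by simp
  then show False unfolding eventually_es using side_not_null by force
qed

lemma slimI: "(g \<longlongrightarrow> l) (es b t) \<Longrightarrow> slim b g t = l"
  unfolding slim_def by (rule tendsto_Lim) simp_all

lemma side_in_open:
  assumes "open U" "t \<in> U"
  obtains d where "d > 0" "\<And>b. side b t d \<subseteq> U" "{t-d<..<t+d} \<subseteq> U"
proof -
  obtain e where "e > 0" "ball t e \<subseteq> U" using assms open_contains_ball by blast
  then have "{t-e<..<t+e} \<subseteq> U" by (simp add: ball_eq_greaterThanLessThan)
  then have "side b t e \<subseteq> U" for b using \<open>e > 0\<close> by (auto simp: side_def)
  then show thesis using that \<open>e > 0\<close> \<open>{t-e<..<t+e} \<subseteq> U\<close> by blast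
qed

lemma eventually_es_open:
  assumes "open U" "t \<in> U" "AE s in lebesgue. s \<in> U \<longrightarrow> P s"
  shows "eventually P (es b t)"
proof -
  obtain d where "d > 0" "side b t d \<subseteq> U" using side_in_open[OF assms(1,2)] by metis
  then show ?thesis unfolding eventually_es using assms(3)
    by (intro exI[of _ d] conjI) (auto elim: eventually_mono)
qed

text \<open>Every point of an open set lies in a compact interval with rational ends inside the set.
  There are only countably many of these, so their exceptional sets unite to a null set.\<close>

lemma AE_open_rat:
  fixes U :: "real set"
  assumes "open U" and P: "\<And>c d. c \<le> d \<Longrightarrow> {c..d} \<subseteq> U \<Longrightarrow> AE s in lebesgue. s \<in> {c..d} \<longrightarrow> P s"
  shows "AE s in lebesgue. s \<in> U \<longrightarrow> P s"
proof -
  have "AE s in lebesgue. \<forall>c\<in>\<rat>. \<forall>d\<in>\<rat>. c \<le> d \<and> {c..d} \<subseteq> U \<longrightarrow> s \<in> {c..d} \<longrightarrow> P s"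
  proof (subst AE_ball_countable[OF countable_rat], intro ballI,
         subst AE_ball_countable[OF countable_rat], intro ballI)
    fix c d :: real
    show "AE s in lebesgue. c \<le> d \<and> {c..d} \<subseteq> U \<longrightarrow> s \<in> {c..d} \<longrightarrow> P s"
      using P[of c d] by (cases "c \<le> d \<and> {c..d} \<subseteq> U") auto
  qed
  then show ?thesis
  proof eventually_elim
    case (elim s)
    show ?case
    proof
      assume "s \<in> U"
      then obtain e where e: "e > 0" "{s-e<..<s+e} \<subseteq> U" using side_in_open[OF assms(1)] by metis
      obtain c where c: "c \<in> \<rat>" "s - e < c" "c < s" using Rats_dense_in_real[of "s-e" s] e by auto
      obtain d where d: "d \<in> \<rat>" "s < d" "d < s + e" using Rats_dense_in_real[of s "s+e"] e by auto
      have "{c..d} \<subseteq> U" using c d e(2) by (force)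
      then show "P s" using elim c d by auto
    qed
  qed
qed

text \<open>Bisection on a compact interval: the exceptional sets of two adjacent intervals unite,
  and near a point the two one-sided hypotheses cover everything except the point itself, which is
  null.\<close>

lemma es_local_AE:
  assumes "open U" and ev: "\<And>t b. t \<in> U \<Longrightarrow> eventually P (es b t)"
  shows "AE s in lebesgue. s \<in> U \<longrightarrow> P s"
proof (rule AE_open_rat[OF assms(1)])
  fix c d :: real assume cd: "c \<le> d" "{c..d} \<subseteq> U"
  from cd(1) show "AE s in lebesgue. s \<in> {c..d} \<longrightarrow> P s"
  proof (induction rule: Bolzano)
    case (trans a b c)
    from trans(1,2) show ?case by eventually_elim auto
  next
    case (local x)
    have xU: "x \<in> U" using local cd by auto
    obtain d1 where d1: "d1 > 0" "AE s in lebesgue. s \<in> side True x d1 \<longrightarrow> P s"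
      using ev[OF xU, of True] unfolding eventually_es by blast
    obtain d2 where d2: "d2 > 0" "AE s in lebesgue. s \<in> side False x d2 \<longrightarrow> P s"
      using ev[OF xU, of False] unfolding eventually_es by blast
    have ne: "AE s in lebesgue. s \<noteq> x"
      by (rule AE_I'[of "{x}"]) auto
    show ?case
    proof (intro exI[of _ "min d1 d2"] conjI allI impI)
      show "0 < min d1 d2" using d1 d2 by simp
      fix a b assume ab: "a \<le> x \<and> x \<le> b \<and> b - a < min d1 d2"
      from d1(2) d2(2) ne show "AE s in lebesgue. s \<in> {a..b} \<longrightarrow> P s"
        by eventually_elim (use ab in \<open>auto simp: side_def\<close>)
    qed
  qed
qed

text \<open>The exceptional sets for the countably many bounds \<open>1 / Suc n\<close> unite to a
  null set. One-sided limits thus determine the class of a function, which later makes derivatives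
  unique.\<close>

lemma AE_eq_of_slim:
  assumes "open U" and lim: "\<And>t b. t \<in> U \<Longrightarrow> (u \<longlongrightarrow> (0::complex)) (es b t)"
  shows "AE s in lebesgue. s \<in> U \<longrightarrow> u s = 0"
proof -
  have "AE s in lebesgue. s \<in> U \<longrightarrow> norm (u s) < 1 / Suc n" for n
  proof (rule es_local_AE[OF assms(1)])
    fix t b assume "t \<in> U"
    show "eventually (\<lambda>s. norm (u s) < 1 / Suc n) (es b t)"
      using tendstoD[OF lim[OF \<open>t \<in> U\<close>], of "1 / Suc n" b] by simp
  qed
  then have "AE s in lebesgue. \<forall>n. s \<in> U \<longrightarrow> norm (u s) < 1 / Suc n"
    by (subst AE_all_countable) blast
  then show ?thesis
  proof eventually_elim
    case (elim s)
    show ?case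
    proof
      assume "s \<in> U"
      then have "norm (u s) < 1 / Suc n" for n using elim by blast
      then have "norm (u s) \<le> 0"
        using nat_approx_posE[of "norm (u s)"] by (metis less_asym not_le)
      then show "u s = 0" by simp
    qed
  qed
qed

text \<open>Near each point the two limits bound the function, and bisection spreads the bound over
  the compact interval.\<close>

lemma AE_bounded_of_es:
  assumes "c \<le> d" and lim: "\<And>t b. t \<in> {c..d} \<Longrightarrow> \<exists>l::complex. (g \<longlongrightarrow> l) (es b t)"
  shows "\<exists>M\<ge>0. AE s in lebesgue. s \<in> {c..d} \<longrightarrow> norm (g s) \<le> M"
  using assms(1)
proof (induction rule: Bolzano)
  case (trans a b c)
  then obtain M N where MN: "M \<ge> 0" "N \<ge> 0"
    and *: "AE s in lebesgue. s \<in> {a..b} \<longrightarrow> norm (g s) \<le> M"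
    "AE s in lebesgue. s \<in> {b..c} \<longrightarrow> norm (g s) \<le> N" by blast
  from * have "AE s in lebesgue. s \<in> {a..c} \<longrightarrow> norm (g s) \<le> max M N"
    by eventually_elim auto
  then show ?case using MN by (intro exI[of _ "max M N"]) auto
next
  case (local x)
  have "\<exists>d M. d > 0 \<and> (AE s in lebesgue. s \<in> side b x d \<longrightarrow> norm (g s) \<le> M)" for b
  proof -
    obtain l where "(g \<longlongrightarrow> l) (es b x)" using lim[of x b] local by auto
    then have "eventually (\<lambda>s. dist (g s) l < 1) (es b x)" by (rule tendstoD) simp
    then have "eventually (\<lambda>s. norm (g s) \<le> norm l + 1) (es b x)"
    proof (rule eventually_mono)
      fix s assume "dist (g s) l < 1"
      then show "norm (g s) \<le> norm l + 1" using norm_triangle_sub[of "g s" l] by (simp add: dist_norm)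
    qed
    then show ?thesis unfolding eventually_es by blast
  qed
  then obtain d M where dM: "\<And>b. d b > 0" "\<And>b. AE s in lebesgue. s \<in> side b x (d b) \<longrightarrow> norm (g s) \<le> M b"
    by metis
  have ne: "AE s in lebesgue. s \<noteq> x" by (rule AE_I'[of "{x}"]) auto
  show ?case
  proof (rule exI[of _ "min (d True) (d False)"], intro conjI allI impI)
    show "0 < min (d True) (d False)" using dM by simp
    fix a b assume ab: "a \<le> x \<and> x \<le> b \<and> b - a < min (d True) (d False)"
    have "AE s in lebesgue. s \<in> {a..b} \<longrightarrow> norm (g s) \<le> max (M True) (max (M False) 0)"
      using dM(2)[of True] dM(2)[of False] ne
      by eventually_elim (use ab in \<open>auto simp: side_def\<close>)
    then show "\<exists>M\<ge>0. AE s in lebesgue. s \<in> {a..b} \<longrightarrow> norm (g s) \<le> M"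
      by (intro exI[of _ "max (M True) (max (M False) 0)"]) auto
  qed
qed

text \<open>Along the essential filter a continuous function has its ordinary limits, because the filter is
  nontrivial at every point.\<close>

lemma AE_le_continuous:
  fixes f :: "real \<Rightarrow> real"
  assumes "open U" "continuous_on U f" "AE s in lebesgue. s \<in> U \<longrightarrow> f s \<le> C" "t \<in> U"
  shows "f t \<le> C"
proof -
  have "(f \<longlongrightarrow> f t) (at t)" using assms by (simp add: continuous_on_eq_continuous_at isContD)
  moreover have "es True t \<le> at t" using es_le[of True t]
    by (simp add: at_side_def) (meson at_le order.trans subset_UNIV)
  ultimately have "(f \<longlongrightarrow> f t) (es True t)" by (meson tendsto_mono)
  then show ?thesis
    using eventually_es_open[OF assms(1,4,3)] by (rule tendsto_upperbound) simp
qed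

lemma has_vector_derivative_scaleR_quotient:
  fixes f :: "real \<Rightarrow> 'a::real_normed_vector"
  shows "(f has_vector_derivative l) (at x within S) \<longleftrightarrow> ((\<lambda>y. (f y - f x) /\<^sub>R (y - x)) \<longlongrightarrow> l) (at x within S)"
proof -
  have "(f has_vector_derivative l) (at x within S) \<longleftrightarrow>
      ((\<lambda>y. norm (f y - f x - (y - x) *\<^sub>R l) / norm (y - x)) \<longlongrightarrow> 0) (at x within S)"
    by (simp add: has_vector_derivative_def has_derivative_iff_norm bounded_linear_scaleR_left)
  also have "\<dots> \<longleftrightarrow> ((\<lambda>y. norm ((f y - f x) /\<^sub>R (y - x) - l)) \<longlongrightarrow> 0) (at x within S)"
  proof (rule tendsto_cong)
    have "norm (f y - f x - (y - x) *\<^sub>R l) / norm (y - x) = norm ((f y - f x) /\<^sub>R (y - x) - l)"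
      if "y \<noteq> x" for y
    proof -
      have "(f y - f x) /\<^sub>R (y - x) - l = (f y - f x - (y - x) *\<^sub>R l) /\<^sub>R (y - x)"
        using that by (simp add: scaleR_diff_right)
      then show ?thesis by (simp add: divide_inverse mult.commute)
    qed
    then show "\<forall>\<^sub>F y in at x within S. norm (f y - f x - (y - x) *\<^sub>R l) / norm (y - x)
        = norm ((f y - f x) /\<^sub>R (y - x) - l)"
      by (simp add: eventually_at_filter)
  qed
  also have "\<dots> \<longleftrightarrow> ((\<lambda>y. (f y - f x) /\<^sub>R (y - x)) \<longlongrightarrow> l) (at x within S)"
    by (simp only: tendsto_norm_zero_iff LIM_zero_iff)
  finally show ?thesis .
qed

lemma has_vector_derivative_quotient:
  fixes f :: "real \<Rightarrow> complex"
  shows "(f has_vector_derivative l) (at x within S) \<longleftrightarrow>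
    ((\<lambda>y. (f y - f x) / of_real (y - x)) \<longlongrightarrow> l) (at x within S)"
proof -
  have "(f y - f x) / of_real (y - x) = (f y - f x) /\<^sub>R (y - x)" for y
    by (simp add: scaleR_conv_of_real divide_inverse mult.commute)
  then show ?thesis by (simp only: has_vector_derivative_scaleR_quotient)
qed

section \<open>Regulated functions and their derivatives\<close>

locale open_interval =
  fixes I :: "real set" and t0 :: real
  assumes opn: "open I" and itv: "is_interval I" and t0: "t0 \<in> I"
begin

text \<open>\<open>G_fun\<close> without the global essential bound; on compact subintervals of
  \<open>I\<close> a bound comes for free from \<open>AE_bounded_of_es\<close>.\<close>

definition regulated :: "(real \<Rightarrow> complex) \<Rightarrow> bool" where
  "regulated g \<longleftrightarrow> g \<in> borel_measurable (lebesgue_on I) \<and> (\<forall>t\<in>I. \<forall>b. \<exists>l. (g \<longlongrightarrow> l) (es b t))"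

definition der :: "(real \<Rightarrow> complex) \<Rightarrow> (real \<Rightarrow> complex) \<Rightarrow> bool" where
  "der g h \<longleftrightarrow> regulated g \<and> regulated h \<and>
     (\<forall>t\<in>I. \<forall>b. ((\<lambda>s. (g s - slim b g t) / of_real (s - t)) \<longlongrightarrow> slim b h t) (es b t))"

text \<open>The bounds required in \<^const>\<open>G_inf\<close> are dropped: classical solutions may be unbounded on \<^term>\<open>I\<close>,
  but they still multiply test functions.\<close>

definition smooth :: "(real \<Rightarrow> complex) \<Rightarrow> bool" where
  "smooth g \<longleftrightarrow> (\<exists>d. d 0 = g \<and> (\<forall>k::nat. der (d k) (d (Suc k))))"

lemma Icc_sub: "c \<in> I \<Longrightarrow> d \<in> I \<Longrightarrow> {c..d} \<subseteq> I"
  using mem_is_interval_1_I[OF itv] by (meson atLeastAtMost_iff subsetI)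

lemma I_lebesgue [measurable, simp]: "I \<in> sets lebesgue"
  using opn by (simp add: borel_open)

lemma AE_on: "(AE s in lebesgue_on I. P s) \<longleftrightarrow> (AE s in lebesgue. s \<in> I \<longrightarrow> P s)"
  by (subst AE_restrict_space_iff) auto

lemma regulated_lim: "regulated g \<Longrightarrow> t \<in> I \<Longrightarrow> (g \<longlongrightarrow> slim b g t) (es b t)"
  using slimI unfolding regulated_def by metis

lemma derD:
  assumes "der g h"
  shows "regulated g" "regulated h"
    "t \<in> I \<Longrightarrow> ((\<lambda>s. (g s - slim b g t) / of_real (s - t)) \<longlongrightarrow> slim b h t) (es b t)"
  using assms unfolding der_def by auto

section \<open>Closure properties and the rules of differentiation\<close>

lemma regulated_const: "regulated (\<lambda>_. c)"
  unfolding regulated_def by (auto intro!: exI tendsto_const)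

lemma regulated_meas: "regulated g \<Longrightarrow> g \<in> borel_measurable (lebesgue_on I)"
  by (simp add: regulated_def)

lemma regI:
  "g \<in> borel_measurable (lebesgue_on I) \<Longrightarrow> (\<And>t b. t \<in> I \<Longrightarrow> (g \<longlongrightarrow> l b t) (es b t)) \<Longrightarrow> regulated g"
  unfolding regulated_def by blast

lemma regulated_add:
  assumes "regulated f" "regulated g" shows "regulated (\<lambda>s. f s + g s)"
proof (rule regI)
  show "(\<lambda>s. f s + g s) \<in> borel_measurable (lebesgue_on I)"
    by (intro borel_measurable_add regulated_meas assms)
  show "((\<lambda>s. f s + g s) \<longlongrightarrow> slim b f t + slim b g t) (es b t)" if "t \<in> I" for t b
    by (intro tendsto_add regulated_lim assms that)
qed

lemma regulated_mult:
  assumes "regulated f" "regulated g" shows "regulated (\<lambda>s. f s * g s)"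
proof (rule regI)
  show "(\<lambda>s. f s * g s) \<in> borel_measurable (lebesgue_on I)"
    by (intro borel_measurable_times regulated_meas assms)
  show "((\<lambda>s. f s * g s) \<longlongrightarrow> slim b f t * slim b g t) (es b t)" if "t \<in> I" for t b
    by (intro tendsto_mult regulated_lim assms that)
qed

lemma regulated_diff:
  assumes "regulated f" "regulated g" shows "regulated (\<lambda>s. f s - g s)"
proof (rule regI)
  show "(\<lambda>s. f s - g s) \<in> borel_measurable (lebesgue_on I)"
    by (intro borel_measurable_diff regulated_meas assms)
  show "((\<lambda>s. f s - g s) \<longlongrightarrow> slim b f t - slim b g t) (es b t)" if "t \<in> I" for t b
    by (intro tendsto_diff regulated_lim assms that)
qed

lemma slim_const: "slim b (\<lambda>_. c) t = c"
  by (rule slimI) simp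

lemma slim_add: "regulated f \<Longrightarrow> regulated g \<Longrightarrow> t \<in> I \<Longrightarrow> slim b (\<lambda>s. f s + g s) t = slim b f t + slim b g t"
  by (intro slimI tendsto_add regulated_lim)

lemma slim_diff: "regulated f \<Longrightarrow> regulated g \<Longrightarrow> t \<in> I \<Longrightarrow> slim b (\<lambda>s. f s - g s) t = slim b f t - slim b g t"
  by (intro slimI tendsto_diff regulated_lim)

lemma slim_mult: "regulated f \<Longrightarrow> regulated g \<Longrightarrow> t \<in> I \<Longrightarrow> slim b (\<lambda>s. f s * g s) t = slim b f t * slim b g t"
  by (intro slimI tendsto_mult regulated_lim)

lemma slim_cmult: "regulated g \<Longrightarrow> t \<in> I \<Longrightarrow> slim b (\<lambda>s. c * g s) t = c * slim b g t"
  by (intro slimI tendsto_mult tendsto_const regulated_lim)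

lemma slim_cong:
  assumes "open U" "t \<in> U" "AE s in lebesgue. s \<in> U \<longrightarrow> f s = g s"
  shows "slim b f t = slim b g t"
proof -
  have ev: "eventually (\<lambda>s. f s = g s) (es b t)" using eventually_es_open[OF assms] .
  \<comment> \<open>\<open>Lim\<close> is a description of the limit, so having the same limits
    makes the values agree also where no limit exists.\<close>
  have "(f \<longlongrightarrow> l) (es b t) \<longleftrightarrow> (g \<longlongrightarrow> l) (es b t)" for l by (rule tendsto_cong[OF ev])
  then show ?thesis by (simp add: slim_def t2_space_class.Lim_def)
qed

lemma der_const: "der (\<lambda>_. c) (\<lambda>_. 0)"
  unfolding der_def by (simp add: regulated_const slim_const)

lemma der_add:
  assumes "der f f'" "der g g'"
  shows "der (\<lambda>s. f s + g s) (\<lambda>s. f' s + g' s)"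
  unfolding der_def
proof (intro conjI ballI allI)
  show "regulated (\<lambda>s. f s + g s)" "regulated (\<lambda>s. f' s + g' s)" by (rule regulated_add; rule derD(1)[OF assms(1)] derD(2)[OF assms(1)] derD(1)[OF assms(2)] derD(2)[OF assms(2)])+
  fix t b assume t: "t \<in> I"
  have "((\<lambda>s. (f s - slim b f t) / of_real (s - t) + (g s - slim b g t) / of_real (s - t))
      \<longlongrightarrow> slim b f' t + slim b g' t) (es b t)"
    by (intro tendsto_add derD(3) assms t)
  then show "((\<lambda>s. (f s + g s - slim b (\<lambda>s. f s + g s) t) / of_real (s - t))
      \<longlongrightarrow> slim b (\<lambda>s. f' s + g' s) t) (es b t)"
    using assms[THEN derD(1)] assms[THEN derD(2)] t
    by (simp add: slim_add add_divide_distrib diff_divide_distrib algebra_simps)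
qed

lemma der_mult:
  assumes "der f f'" "der g g'"
  shows "der (\<lambda>s. f s * g s) (\<lambda>s. f' s * g s + f s * g' s)"
  unfolding der_def
proof (intro conjI ballI allI)
  note [simp] = assms[THEN derD(1)] assms[THEN derD(2)]
  show "regulated (\<lambda>s. f s * g s)" "regulated (\<lambda>s. f' s * g s + f s * g' s)" by (simp_all add: regulated_mult regulated_add)
  fix t b assume t: "t \<in> I"
  have "((\<lambda>s. (f s - slim b f t) / of_real (s - t) * g s + slim b f t * ((g s - slim b g t) / of_real (s - t)))
      \<longlongrightarrow> slim b f' t * slim b g t + slim b f t * slim b g' t) (es b t)"
    by (intro tendsto_add tendsto_mult tendsto_const derD(3) regulated_lim assms t) simp
  moreover have "(f s - slim b f t) / of_real (s - t) * g s + slim b f t * ((g s - slim b g t) / of_real (s - t))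
      = (f s * g s - slim b f t * slim b g t) / of_real (s - t)" for s
    by (simp add: add_divide_distrib[symmetric] algebra_simps)
  ultimately show "((\<lambda>s. (f s * g s - slim b (\<lambda>s. f s * g s) t) / of_real (s - t))
      \<longlongrightarrow> slim b (\<lambda>s. f' s * g s + f s * g' s) t) (es b t)"
    using t by (simp add: slim_mult slim_add regulated_mult)
qed

lemma der_cmult: "der f f' \<Longrightarrow> der (\<lambda>s. c * f s) (\<lambda>s. c * f' s)"
  using der_mult[OF der_const[of c]] by simp

lemma der_diff: "der f f' \<Longrightarrow> der g g' \<Longrightarrow> der (\<lambda>s. f s - g s) (\<lambda>s. f' s - g' s)"
  using der_add[OF _ der_cmult[of g g' "-1"]] by simp

lemma der_sum:
  "(\<And>a. a \<in> K \<Longrightarrow> der (f a) (f' a)) \<Longrightarrow> der (\<lambda>s. \<Sum>a\<in>K. f a s) (\<lambda>s. \<Sum>a\<in>K. f' a s)"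
  by (induction K rule: infinite_finite_induct) (simp_all add: der_const der_add)

text \<open>Both derivatives get their one-sided limits from the same quotients, and limits
  determine a class. This locality keeps the support of a derivative inside that of the
  function.\<close>

lemma der_cong_on:
  assumes "der f f'" "der g g'" "open U" "U \<subseteq> I" "AE s in lebesgue. s \<in> U \<longrightarrow> f s = g s"
  shows "AE s in lebesgue. s \<in> U \<longrightarrow> f' s = g' s"
proof -
  have "AE s in lebesgue. s \<in> U \<longrightarrow> f' s - g' s = 0"
  proof (rule AE_eq_of_slim[OF assms(3)])
    fix t b assume t: "t \<in> U"
    then have tI: "t \<in> I" using assms(4) by blast
    have ev: "eventually (\<lambda>s. f s = g s) (es b t)" using eventually_es_open[OF assms(3) t assms(5)] .
    have eq: "slim b f t = slim b g t" using slim_cong[OF assms(3) t assms(5)] .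
    have "((\<lambda>s. (f s - slim b f t) / of_real (s - t)) \<longlongrightarrow> slim b g' t) (es b t)"
    proof (rule Lim_transform_eventually[OF derD(3)[OF assms(2) tI]])
      show "\<forall>\<^sub>F s in es b t. (g s - slim b g t) / complex_of_real (s - t) = (f s - slim b f t) / complex_of_real (s - t)"
        using ev by eventually_elim (simp add: eq)
    qed
    then have "slim b f' t = slim b g' t"
      using derD(3)[OF assms(1) tI] tendsto_unique[OF es_ne] by blast
    then show "((\<lambda>s. f' s - g' s) \<longlongrightarrow> 0) (es b t)"
      using tendsto_diff[OF regulated_lim[OF derD(2)[OF assms(1)] tI, of b] regulated_lim[OF derD(2)[OF assms(2)] tI, of b]]
      by simp
  qed
  then show ?thesis by simp
qed

lemma der_unique: "der g h \<Longrightarrow> der g k \<Longrightarrow> AE s in lebesgue. s \<in> I \<longrightarrow> h s = k s"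
  using der_cong_on[of g h g k I] opn by simp

lemma der_cong:
  assumes "der f f'" "AE s in lebesgue. s \<in> I \<longrightarrow> f s = g s" "AE s in lebesgue. s \<in> I \<longrightarrow> f' s = g' s"
    "regulated g" "regulated g'"
  shows "der g g'"
  unfolding der_def
proof (intro conjI ballI allI assms(4,5))
  fix t b assume t: "t \<in> I"
  have ev: "eventually (\<lambda>s. f s = g s) (es b t)" using eventually_es_open[OF opn t assms(2)] .
  have "((\<lambda>s. (g s - slim b g t) / of_real (s - t)) \<longlongrightarrow> slim b f' t) (es b t)"
  proof (rule Lim_transform_eventually[OF derD(3)[OF assms(1) t]])
    show "\<forall>\<^sub>F s in es b t. (f s - slim b f t) / complex_of_real (s - t) = (g s - slim b g t) / complex_of_real (s - t)"
      using ev by eventually_elim (simp add: slim_cong[OF opn t assms(2)])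
  qed
  then show "((\<lambda>s. (g s - slim b g t) / of_real (s - t)) \<longlongrightarrow> slim b g' t) (es b t)"
    by (simp add: slim_cong[OF opn t assms(3)])
qed

section \<open>Comparison with ordinary derivatives\<close>

lemma regulated_continuous:
  assumes "continuous_on I g" shows "regulated g" and "t \<in> I \<Longrightarrow> slim b g t = g t"
proof -
  have *: "(g \<longlongrightarrow> g t) (es b t)" if "t \<in> I" for t b
  proof -
    have "(g \<longlongrightarrow> g t) (at t)" using assms that opn by (simp add: continuous_on_eq_continuous_at isContD)
    moreover have "at_side b t \<le> at t" by (simp add: at_side_def at_le)
    ultimately show ?thesis by (meson es_le tendsto_mono)
  qed
  show "regulated g" unfolding regulated_def
    using * continuous_imp_measurable_on_sets_lebesgue[OF assms] by auto
  show "t \<in> I \<Longrightarrow> slim b g t = g t" using * slimI by blast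
qed

text \<open>A convergent quotient taken with the value \<open>g t\<close> forces \<open>g\<close> to
  tend to \<open>g t\<close> from both sides. By continuity the values are the essential limits, so
  ordinary quotients become those of \<open>der\<close>.\<close>

lemma der_classical:
  assumes "\<And>t b. t \<in> I \<Longrightarrow> ((\<lambda>s. (g s - g t) / of_real (s - t)) \<longlongrightarrow> slim b h t) (at_side b t)"
    and "regulated h"
  shows "continuous_on I g" "der g h"
proof -
  have cont: "(g \<longlongrightarrow> g t) (at_side b t)" if "t \<in> I" for t b
  proof -
    have "((\<lambda>s. of_real (s - t)) \<longlongrightarrow> complex_of_real (t - t)) (at_side b t)"
      unfolding at_side_def by (cases b; simp only: if_True if_False; intro tendsto_intros)
    from tendsto_add[OF tendsto_mult[OF assms(1)[OF that] this] tendsto_const[of "g t"]]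
    have "((\<lambda>s. (g s - g t) / of_real (s - t) * of_real (s - t) + g t) \<longlongrightarrow> g t) (at_side b t)" by simp
    moreover have "eventually (\<lambda>s. (g s - g t) / of_real (s - t) * of_real (s - t) + g t = g s) (at_side b t)"
      unfolding eventually_at_side by (intro exI[of _ 1]) (auto simp: side_def split: if_splits)
    ultimately show ?thesis by (rule Lim_transform_eventually)
  qed
  show c: "continuous_on I g"
  proof (rule continuous_at_imp_continuous_on, rule ballI)
    fix t assume "t \<in> I"
    then show "isCont g t" using cont[of t True] cont[of t False]
      by (simp add: at_side_def isCont_def filterlim_split_at)
  qed
  show "der g h" unfolding der_def
  proof (intro conjI ballI allI assms(2) regulated_continuous(1)[OF c])
    fix t b assume t: "t \<in> I"
    show "((\<lambda>s. (g s - slim b g t) / of_real (s - t)) \<longlongrightarrow> slim b h t) (es b t)"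
      using tendsto_mono[OF es_le assms(1)[OF t, of b]] by (simp only: regulated_continuous(2)[OF c t])
  qed
qed

lemma der_smooth:
  assumes "\<And>t. t \<in> I \<Longrightarrow> (g has_vector_derivative h t) (at t)" "continuous_on I h"
  shows "der g h"
proof (rule der_classical(2)[OF _ regulated_continuous(1)[OF assms(2)]])
  fix t b assume t: "t \<in> I"
  have "((\<lambda>s. (g s - g t) / of_real (s - t)) \<longlongrightarrow> h t) (at t)"
    using assms(1)[OF t] by (simp only: has_vector_derivative_quotient)
  moreover have "at_side b t \<le> at t" by (simp add: at_side_def at_le)
  ultimately have "((\<lambda>s. (g s - g t) / of_real (s - t)) \<longlongrightarrow> h t) (at_side b t)" by (meson tendsto_mono)
  then show "((\<lambda>s. (g s - g t) / of_real (s - t)) \<longlongrightarrow> slim b h t) (at_side b t)"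
    by (simp only: regulated_continuous(2)[OF assms(2) t])
qed

text \<open>\<open>smooth\<close> asks for a whole chain of derivatives at once; dependent choice
  produces it from any property that survives one differentiation.\<close>

lemma smooth_coinduct:
  assumes "P g" "\<And>g. P g \<Longrightarrow> \<exists>h. der g h \<and> P h"
  shows "smooth g"
proof -
  have "\<exists>f. \<forall>n::nat. (P (f n) \<and> (n = 0 \<longrightarrow> f n = g)) \<and> der (f n) (f (Suc n))"
    by (rule dependent_nat_choice) (use assms in blast)+
  then show ?thesis unfolding smooth_def by blast
qed

lemma smooth_der: "smooth g \<Longrightarrow> \<exists>h. der g h \<and> smooth h"
proof -
  assume "smooth g"
  then obtain d where d: "d 0 = g" "\<forall>k::nat. der (d k) (d (Suc k))" unfolding smooth_def by blast
  then have "smooth (d 1)" unfolding smooth_def by (intro exI[of _ "\<lambda>k. d (Suc k)"]) simp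
  with d show ?thesis by (metis One_nat_def)
qed

lemma smooth_regulated: "smooth g \<Longrightarrow> regulated g"
  using smooth_der derD by blast

lemma smooth_of_der: "der g h \<Longrightarrow> smooth h \<Longrightarrow> smooth g"
  by (rule smooth_coinduct[of "\<lambda>f. smooth f \<or> f = g"]) (use smooth_der in blast)+

text \<open>Products of smooth functions alone are not an invariant of differentiation, because the
  Leibniz rule produces sums of products. The generated algebra is one.\<close>

inductive alg :: "((real \<Rightarrow> complex) \<Rightarrow> bool) \<Rightarrow> (real \<Rightarrow> complex) \<Rightarrow> bool" for A where
  base: "A g \<Longrightarrow> alg A g"
| const: "alg A (\<lambda>_. c)"
| add: "alg A f \<Longrightarrow> alg A g \<Longrightarrow> alg A (\<lambda>s. f s + g s)"
| mult: "alg A f \<Longrightarrow> alg A g \<Longrightarrow> alg A (\<lambda>s. f s * g s)"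

text \<open>By the Leibniz rule it is enough to differentiate generators. The components of a
  solution of a linear system will later be generators, although their smoothness is what is being
  proved.\<close>

lemma smooth_algI:
  assumes "\<And>a. A a \<Longrightarrow> \<exists>h. der a h \<and> alg A h" "alg A g"
  shows "smooth g"
proof (rule smooth_coinduct[of "alg A", OF assms(2)])
  fix g assume "alg A g"
  then show "\<exists>h. der g h \<and> alg A h"
  proof induction
    case (base g) then show ?case using assms(1) by blast
  next
    case (const c) then show ?case using der_const alg.const by blast
  next
    case (add f g) then show ?case using der_add alg.add by metis
  next
    case (mult f g)
    then obtain f' g' where "der f f'" "alg A f'" "der g g'" "alg A g'" by blast
    then show ?case using der_mult[of f f' g g'] mult.hyps alg.add alg.mult
      by (intro exI[of _ "\<lambda>s. f' s * g s + f s * g' s"]) simp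
  qed
qed

lemma smooth_alg: "alg smooth g \<Longrightarrow> smooth g"
  by (rule smooth_algI[of smooth]) (use smooth_der alg.base in blast)+

lemma smooth_const: "smooth (\<lambda>_. c)" and smooth_add: "smooth f \<Longrightarrow> smooth g \<Longrightarrow> smooth (\<lambda>s. f s + g s)"
  and smooth_mult: "smooth f \<Longrightarrow> smooth g \<Longrightarrow> smooth (\<lambda>s. f s * g s)"
  by (auto intro: smooth_alg alg.intros)

lemma smooth_diff: "smooth f \<Longrightarrow> smooth g \<Longrightarrow> smooth (\<lambda>s. f s - g s)"
  using smooth_add[OF _ smooth_mult[OF smooth_const[of "-1"]]] by simp

lemma smooth_sum: "(\<And>a. a \<in> K \<Longrightarrow> smooth (f a)) \<Longrightarrow> smooth (\<lambda>s. \<Sum>a\<in>K. f a s)"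
  by (induction K rule: infinite_finite_induct) (simp_all add: smooth_const smooth_add)

section \<open>Steps and the identity function\<close>

definition step :: "real \<Rightarrow> real \<Rightarrow> complex" where
  "step c = (\<lambda>s. if c < s then 1 else 0)"

lemma step_ev: "eventually (\<lambda>s. step c s = (if c < t \<or> c = t \<and> b then 1 else 0)) (at_side b t)"
  unfolding eventually_at_side
  by (intro exI[of _ "if c = t then 1 else \<bar>c - t\<bar>"])
     (auto simp: step_def side_def split: if_splits)

lemma slim_step: "slim b (step c) t = (if c < t \<or> c = t \<and> b then 1 else 0)"
  by (rule slimI, rule tendsto_eventually) (rule filter_leD[OF es_le step_ev])

text \<open>The quotients use one-sided limits, and on either side of its jump a step is constant. A
  vanishing derivative therefore does not mean a constant function, and absence of jumps must be
  demanded wherever a function is recovered from its derivative.\<close>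

lemma der_step: "der (step c) (\<lambda>_. 0)"
  unfolding der_def
proof (intro conjI ballI allI regulated_const)
  have m: "step c \<in> borel_measurable (lebesgue_on I)"
    unfolding step_def by (intro measurable_restrict_space1 measurable_completion) measurable
  have ev: "eventually (\<lambda>s. step c s = slim b (step c) t) (es b t)" for b t
    using filter_leD[OF es_le step_ev] by (simp add: slim_step)
  show "regulated (step c)" unfolding regulated_def using m tendsto_eventually[OF ev] by blast
  fix t b
  show "((\<lambda>s. (step c s - slim b (step c) t) / of_real (s - t)) \<longlongrightarrow> slim b (\<lambda>_. 0) t) (es b t)"
    by (rule tendsto_eventually, use ev[of b t] in eventually_elim) (simp add: slim_const)
qed

lemma smooth_step: "smooth (step c)"
  using smooth_of_der[OF der_step smooth_const] .

lemma smooth_id: "der (\<lambda>s. of_real s) (\<lambda>_. 1)" "smooth (\<lambda>s. of_real s)"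
proof -
  show "der (\<lambda>s. of_real s) (\<lambda>_. 1)"
    by (rule der_smooth) (auto intro!: derivative_eq_intros simp: has_vector_derivative_def scaleR_conv_of_real)
  then show "smooth (\<lambda>s. of_real s)" using smooth_of_der smooth_const by blast
qed

end

section \<open>Test functions and the growth of distributions\<close>

context open_interval
begin

text \<open>The support is recorded by an explicit interval with ends in \<open>I\<close>. Functions
  sharing \<open>c\<close> and \<open>d\<close> form one step space of the inductive limit, and all
  estimates are made there.\<close>

definition test_on :: "real \<Rightarrow> real \<Rightarrow> (real \<Rightarrow> complex) \<Rightarrow> bool" where
  "test_on c d \<phi> \<longleftrightarrow> c \<in> I \<and> d \<in> I \<and> c < d \<and> smooth \<phi> \<and> (AE s in lebesgue. s \<in> I - {c..d} \<longrightarrow> \<phi> s = 0)"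

lemma open_off: "open (I - {c..d})"
  using opn by (simp add: open_Diff)

lemma test_on_smooth: "test_on c d \<phi> \<Longrightarrow> smooth \<phi>"
  by (simp add: test_on_def)

lemma test_on_mono: "test_on c d \<phi> \<Longrightarrow> c' \<in> I \<Longrightarrow> d' \<in> I \<Longrightarrow> c' \<le> c \<Longrightarrow> d \<le> d' \<Longrightarrow> test_on c' d' \<phi>"
  unfolding test_on_def by (elim conjE, intro conjI) (auto elim: eventually_mono)

lemma test_on_der: "test_on c d \<phi> \<Longrightarrow> der \<phi> h \<Longrightarrow> smooth h \<Longrightarrow> test_on c d h"
  unfolding test_on_def using der_cong_on[OF _ der_const open_off, of \<phi> h c d 0] by auto

lemma test_on_add: "test_on c d \<phi> \<Longrightarrow> test_on c d \<psi> \<Longrightarrow> test_on c d (\<lambda>s. \<phi> s + \<psi> s)"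
  unfolding test_on_def by (auto simp: smooth_add elim: eventually_elim2)

lemma test_on_mult: "smooth g \<Longrightarrow> test_on c d \<phi> \<Longrightarrow> test_on c d (\<lambda>s. g s * \<phi> s)"
  unfolding test_on_def by (auto simp: smooth_mult elim: eventually_mono)

lemma test_on_cmult: "test_on c d \<phi> \<Longrightarrow> test_on c d (\<lambda>s. k * \<phi> s)"
  using test_on_mult[OF smooth_const] .

lemma test_on_diff: "test_on c d \<phi> \<Longrightarrow> test_on c d \<psi> \<Longrightarrow> test_on c d (\<lambda>s. \<phi> s - \<psi> s)"
  using test_on_add[OF _ test_on_cmult[of c d \<psi> "-1"]] by simp

lemma test_on_slim_off: "test_on c d \<phi> \<Longrightarrow> t \<in> I \<Longrightarrow> t \<notin> {c..d} \<Longrightarrow> slim b \<phi> t = 0"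
  using slim_cong[OF open_off, of t c d \<phi> "\<lambda>_. 0" b] by (simp add: test_on_def slim_const)

lemma test_on_bounded: "test_on c d \<phi> \<Longrightarrow> \<exists>M\<ge>0. AE s in lebesgue. s \<in> I \<longrightarrow> norm (\<phi> s) \<le> M"
proof -
  assume a: "test_on c d \<phi>"
  then have cd: "c \<le> d" "{c..d} \<subseteq> I" using Icc_sub by (auto simp: test_on_def)
  have "\<exists>M\<ge>0. AE s in lebesgue. s \<in> {c..d} \<longrightarrow> norm (\<phi> s) \<le> M"
    by (rule AE_bounded_of_es[OF cd(1)]) (use regulated_lim[OF smooth_regulated[OF test_on_smooth[OF a]]] cd in blast)
  then obtain M where M: "M \<ge> 0" "AE s in lebesgue. s \<in> {c..d} \<longrightarrow> norm (\<phi> s) \<le> M" by blast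
  have "AE s in lebesgue. s \<in> I - {c..d} \<longrightarrow> \<phi> s = 0" using a by (simp add: test_on_def)
  then have "AE s in lebesgue. s \<in> I \<longrightarrow> norm (\<phi> s) \<le> M" using M(2)
    by eventually_elim (use M(1) in auto)
  with M show ?thesis by blast
qed

lemma G_fun_iff: "g \<in> G_fun I \<longleftrightarrow> regulated g \<and> (\<exists>C. AE s in lebesgue. s \<in> I \<longrightarrow> norm (g s) \<le> C)"
proof -
  have "(\<forall>t\<in>I. \<forall>b. \<exists>l. (g \<longlongrightarrow> l) (es b t)) \<longleftrightarrow>
     (\<forall>t\<in>I. (\<exists>l. (g \<longlongrightarrow> l) (ess_at_right t)) \<and> (\<exists>l. (g \<longlongrightarrow> l) (ess_at_left t)))"
    by (auto simp: all_bool_eq es_def)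
  then show ?thesis unfolding G_fun_def regulated_def AE_on by auto
qed

lemma G_deriv_iff: "G_deriv I g h \<longleftrightarrow> der g h \<and> g \<in> G_fun I \<and> h \<in> G_fun I"
  unfolding G_deriv_def der_def
  by (auto simp: all_bool_eq es_def rlim_slim llim_slim G_fun_iff)

lemma G_inf_smooth: "g \<in> G_inf I \<Longrightarrow> smooth g"
  unfolding G_inf_def smooth_def G_deriv_iff by blast

lemma test_on_G_fun: "test_on c d \<phi> \<Longrightarrow> \<phi> \<in> G_fun I"
  using test_on_bounded test_on_smooth smooth_regulated G_fun_iff by blast

text \<open>Compact support turns local bounds into global ones and is inherited by derivatives, so
  the bounds missing in \<open>smooth\<close> are recovered in every order.\<close>

lemma test_on_G_inf: "test_on c d \<phi> \<Longrightarrow> \<phi> \<in> G_inf I"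
proof -
  assume a: "test_on c d \<phi>"
  have "\<exists>f. \<forall>n::nat. (test_on c d (f n) \<and> (n = 0 \<longrightarrow> f n = \<phi>)) \<and> der (f n) (f (Suc n))"
  proof (rule dependent_nat_choice)
    show "\<exists>x. test_on c d x \<and> (0 = (0::nat) \<longrightarrow> x = \<phi>)" using a by blast
    show "\<exists>y. (test_on c d y \<and> (Suc n = 0 \<longrightarrow> y = \<phi>)) \<and> der x y" if "test_on c d x \<and> (n = 0 \<longrightarrow> x = \<phi>)" for x n
      using that test_on_smooth smooth_der test_on_der by (metis nat.distinct(1))
  qed
  then show ?thesis unfolding G_inf_def G_deriv_iff using test_on_G_fun a by blast
qed

lemma G_supp_test_on: assumes "test_on c d \<phi>" shows "G_supp I \<phi> \<subseteq> {c..d}" "compact (G_supp I \<phi>)"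
proof -
  have "{t \<in> I. llim \<phi> t \<noteq> 0 \<or> rlim \<phi> t \<noteq> 0} \<subseteq> {c..d}" (is "?T \<subseteq> _")
    using test_on_slim_off[OF assms] unfolding rlim_slim llim_slim by blast
  then have "closure ?T \<subseteq> {c..d}" by (simp add: closure_minimal)
  moreover have "{c..d} \<subseteq> I" using assms Icc_sub by (simp add: test_on_def)
  ultimately have "G_supp I \<phi> = closure ?T" "closure ?T \<subseteq> {c..d}" by (auto simp: G_supp_def)
  then show "G_supp I \<phi> \<subseteq> {c..d}" "compact (G_supp I \<phi>)"
    by (auto simp: compact_eq_bounded_closed bounded_subset[OF bounded_closed_interval])
qed

lemma compact_in_interval:
  fixes V :: "real set"
  assumes "compact K" "K \<subseteq> V" "open V" "V \<noteq> {}"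
  shows "\<exists>c\<in>V. \<exists>d\<in>V. c < d \<and> K \<subseteq> {c..d}"
proof -
  obtain p where p: "p \<in> V" using assms by blast
  \<comment> \<open>The point \<open>p\<close> is added so that extrema exist even for an empty
    support.\<close>
  have "compact (insert p K)" "insert p K \<noteq> {}" "insert p K \<subseteq> V" using p assms by auto
  then obtain l u where lu: "l \<in> V" "u \<in> V" "\<forall>x\<in>insert p K. l \<le> x \<and> x \<le> u"
    using compact_attains_sup[of "insert p K"] compact_attains_inf[of "insert p K"] by (metis subsetD)
  obtain e where e: "e > 0" "{l-e<..<l+e} \<subseteq> V" using side_in_open[OF assms(3) lu(1)] by metis
  obtain f where f: "f > 0" "{u-f<..<u+f} \<subseteq> V" using side_in_open[OF assms(3) lu(2)] by metis
  have "l - e/2 \<in> V" by (rule subsetD[OF e(2)]) (use e(1) in auto)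
  moreover have "u + f/2 \<in> V" by (rule subsetD[OF f(2)]) (use f(1) in auto)
  moreover have "l \<le> u" using lu(3) by force
  then have "l - e/2 < u + f/2" "K \<subseteq> {l - e/2..u + f/2}" using e(1) f(1) lu(3) by force+
  ultimately show ?thesis by blast
qed

text \<open>Off the support both one-sided limits vanish, and vanishing limits make the function
  zero almost everywhere. Besides \<open>I\<close> itself, \<open>V\<close> will be the part of
  \<open>I\<close> before \<open>t0\<close>.\<close>

lemma test_on_of_supp:
  assumes "\<phi> \<in> test_fun I" "G_supp I \<phi> \<subseteq> V" "open V" "is_interval V" "V \<subseteq> I" "V \<noteq> {}"
  shows "\<exists>c\<in>V. \<exists>d\<in>V. test_on c d \<phi>"
proof -
  obtain c d where cd: "c \<in> V" "d \<in> V" "c < d" "G_supp I \<phi> \<subseteq> {c..d}"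
    using compact_in_interval[of "G_supp I \<phi>" V] assms by (auto simp: test_fun_def)
  have zero: "slim b \<phi> t = 0" if "t \<in> I - {c..d}" for t b
  proof -
    have "t \<notin> {t \<in> I. llim \<phi> t \<noteq> 0 \<or> rlim \<phi> t \<noteq> 0}"
      using that cd(4) closure_subset unfolding G_supp_def by fastforce
    then show ?thesis using that by (cases b) (auto simp: rlim_slim llim_slim)
  qed
  have smooth: "smooth \<phi>" using assms(1) G_inf_smooth by (simp add: test_fun_def)
  have "AE s in lebesgue. s \<in> I - {c..d} \<longrightarrow> \<phi> s = 0"
  proof (rule AE_eq_of_slim[OF open_off])
    fix t b assume "t \<in> I - {c..d}"
    then show "(\<phi> \<longlongrightarrow> 0) (es b t)" using regulated_lim[OF smooth_regulated[OF smooth], of t b] zero[of t b] by simp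
  qed
  then have "test_on c d \<phi>" using cd assms(5) smooth by (auto simp: test_on_def)
  with cd show ?thesis by blast
qed

lemma test_fun_iff: "\<phi> \<in> test_fun I \<longleftrightarrow> (\<exists>c d. test_on c d \<phi>)"
proof
  assume "\<phi> \<in> test_fun I"
  moreover have "G_supp I \<phi> \<subseteq> I" by (auto simp: G_supp_def)
  ultimately show "\<exists>c d. test_on c d \<phi>" using test_on_of_supp[of \<phi> I] opn itv t0 by blast
next
  assume "\<exists>c d. test_on c d \<phi>"
  then show "\<phi> \<in> test_fun I" using test_on_G_inf G_supp_test_on by (auto simp: test_fun_def)
qed

lemma before_t0: obtains p where "p \<in> I" "p < t0"
proof -
  obtain e where e: "e > 0" "{t0-e<..<t0+e} \<subseteq> I" using side_in_open[OF opn t0] by metis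
  then have "t0 - e/2 \<in> I" by (intro subsetD[OF e(2)]) auto
  then show thesis using that e by force
qed

text \<open>A compact support inside the open set of points before \<open>t0\<close> ends at some
  \<open>d < t0\<close>, so the condition can be read off from supporting intervals.\<close>

lemma zero_before_iff: "zero_before I t0 f \<longleftrightarrow> (\<forall>c d \<phi>. test_on c d \<phi> \<longrightarrow> d < t0 \<longrightarrow> f \<phi> = 0)"
proof
  assume z: "zero_before I t0 f"
  show "\<forall>c d \<phi>. test_on c d \<phi> \<longrightarrow> d < t0 \<longrightarrow> f \<phi> = 0"
  proof (intro allI impI)
    fix c d \<phi> assume a: "test_on c d \<phi>" "d < t0"
    then have "G_supp I \<phi> \<subseteq> {..<t0}" using G_supp_test_on(1)[OF a(1)] by auto
    then show "f \<phi> = 0" using z a test_fun_iff unfolding zero_before_def by blast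
  qed
next
  assume z: "\<forall>c d \<phi>. test_on c d \<phi> \<longrightarrow> d < t0 \<longrightarrow> f \<phi> = 0"
  show "zero_before I t0 f" unfolding zero_before_def
  proof (intro ballI impI)
    fix \<phi> assume a: "\<phi> \<in> test_fun I" "G_supp I \<phi> \<subseteq> {..<t0}"
    have "is_interval (I \<inter> {..<t0})" using itv by (intro is_interval_Int) auto
    moreover have "G_supp I \<phi> \<subseteq> I \<inter> {..<t0}" using a(2) by (auto simp: G_supp_def)
    moreover have "I \<inter> {..<t0} \<noteq> {}" using before_t0 by blast
    ultimately have "\<exists>c\<in>I \<inter> {..<t0}. \<exists>d\<in>I \<inter> {..<t0}. test_on c d \<phi>"
      by (intro test_on_of_supp[OF a(1) _ open_Int[OF opn open_lessThan]]) auto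
    then obtain c d where "d \<in> I \<inter> {..<t0}" "test_on c d \<phi>" by blast
    then show "f \<phi> = 0" using z by auto
  qed
qed

lemma smooth_cong: "smooth h \<Longrightarrow> AE s in lebesgue. s \<in> I \<longrightarrow> h s = g s \<Longrightarrow> regulated g \<Longrightarrow> smooth g"
proof -
  assume a: "smooth h" "AE s in lebesgue. s \<in> I \<longrightarrow> h s = g s" "regulated g"
  obtain h' where "der h h'" "smooth h'" using smooth_der[OF a(1)] by blast
  then have "der g h'" using der_cong[OF _ a(2) _ a(3)] derD(2) by auto
  then show "smooth g" using smooth_of_der \<open>smooth h'\<close> by blast
qed

lemma dG_test_on: assumes "test_on c d \<phi>" shows "der \<phi> (dG I \<phi>)" "test_on c d (dG I \<phi>)"
proof -
  obtain h where h: "der \<phi> h" "smooth h" using smooth_der test_on_smooth assms by blast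
  then have "G_deriv I \<phi> h" using test_on_der[OF assms h] assms test_on_G_fun by (auto simp: G_deriv_iff)
  then have "G_deriv I \<phi> (dG I \<phi>)" unfolding dG_def by (rule someI[of "G_deriv I \<phi>"])
  then show d: "der \<phi> (dG I \<phi>)" by (simp add: G_deriv_iff)
  \<comment> \<open>\<open>dG\<close> is an unspecified representative; it inherits smoothness from
    the derivative \<open>h\<close> through equality almost everywhere.\<close>
  have "smooth (dG I \<phi>)" using smooth_cong[OF h(2) der_unique[OF h(1) d]] derD(2)[OF d] by blast
  then show "test_on c d (dG I \<phi>)" using test_on_der[OF assms d] by blast
qed

lemma test_on_common:
  assumes "\<phi> \<in> test_fun I" "\<psi> \<in> test_fun I" obtains c d where "test_on c d \<phi>" "test_on c d \<psi>"
proof -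
  obtain a b a' b' where *: "test_on a b \<phi>" "test_on a' b' \<psi>" using assms by (auto simp: test_fun_iff)
  then have "min a a' \<in> I" "max b b' \<in> I" by (auto simp: test_on_def min_def max_def)
  then have "test_on (min a a') (max b b') \<phi>" "test_on (min a a') (max b b') \<psi>"
    using * by (auto intro: test_on_mono)
  then show thesis using that by blast
qed

lemma test_fun_add: "\<phi> \<in> test_fun I \<Longrightarrow> \<psi> \<in> test_fun I \<Longrightarrow> (\<lambda>s. \<phi> s + \<psi> s) \<in> test_fun I"
  using test_on_common test_on_add test_fun_iff by metis

lemma test_fun_cmult: "\<phi> \<in> test_fun I \<Longrightarrow> (\<lambda>s. k * \<phi> s) \<in> test_fun I"
  using test_on_cmult test_fun_iff by blast

lemma test_fun_mult: "smooth g \<Longrightarrow> \<phi> \<in> test_fun I \<Longrightarrow> (\<lambda>s. g s * \<phi> s) \<in> test_fun I"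
  using test_on_mult test_fun_iff by blast

lemma test_fun_diff: "\<phi> \<in> test_fun I \<Longrightarrow> \<psi> \<in> test_fun I \<Longrightarrow> (\<lambda>s. \<phi> s - \<psi> s) \<in> test_fun I"
  using test_fun_add[OF _ test_fun_cmult[of \<psi> "-1"]] by simp

lemma test_fun_0: "(\<lambda>_. 0) \<in> test_fun I"
proof -
  obtain p where "p \<in> I" "p < t0" using before_t0 .
  then have "test_on p t0 (\<lambda>_. 0)" using t0 by (simp add: test_on_def smooth_const)
  then show ?thesis using test_fun_iff by blast
qed

lemma test_fun_smooth: "\<phi> \<in> test_fun I \<Longrightarrow> smooth \<phi>"
  using test_fun_iff test_on_smooth by blast

text \<open>The condition that the norm of order \<open>k\<close> is at most \<open>M\<close>, freed
  from essential suprema and from the choice made by \<open>dG\<close>. Letting \<open>U\<close> be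
  smaller than \<open>I\<close> permits estimates on pieces that are joined afterwards.\<close>

primrec bnd :: "real set \<Rightarrow> nat \<Rightarrow> real \<Rightarrow> (real \<Rightarrow> complex) \<Rightarrow> bool" where
  "bnd U 0 M g \<longleftrightarrow> (AE s in lebesgue. s \<in> U \<longrightarrow> norm (g s) \<le> M)"
| "bnd U (Suc k) M g \<longleftrightarrow> (AE s in lebesgue. s \<in> U \<longrightarrow> norm (g s) \<le> M) \<and> (\<exists>h. der g h \<and> bnd U k M h)"

lemma bnd_AE: "bnd U k M g \<Longrightarrow> AE s in lebesgue. s \<in> U \<longrightarrow> norm (g s) \<le> M"
  by (cases k) auto

lemma bnd_cong:
  assumes "bnd U k M g" "AE s in lebesgue. s \<in> U \<longrightarrow> g s = g' s" "smooth g'" "open U" "U \<subseteq> I"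
  shows "bnd U k M g'"
  using assms(1-3)
proof (induction k arbitrary: g g')
  case 0
  then show ?case by (auto elim: eventually_elim2)
next
  case (Suc k)
  then obtain h where h: "der g h" "bnd U k M h" by auto
  obtain h' where h': "der g' h'" "smooth h'" using smooth_der Suc.prems(3) by blast
  have "AE s in lebesgue. s \<in> U \<longrightarrow> h s = h' s"
    by (rule der_cong_on[OF h(1) h'(1) assms(4,5) Suc.prems(2)])
  then have "bnd U k M h'" using Suc.IH h h' by blast
  moreover have "AE s in lebesgue. s \<in> U \<longrightarrow> norm (g' s) \<le> M"
    using bnd_AE[OF Suc.prems(1)] Suc.prems(2) by eventually_elim auto
  ultimately show ?case using h' by auto
qed

lemma bnd_Suc:
  assumes "der g h" "smooth h" "open U" "U \<subseteq> I"
  shows "bnd U (Suc k) M g \<longleftrightarrow> (AE s in lebesgue. s \<in> U \<longrightarrow> norm (g s) \<le> M) \<and> bnd U k M h"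
proof -
  have "bnd U k M h" if h': "der g h'" "bnd U k M h'" for h'
  proof (rule bnd_cong[OF h'(2) _ assms(2-4)])
    show "AE s in lebesgue. s \<in> U \<longrightarrow> h' s = h s"
      using der_unique[OF h'(1) assms(1)] assms(4) by (auto elim: eventually_mono)
  qed
  then show ?thesis using assms(1) by auto
qed

lemma bnd_mono: "bnd U k M g \<Longrightarrow> M \<le> N \<Longrightarrow> bnd U k N g"
proof (induction k arbitrary: g)
  case 0 then show ?case by (auto elim: eventually_mono)
next
  case (Suc k)
  moreover have "AE s in lebesgue. s \<in> U \<longrightarrow> norm (g s) \<le> N"
    using bnd_AE[OF Suc.prems(1)] Suc.prems(2) by (auto elim: eventually_mono)
  ultimately show ?case by auto
qed

lemma bnd_le: "bnd U k M g \<Longrightarrow> j \<le> k \<Longrightarrow> bnd U j M g"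
proof (induction k arbitrary: g j)
  case (Suc k)
  then show ?case by (cases j) auto
qed simp

lemma bnd_add: "bnd U k M f \<Longrightarrow> bnd U k N g \<Longrightarrow> bnd U k (M + N) (\<lambda>s. f s + g s)"
proof (induction k arbitrary: f g)
  case 0
  then have "AE s in lebesgue. s \<in> U \<longrightarrow> norm (f s) \<le> M" "AE s in lebesgue. s \<in> U \<longrightarrow> norm (g s) \<le> N"
    by simp_all
  then have "AE s in lebesgue. s \<in> U \<longrightarrow> norm (f s + g s) \<le> M + N"
    by eventually_elim (use norm_triangle_mono in blast)
  then show ?case by simp
next
  case (Suc k)
  then obtain f' g' where "der f f'" "bnd U k M f'" "der g g'" "bnd U k N g'" by auto
  then have "der (\<lambda>s. f s + g s) (\<lambda>s. f' s + g' s)" "bnd U k (M + N) (\<lambda>s. f' s + g' s)"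
    using der_add Suc.IH by auto
  moreover from bnd_AE[OF Suc.prems(1)] bnd_AE[OF Suc.prems(2)]
  have "AE s in lebesgue. s \<in> U \<longrightarrow> norm (f s + g s) \<le> M + N"
    by eventually_elim (use norm_triangle_mono in blast)
  ultimately show ?case by auto
qed

lemma bnd_cmult: "bnd U k M f \<Longrightarrow> bnd U k (norm c * M) (\<lambda>s. c * f s)"
proof (induction k arbitrary: f)
  case 0
  then show ?case by (auto simp: norm_mult intro!: mult_left_mono elim: eventually_mono)
next
  case (Suc k)
  then obtain f' where "der f f'" "bnd U k M f'" by auto
  then have "der (\<lambda>s. c * f s) (\<lambda>s. c * f' s)" "bnd U k (norm c * M) (\<lambda>s. c * f' s)"
    using der_cmult Suc.IH by auto
  moreover have "AE s in lebesgue. s \<in> U \<longrightarrow> norm (c * f s) \<le> norm c * M"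
    using bnd_AE[OF Suc.prems(1)] by (auto simp: norm_mult intro!: mult_left_mono elim: eventually_mono)
  ultimately show ?case by auto
qed

lemma bnd_diff: "bnd U k M f \<Longrightarrow> bnd U k N g \<Longrightarrow> bnd U k (M + N) (\<lambda>s. f s - g s)"
  using bnd_add[OF _ bnd_cmult[of U k N g "-1"]] by simp

text \<open>Outside the interval the function and its derivatives vanish almost everywhere, and the
  two end points are null.\<close>

lemma bnd_extend:
  assumes "test_on c d \<phi>" "bnd {c<..<d} k M \<phi>" "M \<ge> 0"
  shows "bnd I k M \<phi>"
  using assms(1,2)
proof (induction k arbitrary: \<phi>)
  have *: "AE s in lebesgue. s \<in> I \<longrightarrow> norm (\<phi> s) \<le> M"
    if "test_on c d \<phi>" "AE s in lebesgue. s \<in> {c<..<d} \<longrightarrow> norm (\<phi> s) \<le> M" for \<phi>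
  proof -
    have "AE s in lebesgue. s \<in> I - {c..d} \<longrightarrow> \<phi> s = 0" "AE s in lebesgue. s \<notin> {c, d}"
      using that(1) by (auto simp: test_on_def intro: AE_I'[of "{c, d}"])
    with that(2) show ?thesis by eventually_elim (use assms(3) in auto)
  qed
  { case 0 then show ?case using * by simp }
  case (Suc k)
  obtain h where h: "der \<phi> h" "smooth h" using smooth_der test_on_smooth Suc.prems by blast
  have sub: "{c<..<d} \<subseteq> I" using Icc_sub[of c d] Suc.prems(1) by (auto simp: test_on_def)
  have "bnd {c<..<d} k M h" using bnd_Suc[OF h open_greaterThanLessThan sub] Suc.prems(2) by blast
  then have "bnd I k M h" using Suc.IH test_on_der[OF Suc.prems(1) h] by blast
  moreover have "AE s in lebesgue. s \<in> I \<longrightarrow> norm (\<phi> s) \<le> M"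
    using *[OF Suc.prems(1)] bnd_AE[OF Suc.prems(2)] by blast
  ultimately show ?case using h by auto
qed

lemma bnd_subset: "bnd U k M g \<Longrightarrow> V \<subseteq> U \<Longrightarrow> bnd V k M g"
proof (induction k arbitrary: g)
  case 0 then show ?case by (auto elim: eventually_mono)
next
  case (Suc k)
  have "AE s in lebesgue. s \<in> V \<longrightarrow> norm (g s) \<le> M"
    using bnd_AE[OF Suc.prems(1)] Suc.prems(2) by (auto elim: eventually_mono)
  then show ?case using Suc by auto
qed

text \<open>No matching at \<open>b\<close> is required: \<open>smooth\<close> admits jumps of every
  order, and the single point \<open>b\<close> is null. The common bound does not grow, so pieces
  can be joined repeatedly without loss.\<close>

lemma bnd_glue:
  assumes "bnd {a<..<b} k M g" "bnd {b<..<c} k M g" "smooth g" "{a<..<c} \<subseteq> I" "a \<le> b" "b \<le> c"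
  shows "bnd {a<..<c} k M g"
  using assms(1-3)
proof (induction k arbitrary: g)
  have *: "AE s in lebesgue. s \<in> {a<..<c} \<longrightarrow> norm (g s) \<le> M"
    if "AE s in lebesgue. s \<in> {a<..<b} \<longrightarrow> norm (g s) \<le> M"
       "AE s in lebesgue. s \<in> {b<..<c} \<longrightarrow> norm (g s) \<le> M" for g :: "real \<Rightarrow> complex"
  proof -
    have "AE s in lebesgue. s \<noteq> b" by (rule AE_I'[of "{b}"]) auto
    with that show ?thesis by eventually_elim (use assms in auto)
  qed
  { case 0 then show ?case using * by simp }
  case (Suc k)
  have sub: "{a<..<b} \<subseteq> I" "{b<..<c} \<subseteq> I" using assms(4-6) by auto
  obtain h where h: "der g h" "smooth h" using smooth_der Suc.prems by blast
  have "bnd {a<..<c} k M h"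
    using Suc.prems bnd_Suc[OF h open_greaterThanLessThan sub(1)]
      bnd_Suc[OF h open_greaterThanLessThan sub(2)] by (intro Suc.IH h(2)) blast+
  moreover have "AE s in lebesgue. s \<in> {a<..<c} \<longrightarrow> norm (g s) \<le> M"
    using * bnd_AE[OF Suc.prems(1)] bnd_AE[OF Suc.prems(2)] by blast
  ultimately show ?case using h by auto
qed

text \<open>The Leibniz rule, with one constant each for the function itself, for
  \<open>g' \<phi>\<close> and for \<open>g \<phi>'\<close>. The estimate is local because
  \<open>g\<close> may be unbounded on \<open>I\<close>.\<close>

lemma bnd_mult:
  assumes "c \<in> I" "d \<in> I" "c < d"
  shows "smooth g \<Longrightarrow> \<exists>C\<ge>0. \<forall>\<phi> M. bnd {c<..<d} k M \<phi> \<longrightarrow> M \<ge> 0 \<longrightarrow> bnd {c<..<d} k (C * M) (\<lambda>s. g s * \<phi> s)"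
proof (induction k arbitrary: g)
  have *: "\<exists>C\<ge>0. \<forall>\<phi> M. (AE s in lebesgue. s \<in> {c<..<d} \<longrightarrow> norm (\<phi> s) \<le> M) \<longrightarrow> M \<ge> 0 \<longrightarrow>
      (AE s in lebesgue. s \<in> {c<..<d} \<longrightarrow> norm (g s * \<phi> s) \<le> C * M)" if "smooth g" for g
  proof -
    have "\<exists>C\<ge>0. AE s in lebesgue. s \<in> {c..d} \<longrightarrow> norm (g s) \<le> C"
      using AE_bounded_of_es[OF less_imp_le[OF assms(3)]] regulated_lim[OF smooth_regulated[OF that]]
        Icc_sub[OF assms(1,2)] by blast
    then obtain C where C: "C \<ge> 0" "AE s in lebesgue. s \<in> {c..d} \<longrightarrow> norm (g s) \<le> C" by blast
    have "AE s in lebesgue. s \<in> {c<..<d} \<longrightarrow> norm (g s * \<phi> s) \<le> C * M"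
      if M: "AE s in lebesgue. s \<in> {c<..<d} \<longrightarrow> norm (\<phi> s) \<le> M" "M \<ge> 0" for \<phi> :: "real \<Rightarrow> complex" and M
      using C(2) M(1) by eventually_elim (use C(1) M(2) in \<open>auto simp: norm_mult intro!: mult_mono\<close>)
    with C show ?thesis by blast
  qed
  { case 0 then show ?case using * by simp }
  case (Suc k)
  obtain g' where g': "der g g'" "smooth g'" using smooth_der Suc.prems by blast
  obtain C0 where C0: "C0 \<ge> 0" "\<And>\<phi> M. (AE s in lebesgue. s \<in> {c<..<d} \<longrightarrow> norm (\<phi> s) \<le> M) \<Longrightarrow> M \<ge> 0 \<Longrightarrow>
      (AE s in lebesgue. s \<in> {c<..<d} \<longrightarrow> norm (g s * \<phi> s) \<le> C0 * M)" using *[OF Suc.prems] by blast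
  obtain C1 where C1: "C1 \<ge> 0" "\<And>\<phi> M. bnd {c<..<d} k M \<phi> \<Longrightarrow> M \<ge> 0 \<Longrightarrow> bnd {c<..<d} k (C1 * M) (\<lambda>s. g' s * \<phi> s)"
    using Suc.IH[OF g'(2)] by blast
  obtain C2 where C2: "C2 \<ge> 0" "\<And>\<phi> M. bnd {c<..<d} k M \<phi> \<Longrightarrow> M \<ge> 0 \<Longrightarrow> bnd {c<..<d} k (C2 * M) (\<lambda>s. g s * \<phi> s)"
    using Suc.IH[OF Suc.prems] by blast
  show ?case
  proof (rule exI[of _ "C0 + (C1 + C2)"], intro conjI allI impI)
    show "0 \<le> C0 + (C1 + C2)" using C0 C1 C2 by simp
    fix \<phi> M assume b: "bnd {c<..<d} (Suc k) M \<phi>" and M: "(0::real) \<le> M"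
    then obtain \<phi>' where \<phi>': "der \<phi> \<phi>'" "bnd {c<..<d} k M \<phi>'" by auto
    have "bnd {c<..<d} k M \<phi>" using bnd_le[OF b] by simp
    from bnd_add[OF C1(2)[OF this M] C2(2)[OF \<phi>'(2) M]]
    have "bnd {c<..<d} k ((C0 + (C1 + C2)) * M) (\<lambda>s. g' s * \<phi> s + g s * \<phi>' s)"
      by (rule bnd_mono) (use M C0 in \<open>simp add: algebra_simps\<close>)
    moreover have "AE s in lebesgue. s \<in> {c<..<d} \<longrightarrow> norm (g s * \<phi> s) \<le> (C0 + (C1 + C2)) * M"
    proof -
      have "C0 * M \<le> (C0 + (C1 + C2)) * M" using C1 C2 M by (intro mult_right_mono) auto
      then show ?thesis using C0(2)[OF bnd_AE[OF b] M] by (auto elim!: eventually_mono)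
    qed
    ultimately show "bnd {c<..<d} (Suc k) ((C0 + (C1 + C2)) * M) (\<lambda>s. g s * \<phi> s)"
      using der_mult[OF g'(1) \<phi>'(1)] by auto
  qed
qed

lemma Linf_le:
  assumes "g \<in> G_fun I"
  shows "Linf_norm I g \<le> M \<longleftrightarrow> (AE s in lebesgue. s \<in> I \<longrightarrow> norm (g s) \<le> M)"
proof -
  define E where "E = esssup (lebesgue_on I) (\<lambda>s. ereal (norm (g s)))"
  have m: "(\<lambda>s. ereal (norm (g s))) \<in> borel_measurable (lebesgue_on I)"
    using assms by (auto simp: G_fun_iff regulated_def)
  have AE_E: "AE s in lebesgue. s \<in> I \<longrightarrow> ereal (norm (g s)) \<le> E"
    using esssup_AE[of "\<lambda>s. ereal (norm (g s))" "lebesgue_on I"] by (simp only: E_def AE_on)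
  have E_le: "E \<le> ereal C" if "AE s in lebesgue. s \<in> I \<longrightarrow> norm (g s) \<le> C" for C
    unfolding E_def by (rule esssup_I[OF m]) (use that in \<open>simp only: AE_on ereal_less_eq\<close>)
  \<comment> \<open>\<open>real_of_ereal\<close> sends infinite values to zero, so finiteness must
    be proved. The bound from below holds because \<open>I\<close> contains a set of positive
    measure; on a null domain the essential supremum would be -\<infinity>.\<close>
  have "0 \<le> E"
  proof (rule ccontr)
    assume "\<not> 0 \<le> E"
    obtain e where e: "e > 0" "side True t0 e \<subseteq> I" using side_in_open[OF opn t0] by metis
    from AE_E have "AE s in lebesgue. s \<notin> side True t0 e"
    proof eventually_elim
      case (elim s)
      show ?case
      proof
        assume "s \<in> side True t0 e"
        then have "ereal (norm (g s)) \<le> E" using elim e by blast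
        then have "ereal 0 \<le> E" using order_trans[of "ereal 0" "ereal (norm (g s))" E] by simp
        then show False using \<open>\<not> 0 \<le> E\<close> by (simp add: zero_ereal_def)
      qed
    qed
    then show False using side_not_null[OF e(1)] by blast
  qed
  moreover obtain C where "E \<le> ereal C" using assms E_le by (auto simp: G_fun_iff)
  ultimately obtain e where e: "E = ereal e" by (cases E) auto
  have L: "Linf_norm I g = e" using e by (simp add: Linf_norm_def E_def)
  show ?thesis
  proof
    assume "Linf_norm I g \<le> M"
    then have "e \<le> M" using L by simp
    with AE_E show "AE s in lebesgue. s \<in> I \<longrightarrow> norm (g s) \<le> M" by (auto simp: e elim!: eventually_mono)
  next
    assume "AE s in lebesgue. s \<in> I \<longrightarrow> norm (g s) \<le> M"
    from E_le[OF this] show "Linf_norm I g \<le> M" using L e by simp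
  qed
qed

lemma bnd_G_norm: "test_on c d \<phi> \<Longrightarrow> G_norm I k \<phi> \<le> M \<longleftrightarrow> bnd I k M \<phi>"
proof -
  have "(\<forall>i\<le>k. Linf_norm I ((dG I ^^ i) \<phi>) \<le> M) \<longleftrightarrow> bnd I k M \<phi>" if "test_on c d \<phi>" for \<phi>
    using that
  proof (induction k arbitrary: \<phi>)
    case 0
    then show ?case using Linf_le[OF test_on_G_fun] by simp
  next
    case (Suc k)
    have "(\<forall>i\<le>Suc k. Linf_norm I ((dG I ^^ i) \<phi>) \<le> M) \<longleftrightarrow>
       Linf_norm I \<phi> \<le> M \<and> (\<forall>i\<le>k. Linf_norm I ((dG I ^^ i) (dG I \<phi>)) \<le> M)"
      using All_less_Suc2[of "Suc k" "\<lambda>i. Linf_norm I ((dG I ^^ i) \<phi>) \<le> M"]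
      by (simp add: less_Suc_eq_le funpow_swap1)
    also have "\<dots> \<longleftrightarrow> bnd I (Suc k) M \<phi>"
      using Suc.IH[OF dG_test_on(2)[OF Suc.prems]] Linf_le[OF test_on_G_fun[OF Suc.prems]]
        bnd_Suc[OF dG_test_on(1)[OF Suc.prems] test_on_smooth[OF dG_test_on(2)[OF Suc.prems]] opn] by simp
    finally show ?case .
  qed
  then show "test_on c d \<phi> \<Longrightarrow> G_norm I k \<phi> \<le> M \<longleftrightarrow> bnd I k M \<phi>"
    by (auto simp: G_norm_def Max_le_iff)
qed

section \<open>Continuity as a family of norm estimates\<close>

definition lin :: "((real \<Rightarrow> complex) \<Rightarrow> complex) \<Rightarrow> bool" where
  "lin f \<longleftrightarrow> (\<forall>\<phi>. \<phi> \<notin> test_fun I \<longrightarrow> f \<phi> = 0) \<and>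
     (\<forall>\<phi>\<in>test_fun I. \<forall>\<psi>\<in>test_fun I. f (\<lambda>s. \<phi> s + \<psi> s) = f \<phi> + f \<psi>) \<and>
     (\<forall>\<phi>\<in>test_fun I. \<forall>c. f (\<lambda>s. c * \<phi> s) = c * f \<phi>)"

definition dist_bound :: "real \<Rightarrow> real \<Rightarrow> nat \<Rightarrow> real \<Rightarrow> ((real \<Rightarrow> complex) \<Rightarrow> complex) \<Rightarrow> bool" where
  "dist_bound c d k C f \<longleftrightarrow> C \<ge> 0 \<and> (\<forall>\<phi> M. test_on c d \<phi> \<longrightarrow> M \<ge> 0 \<longrightarrow> bnd I k M \<phi> \<longrightarrow> norm (f \<phi>) \<le> C * M)"

lemma test_topology_open: "openin (test_topology I) = test_open I"
  unfolding test_topology_def using istopology_test_open by (rule topology_inverse')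

lemma abs_convex_test_fun: "abs_convex (test_fun I)"
  unfolding abs_convex_def by (auto intro: test_fun_add test_fun_cmult)

lemma G_inf_on_test_on:
  assumes "bounded J" "closure J \<subseteq> I"
  shows "\<exists>c d. c \<in> I \<and> d \<in> I \<and> c < d \<and> (\<forall>\<phi>\<in>G_inf_on I J. test_on c d \<phi>)"
proof -
  obtain c d where cd: "c \<in> I" "d \<in> I" "c < d" "closure J \<subseteq> {c..d}"
    using compact_in_interval[of "closure J" I] assms opn t0 by auto
  then have J: "J \<subseteq> {c..d}" using closure_subset by blast
  have "test_on c d \<phi>" if "\<phi> \<in> G_inf_on I J" for \<phi>
  proof -
    have "AE s in lebesgue. s \<in> I \<longrightarrow> s \<notin> J \<longrightarrow> \<phi> s = 0"
      using that by (simp add: G_inf_on_def AE_on)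
    then have "AE s in lebesgue. s \<in> I - {c..d} \<longrightarrow> \<phi> s = 0"
      by eventually_elim (use J in blast)
    then show ?thesis using that cd G_inf_smooth by (simp add: G_inf_on_def test_on_def)
  qed
  with cd show ?thesis by blast
qed

lemma topspace_test: "topspace (test_topology I) = test_fun I"
proof -
  have "test_nhd0 I (test_fun I)"
    unfolding test_nhd0_def
  proof (intro conjI allI impI subset_refl abs_convex_test_fun)
    fix J :: "real set" assume J: "is_interval J \<and> bounded J \<and> closure J \<subseteq> I"
    then have "G_inf_on I J \<subseteq> test_fun I" using G_inf_on_test_on test_fun_iff by blast
    then show "\<exists>k. \<exists>\<epsilon>>0. {\<phi> \<in> G_inf_on I J. G_norm I k \<phi> < \<epsilon>} \<subseteq> test_fun I"
      by (intro exI[of _ 0] exI[of _ 1]) auto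
  qed
  then have "test_open I (test_fun I)"
    unfolding test_open_def using test_fun_add by (auto simp: plus_fun_def)
  then show ?thesis
    unfolding topspace_def test_topology_open by (auto simp: test_open_def)
qed

lemma lin_add: "lin f \<Longrightarrow> \<phi> \<in> test_fun I \<Longrightarrow> \<psi> \<in> test_fun I \<Longrightarrow> f (\<lambda>s. \<phi> s + \<psi> s) = f \<phi> + f \<psi>"
  by (simp add: lin_def)

lemma lin_cmult: "lin f \<Longrightarrow> \<phi> \<in> test_fun I \<Longrightarrow> f (\<lambda>s. c * \<phi> s) = c * f \<phi>"
  by (simp add: lin_def)

lemma lin_0: "lin f \<Longrightarrow> f (\<lambda>_. 0) = 0"
  using lin_cmult[of f "\<lambda>_. 0" 0] test_fun_0 by simp

lemma lin_diff: "lin f \<Longrightarrow> \<phi> \<in> test_fun I \<Longrightarrow> \<psi> \<in> test_fun I \<Longrightarrow> f (\<lambda>s. \<phi> s - \<psi> s) = f \<phi> - f \<psi>"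
  using lin_add[OF _ _ test_fun_cmult[of \<psi> "-1"], of f \<phi>] lin_cmult[of f \<psi> "-1"] by simp

text \<open>Some norm ball of radius \<open>e\<close> lies in the preimage of the unit ball, and
  homogeneity turns this into the constant \<open>2 / e\<close>. The factor 2 separates the strict
  inequality in the neighbourhood from the non-strict one in \<open>bnd\<close>.\<close>

lemma continuous_dist_bound:
  assumes f: "lin f" "continuous_map (test_topology I) euclidean f" and cd: "c \<in> I" "d \<in> I" "c < d"
  shows "\<exists>k C. dist_bound c d k C f"
proof -
  define W where "W = {\<phi> \<in> test_fun I. f \<phi> \<in> ball 0 1}"
  have "test_open I W"
    using f(2) open_ball[of 0 1]
    unfolding continuous_map_def topspace_test test_topology_open W_def open_openin[symmetric] by blast
  moreover have "(\<lambda>_. 0) \<in> W" using test_fun_0 lin_0[OF f(1)] by (simp add: W_def)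
  ultimately obtain U where U: "test_nhd0 I U" "\<forall>\<psi>\<in>U. (\<lambda>_. 0) + \<psi> \<in> W"
    unfolding test_open_def by blast
  have "is_interval {c..d} \<and> bounded {c..d} \<and> closure {c..d} \<subseteq> I"
    using Icc_sub cd by (simp add: is_interval_cc)
  then obtain k e where e: "e > 0" "{\<phi> \<in> G_inf_on I {c..d}. G_norm I k \<phi> < e} \<subseteq> U"
    using U(1) unfolding test_nhd0_def by blast
  have small: "norm (f \<phi>) < 1" if "test_on c d \<phi>" "bnd I k (e/2) \<phi>" for \<phi>
  proof -
    have "\<phi> \<in> G_inf_on I {c..d}" using that(1) test_on_G_inf
      unfolding G_inf_on_def AE_on test_on_def by (auto elim: eventually_mono)
    moreover have "G_norm I k \<phi> < e" using bnd_G_norm[OF that(1), of k "e/2"] that(2) e(1) by simp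
    ultimately have "(\<lambda>_. 0) + \<phi> \<in> W" using e(2) U(2) by blast
    then show ?thesis by (simp add: W_def plus_fun_def)
  qed
  have "norm (f \<phi>) \<le> 2 / e * M" if a: "test_on c d \<phi>" "M \<ge> 0" "bnd I k M \<phi>" for \<phi> M
  proof -
    \<comment> \<open>A positive \<open>N\<close> stands in for \<open>M\<close>, since scaling
      divides by the bound and \<open>M\<close> may be zero.\<close>
    have *: "norm (f \<phi>) \<le> 2 / e * N" if "N > 0" "M \<le> N" for N
    proof -
      define r where "r = e / (2 * N)"
      have r: "r > 0" using e that by (simp add: r_def)
      have "bnd I k (norm (complex_of_real r) * N) (\<lambda>s. of_real r * \<phi> s)"
        by (rule bnd_cmult) (rule bnd_mono[OF a(3) that(2)])
      moreover have "norm (complex_of_real r) = r" using r by (simp only: norm_of_real abs_of_pos)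
      then have "norm (complex_of_real r) * N = e / 2" using that by (simp add: r_def)
      ultimately have "norm (f (\<lambda>s. of_real r * \<phi> s)) < 1" using small test_on_cmult[OF a(1)] by metis
      moreover have "f (\<lambda>s. of_real r * \<phi> s) = of_real r * f \<phi>"
        using lin_cmult[OF f(1)] a(1) test_fun_iff by blast
      ultimately have "r * norm (f \<phi>) < 1" using r by (simp add: norm_mult)
      then show ?thesis using e(1) that by (simp add: r_def field_simps)
    qed
    show ?thesis
    proof (cases "M = 0")
      case True
      have "norm (f \<phi>) \<le> 0"
      proof (rule field_le_epsilon)
        fix x :: real assume "x > 0"
        then show "norm (f \<phi>) \<le> 0 + x" using *[of "e * x / 2"] e(1) True by simp
      qed
      then show ?thesis using True by simp
    next
      case False then show ?thesis using *[of M] a(2) by simp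
    qed
  qed
  then show ?thesis unfolding dist_bound_def using e(1) by (intro exI[of _ k] exI[of _ "2/e"]) auto
qed

lemma dist_bound_continuous:
  assumes f: "lin f" and b: "\<And>c d. c \<in> I \<Longrightarrow> d \<in> I \<Longrightarrow> c < d \<Longrightarrow> \<exists>k C. dist_bound c d k C f"
  shows "continuous_map (test_topology I) euclidean f"
  unfolding continuous_map_def topspace_test test_topology_open
proof (intro conjI allI impI)
  show "f \<in> test_fun I \<rightarrow> topspace euclidean" by simp
  fix V :: "complex set" assume "openin euclidean V"
  then have V: "open V" by simp
  show "test_open I {\<phi> \<in> test_fun I. f \<phi> \<in> V}" unfolding test_open_def
  proof (intro conjI ballI)
    fix \<phi> assume "\<phi> \<in> {\<phi> \<in> test_fun I. f \<phi> \<in> V}"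
    then have \<phi>: "\<phi> \<in> test_fun I" "f \<phi> \<in> V" by auto
    obtain r where r: "r > 0" "ball (f \<phi>) r \<subseteq> V" using V \<phi>(2) open_contains_ball by blast
    define U where "U = {\<psi> \<in> test_fun I. norm (f \<psi>) < r}"
    have "test_nhd0 I U" unfolding test_nhd0_def
    proof (intro conjI allI impI)
      show "U \<subseteq> test_fun I" by (auto simp: U_def)
      show "abs_convex U" unfolding abs_convex_def
      proof (intro ballI allI impI)
        fix \<phi> \<psi> and u v :: complex assume a: "\<phi> \<in> U" "\<psi> \<in> U" "norm u + norm v \<le> 1"
        then have t: "(\<lambda>s. u * \<phi> s) \<in> test_fun I" "(\<lambda>s. v * \<psi> s) \<in> test_fun I"
          using test_fun_cmult by (auto simp: U_def)
        define x where "x = max (norm (f \<phi>)) (norm (f \<psi>))"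
        have x: "0 \<le> x" "x < r" "norm (f \<phi>) \<le> x" "norm (f \<psi>) \<le> x" using a by (auto simp: x_def U_def le_max_iff_disj)
        have "f (\<lambda>s. u * \<phi> s + v * \<psi> s) = u * f \<phi> + v * f \<psi>"
          using lin_add[OF f t] a lin_cmult[OF f] by (simp add: U_def)
        then have "norm (f (\<lambda>s. u * \<phi> s + v * \<psi> s)) \<le> norm u * norm (f \<phi>) + norm v * norm (f \<psi>)"
          by (metis norm_mult norm_triangle_ineq)
        also have "\<dots> \<le> norm u * x + norm v * x" using x by (intro add_mono mult_left_mono) auto
        also have "\<dots> = (norm u + norm v) * x" by (simp add: algebra_simps)
        also have "\<dots> \<le> 1 * x" using a(3) x(1) by (intro mult_right_mono)
        finally show "(\<lambda>s. u * \<phi> s + v * \<psi> s) \<in> U"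
          using x(2) test_fun_add[OF t] by (simp add: U_def)
      qed
      fix J :: "real set" assume J: "is_interval J \<and> bounded J \<and> closure J \<subseteq> I"
      then obtain c d where cd: "c \<in> I" "d \<in> I" "c < d" "\<forall>\<phi>\<in>G_inf_on I J. test_on c d \<phi>"
        using G_inf_on_test_on by blast
      obtain k C where kC: "dist_bound c d k C f" using b cd by blast
      \<comment> \<open>Adding 1 makes \<open>e\<close> positive also for \<open>C = 0\<close>, with
        \<open>C * e < r\<close>. The same choice recurs in the approximation arguments
        below.\<close>
      define e where "e = r / (C + 1)"
      have C: "C \<ge> 0" using kC by (simp add: dist_bound_def)
      then have e: "e > 0" "C * e < r" using r(1) by (auto simp: e_def field_simps)
      have "\<phi> \<in> U" if a: "\<phi> \<in> G_inf_on I J" "G_norm I k \<phi> < e" for \<phi>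
      proof -
        have t: "test_on c d \<phi>" using a cd by blast
        then have "bnd I k e \<phi>" using bnd_G_norm[OF t, of k e] a(2) by simp
        then have "norm (f \<phi>) \<le> C * e" using kC t e(1) by (simp add: dist_bound_def)
        then show ?thesis using e(2) t test_fun_iff by (auto simp: U_def)
      qed
      then show "\<exists>k. \<exists>\<epsilon>>0. {\<phi> \<in> G_inf_on I J. G_norm I k \<phi> < \<epsilon>} \<subseteq> U" using e(1) by blast
    qed
    moreover have "\<phi> + \<psi> \<in> {\<phi> \<in> test_fun I. f \<phi> \<in> V}" if "\<psi> \<in> U" for \<psi>
    proof -
      have "f (\<lambda>s. \<phi> s + \<psi> s) = f \<phi> + f \<psi>" using lin_add[OF f \<phi>(1)] that by (simp add: U_def)
      then have "f (\<phi> + \<psi>) \<in> ball (f \<phi>) r" using that by (simp add: U_def plus_fun_def dist_norm)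
      then show ?thesis using r(2) test_fun_add[OF \<phi>(1), of \<psi>] that by (auto simp: U_def plus_fun_def)
    qed
    ultimately show "\<exists>U. test_nhd0 I U \<and> (\<forall>\<psi>\<in>U. \<phi> + \<psi> \<in> {\<phi> \<in> test_fun I. f \<phi> \<in> V})" by blast
  qed auto
qed

text \<open>A locally convex inductive limit tests continuity of linear functionals step by step,
  and on one countably normed step it means an estimate by one of the norms. From here on,
  membership is checked by estimates alone.\<close>

lemma distributions_iff:
  "f \<in> distributions I \<longleftrightarrow> lin f \<and> (\<forall>c\<in>I. \<forall>d\<in>I. c < d \<longrightarrow> (\<exists>k C. dist_bound c d k C f))"
proof -
  have "f \<in> distributions I \<longleftrightarrow> lin f \<and> continuous_map (test_topology I) euclidean f"
    by (auto simp: distributions_def lin_def plus_fun_def)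
  then show ?thesis using continuous_dist_bound dist_bound_continuous by blast
qed

lemma dist_lin: "f \<in> distributions I \<Longrightarrow> lin f"
  by (simp add: distributions_iff)

text \<open>Functionals are defined on functions, not on classes; the estimate with bound zero shows
  that they do not see a difference vanishing almost everywhere.\<close>

lemma dist_AE_cong:
  assumes f: "f \<in> distributions I" and "\<phi> \<in> test_fun I" "\<psi> \<in> test_fun I"
    and eq: "AE s in lebesgue. s \<in> I \<longrightarrow> \<phi> s = \<psi> s"
  shows "f \<phi> = f \<psi>"
proof -
  obtain c d where cd: "test_on c d \<phi>" "test_on c d \<psi>" using test_on_common assms by blast
  then have "c \<in> I" "d \<in> I" "c < d" by (auto simp: test_on_def)
  then obtain k C where kC: "dist_bound c d k C f" using f unfolding distributions_iff by blast
  have "bnd I k 0 (\<lambda>_. 0)" by (induction k) (use der_const in auto)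
  then have "bnd I k 0 (\<lambda>s. \<phi> s - \<psi> s)"
    by (rule bnd_cong) (use eq test_on_smooth[OF test_on_diff[OF cd]] opn in \<open>auto elim: eventually_mono\<close>)
  then have "norm (f (\<lambda>s. \<phi> s - \<psi> s)) \<le> C * 0"
    using kC test_on_diff[OF cd] unfolding dist_bound_def by blast
  then show ?thesis using lin_diff[OF dist_lin[OF f] assms(2,3)] by simp
qed

end

section \<open>Primitives of functions\<close>

lemma AE_negligible: "(AE s in lebesgue. P s) \<Longrightarrow> negligible {s. \<not> P s}"
proof -
  assume "AE s in lebesgue. P s"
  then obtain N where N: "{s. \<not> P s} \<subseteq> N" "N \<in> null_sets lebesgue"
    by (auto elim!: AE_E simp: null_sets_def)
  then show ?thesis using negligible_subset negligible_iff_null_sets by blast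
qed

lemma integral_AE_cong:
  fixes f :: "real \<Rightarrow> complex"
  assumes "AE s in lebesgue. s \<in> S \<longrightarrow> f s = g s"
  shows "integral S f = integral S g"
  by (rule integral_spike[OF AE_negligible[OF assms]]) auto

lemma integral_AE_bound:
  fixes f :: "real \<Rightarrow> complex"
  assumes "f integrable_on {a..b}" "a \<le> b" "B \<ge> 0"
    and "AE s in lebesgue. s \<in> {a..b} \<longrightarrow> norm (f s - l) \<le> B"
  shows "norm (integral {a..b} f - of_real (b - a) * l) \<le> B * (b - a)"
proof -
  let ?N = "{s. \<not> (s \<in> {a..b} \<longrightarrow> norm (f s - l) \<le> B)}"
  let ?g = "\<lambda>s. if s \<in> ?N then 0 else f s - l"
  have "((\<lambda>s. f s - l) has_integral (integral {a..b} f - (b - a) *\<^sub>R l)) {a..b}"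
    using has_integral_const_real[of l a b] assms(1,2)
    by (intro has_integral_diff integrable_integral) auto
  then have "(?g has_integral (integral {a..b} f - (b - a) *\<^sub>R l)) {a..b}"
    by (rule has_integral_spike[OF AE_negligible[OF assms(4)], rotated]) auto
  then have "norm (integral {a..b} f - (b - a) *\<^sub>R l) \<le> B * measure lborel {a..b}"
    using has_integral_bound[of B ?g _ a b] assms(3) by (simp add: box_real)
  then show ?thesis using assms(2) by (simp add: scaleR_conv_of_real)
qed

definition signed_integral :: "real \<Rightarrow> (real \<Rightarrow> complex) \<Rightarrow> real \<Rightarrow> complex" where
  "signed_integral a u t = (if a \<le> t then integral {a..t} u else - integral {t..a} u)"

lemma signed_integral_refl [simp]: "signed_integral a u a = 0"
  by (simp add: signed_integral_def)

context open_interval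
begin

lemma regulated_locally_bounded:
  assumes "regulated u" "{a..b} \<subseteq> I"
  shows "\<exists>M\<ge>0. AE s in lebesgue. s \<in> {a..b} \<longrightarrow> norm (u s) \<le> M"
proof (cases "a \<le> b")
  case True
  then show ?thesis using AE_bounded_of_es[OF True] regulated_lim[OF assms(1)] assms(2) by blast
next
  case False
  then show ?thesis by (intro exI[of _ 0]) auto
qed

text \<open>Setting the function to zero where it exceeds its essential bound leaves a bounded
  measurable function and alters it on a null set only.\<close>

lemma regulated_integrable:
  assumes "regulated u" "{a..b} \<subseteq> I" shows "u integrable_on {a..b}"
proof -
  obtain M where M: "M \<ge> 0" "AE s in lebesgue. s \<in> {a..b} \<longrightarrow> norm (u s) \<le> M"
    using regulated_locally_bounded[OF assms] by blast
  let ?v = "\<lambda>s. if norm (u s) \<le> M then u s else 0"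
  have m: "u \<in> borel_measurable (lebesgue_on {a..b})"
    using measurable_restrict_mono[OF regulated_meas[OF assms(1)] assms(2)] .
  have "?v integrable_on {a..b}"
  proof (rule measurable_bounded_by_integrable_imp_integrable)
    show "?v \<in> borel_measurable (lebesgue_on {a..b})" using m by measurable
    show "(\<lambda>_. M) integrable_on {a..b}" by (rule integrable_const_ivl)
  qed (use M(1) in auto)
  then show ?thesis by (rule integrable_spike[OF _ AE_negligible[OF M(2)]]) auto
qed

lemma signed_integral_diff:
  assumes "regulated u" "a \<in> I" "s \<in> I" "t \<in> I" "s \<le> t"
  shows "signed_integral a u t - signed_integral a u s = integral {s..t} u"
proof -
  have int: "u integrable_on {x..y}" if "x \<in> I" "y \<in> I" for x y
    using regulated_integrable[OF assms(1) Icc_sub[OF that]] .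
  have c: "integral {x..y} u + integral {y..z} u = integral {x..z} u"
    if "x \<le> y" "y \<le> z" "x \<in> I" "z \<in> I" for x y z
    using Henstock_Kurzweil_Integration.integral_combine[OF that(1,2) int[OF that(3,4)]] .
  consider "a \<le> s" | "s < a" "a \<le> t" | "t < a" by linarith
  then show ?thesis
  proof cases
    case 1 then show ?thesis using c[of a s t] assms by (simp add: signed_integral_def algebra_simps)
  next
    case 2 then show ?thesis using c[of s a t] assms by (simp add: signed_integral_def algebra_simps)
  next
    case 3 then show ?thesis using c[of s t a] assms by (simp add: signed_integral_def algebra_simps)
  qed
qed

text \<open>A mean value over a one-sided interval is close to the limit as soon as the integrand is
  close to it almost everywhere. Ordering the end points as \<open>x < y\<close> treats both sides
  at once.\<close>

lemma signed_integral_quotient: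
  assumes u: "regulated u" and a: "a \<in> I" and t: "t \<in> I"
  shows "((\<lambda>s. (signed_integral a u s - signed_integral a u t) / of_real (s - t)) \<longlongrightarrow> slim b u t) (at_side b t)"
proof (rule tendstoI)
  fix e :: real assume e: "e > 0"
  let ?l = "slim b u t"
  have "eventually (\<lambda>s. dist (u s) ?l < e / 2) (es b t)"
    by (rule tendstoD[OF regulated_lim[OF u t]]) (use e in simp)
  then obtain d0 where d0: "d0 > 0" "AE s in lebesgue. s \<in> side b t d0 \<longrightarrow> dist (u s) ?l < e / 2"
    unfolding eventually_es by blast
  obtain d1 where d1: "d1 > 0" "side b t d1 \<subseteq> I" using side_in_open[OF opn t] by metis
  define d where "d = min d0 d1"
  have ne: "AE s in lebesgue. s \<noteq> t" by (rule AE_I'[of "{t}"]) auto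
  have "dist ((signed_integral a u s - signed_integral a u t) / of_real (s - t)) ?l < e" if s: "s \<in> side b t d" for s
  proof -
    have sI: "s \<in> I" using s d1 side_mono[of d d1 b t] by (auto simp: d_def)
    define x y where "x = min s t" and "y = max s t"
    have xy: "x < y" "x \<in> I" "y \<in> I" using s sI t by (auto simp: side_def x_def y_def split: if_splits)
    have "AE r in lebesgue. r \<in> {x..y} \<longrightarrow> norm (u r - ?l) \<le> e / 2"
      using d0(2) ne by eventually_elim
        (use s in \<open>auto simp: side_def x_def y_def d_def dist_norm split: if_splits\<close>)
    then have "norm (integral {x..y} u - of_real (y - x) * ?l) \<le> e / 2 * (y - x)"
      using regulated_integrable[OF u Icc_sub[OF xy(2,3)]] xy(1) e
      by (intro integral_AE_bound) auto
    moreover have "integral {x..y} u = signed_integral a u y - signed_integral a u x"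
      using signed_integral_diff[OF u a xy(2,3)] xy(1) by simp
    ultimately have n: "norm (signed_integral a u y - signed_integral a u x - of_real (y - x) * ?l) \<le> e / 2 * (y - x)" by simp
    have "(signed_integral a u s - signed_integral a u t) / of_real (s - t) = (signed_integral a u y - signed_integral a u x) / of_real (y - x)"
      by (simp add: x_def y_def min_def max_def) (metis minus_diff_eq minus_divide_divide)
    also have "\<dots> - ?l = (signed_integral a u y - signed_integral a u x - of_real (y - x) * ?l) / of_real (y - x)"
      using xy(1) by (simp add: diff_divide_distrib)
    finally have "norm ((signed_integral a u s - signed_integral a u t) / of_real (s - t) - ?l)
        = norm (signed_integral a u y - signed_integral a u x - of_real (y - x) * ?l) / (y - x)"
      using xy(1) by (simp add: norm_divide flip: of_real_diff)
    also have "\<dots> \<le> e / 2" using n xy(1) by (simp add: divide_le_eq)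
    finally show ?thesis using e by (simp add: dist_norm)
  qed
  then show "eventually (\<lambda>s. dist ((signed_integral a u s - signed_integral a u t) / of_real (s - t)) ?l < e) (at_side b t)"
    unfolding eventually_at_side using d0 d1 by (intro exI[of _ d]) (auto simp: d_def)
qed

lemma signed_integral_continuous: "regulated u \<Longrightarrow> a \<in> I \<Longrightarrow> continuous_on I (signed_integral a u)"
  and der_signed_integral: "regulated u \<Longrightarrow> a \<in> I \<Longrightarrow> der (signed_integral a u) u"
  using der_classical[OF signed_integral_quotient] by blast+

text \<open>The quotient is known to be small for almost every \<open>y\<close> only; continuity of
  \<open>v\<close> extends the estimate to every nearby \<open>y\<close>, and bisection chains the
  estimates with one and the same slope \<open>e\<close>. Without continuity a step would be a
  counterexample.\<close>

lemma zero_derivative_constant: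
  assumes v: "continuous_on I v" and d: "der v z" "\<And>t b. t \<in> I \<Longrightarrow> slim b z t = 0"
    and st: "s \<in> I" "t \<in> I"
  shows "v s = v t"
proof -
  have main: "norm (v t - v s) \<le> 0" if st: "s \<in> I" "t \<in> I" "s \<le> t" for s t
  proof (rule field_le_epsilon)
    fix e0 :: real assume e0: "e0 > 0"
    define e where "e = e0 / (t - s + 1)"
    have e: "e > 0" "e * (t - s) \<le> e0" using e0 st(3) by (auto simp: e_def field_simps)
    have "norm (v t - v s) \<le> e * (t - s)" using st(3)
    proof (induction rule: Bolzano)
      case (trans a b c)
      then show ?case using norm_triangle_ineq[of "v c - v b" "v b - v a"] by (simp add: algebra_simps)
    next
      case (local x)
      have xI: "x \<in> I" using local Icc_sub[OF st(1,2)] by auto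
      have "\<exists>r>0. \<forall>y\<in>side b x r. norm (v y - v x) \<le> e * \<bar>y - x\<bar>" for b
      proof -
        have "((\<lambda>y. (v y - v x) / of_real (y - x)) \<longlongrightarrow> 0) (es b x)"
          using derD(3)[OF d(1) xI, of b] regulated_continuous(2)[OF v xI] d(2)[OF xI] by simp
        from tendstoD[OF this e(1)] obtain r0 where r0: "r0 > 0"
          "AE y in lebesgue. y \<in> side b x r0 \<longrightarrow> dist ((v y - v x) / of_real (y - x)) 0 < e"
          unfolding eventually_es by blast
        obtain r1 where r1: "r1 > 0" "side b x r1 \<subseteq> I" using side_in_open[OF opn xI] by metis
        define r where "r = min r0 r1"
        have sub: "side b x r \<subseteq> side b x r0" "side b x r \<subseteq> I"
          using side_mono[of r r0] side_mono[of r r1 b x] r1(2) by (auto simp: r_def)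
        have "norm (v y - v x) - e * \<bar>y - x\<bar> \<le> 0" if y: "y \<in> side b x r" for y
        proof (rule AE_le_continuous[OF _ _ _ y])
          show "open (side b x r)" by (simp add: side_def)
          show "continuous_on (side b x r) (\<lambda>y. norm (v y - v x) - e * \<bar>y - x\<bar>)"
            by (intro continuous_intros continuous_on_subset[OF v sub(2)])
          show "AE y in lebesgue. y \<in> side b x r \<longrightarrow> norm (v y - v x) - e * \<bar>y - x\<bar> \<le> 0"
            using r0(2)
          proof eventually_elim
            case (elim y)
            show ?case
            proof
              assume y: "y \<in> side b x r"
              then have "norm (v y - v x) / norm (complex_of_real (y - x)) < e"
                using elim sub by (auto simp: norm_divide)
              moreover have "norm (complex_of_real (y - x)) = \<bar>y - x\<bar>" by (simp only: norm_of_real)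
              moreover have "y \<noteq> x" using y by (auto simp: side_def split: if_splits)
              ultimately show "norm (v y - v x) - e * \<bar>y - x\<bar> \<le> 0" by (simp add: divide_less_eq)
            qed
          qed
        qed
        then show ?thesis using r0 r1 by (intro exI[of _ r]) (auto simp: r_def)
      qed
      then obtain r where r: "\<And>b. r b > 0" "\<And>b. \<forall>y\<in>side b x (r b). norm (v y - v x) \<le> e * \<bar>y - x\<bar>" by metis
      show ?case
      proof (rule exI[of _ "min (r True) (r False)"], intro conjI allI impI)
        show "0 < min (r True) (r False)" using r by simp
        fix a b assume ab: "a \<le> x \<and> x \<le> b \<and> b - a < min (r True) (r False)"
        have "norm (v b - v x) \<le> e * (b - x)"
          using r(2)[of True] ab by (cases "b = x") (auto simp: side_def)
        moreover have "norm (v x - v a) \<le> e * (x - a)"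
          using r(2)[of False] ab by (cases "a = x") (auto simp: side_def norm_minus_commute)
        ultimately show "norm (v b - v a) \<le> e * (b - a)"
          using norm_triangle_ineq[of "v b - v x" "v x - v a"] by (simp add: algebra_simps)
      qed
    qed
    then show "norm (v t - v s) \<le> 0 + e0" using e by simp
  qed
  show ?thesis using main[of s t] main[of t s] st by (cases "s \<le> t") auto
qed

lemma der_determines:
  assumes "continuous_on I g" "der g h" "a \<in> I" "t \<in> I"
  shows "g t = g a + signed_integral a h t"
proof -
  have h: "regulated h" using derD(2)[OF assms(2)] .
  let ?v = "\<lambda>s. g s - signed_integral a h s"
  have "?v a = ?v t"
  proof (rule zero_derivative_constant)
    show "continuous_on I ?v" by (intro continuous_on_diff assms(1) signed_integral_continuous h assms(3))
    show "der ?v (\<lambda>s. h s - h s)" by (intro der_diff assms(2) der_signed_integral h assms(3))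
  qed (simp_all add: slim_const assms)
  then show ?thesis by (simp add: algebra_simps)
qed

text \<open>For a regulated class, its right-continuous representative, which is continuous exactly
  at the points without a jump.\<close>

definition rep :: "(real \<Rightarrow> complex) \<Rightarrow> real \<Rightarrow> complex" where
  "rep u = (\<lambda>t. slim True u t)"

definition jump_free :: "(real \<Rightarrow> complex) \<Rightarrow> bool" where
  "jump_free u \<longleftrightarrow> (\<forall>t\<in>I. slim True u t = slim False u t)"

text \<open>An estimate valid almost everywhere on an open one-sided interval passes to the right
  limit at each of its points, so the essential limits of \<open>u\<close> become ordinary limits of
  \<open>rep u\<close>.\<close>

lemma rep_lim:
  assumes u: "regulated u" and t: "t \<in> I"
  shows "(rep u \<longlongrightarrow> slim b u t) (at_side b t)"
proof (rule tendstoI)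
  fix e :: real assume e: "e > 0"
  let ?l = "slim b u t"
  have "eventually (\<lambda>s. dist (u s) ?l < e / 2) (es b t)"
    by (rule tendstoD[OF regulated_lim[OF u t]]) (use e in simp)
  then obtain d0 where d0: "d0 > 0" "AE s in lebesgue. s \<in> side b t d0 \<longrightarrow> dist (u s) ?l < e / 2"
    unfolding eventually_es by blast
  obtain d1 where d1: "d1 > 0" "side b t d1 \<subseteq> I" using side_in_open[OF opn t] by metis
  define d where "d = min d0 d1"
  have sub: "side b t d \<subseteq> side b t d0" "side b t d \<subseteq> I"
    using side_mono[of d d0] side_mono[of d d1 b t] d1(2) by (auto simp: d_def)
  have "dist (rep u s) ?l < e" if s: "s \<in> side b t d" for s
  proof -
    have "eventually (\<lambda>r. norm (u r - ?l) \<le> e / 2) (es True s)"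
    proof (rule eventually_es_open[OF _ s])
      show "open (side b t d)" by (simp add: side_def)
      show "AE r in lebesgue. r \<in> side b t d \<longrightarrow> norm (u r - ?l) \<le> e / 2"
        using d0(2) by eventually_elim (use sub in \<open>auto simp: dist_norm intro: less_imp_le\<close>)
    qed
    moreover have "((\<lambda>r. norm (u r - ?l)) \<longlongrightarrow> norm (rep u s - ?l)) (es True s)"
      unfolding rep_def using sub(2) s by (intro tendsto_norm tendsto_diff tendsto_const regulated_lim u) auto
    ultimately have "norm (rep u s - ?l) \<le> e / 2"
      using tendsto_upperbound[OF _ _ es_ne] by blast
    then show ?thesis using e by (simp add: dist_norm)
  qed
  then show "eventually (\<lambda>s. dist (rep u s) ?l < e) (at_side b t)"
    unfolding eventually_at_side using d0 d1 by (intro exI[of _ d]) (auto simp: d_def)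
qed

lemma rep_AE: "regulated u \<Longrightarrow> AE s in lebesgue. s \<in> I \<longrightarrow> u s = rep u s"
proof -
  assume u: "regulated u"
  have "AE s in lebesgue. s \<in> I \<longrightarrow> u s - rep u s = 0"
    by (rule AE_eq_of_slim[OF opn])
       (use tendsto_diff[OF regulated_lim[OF u] tendsto_mono[OF es_le rep_lim[OF u]]] in fastforce)
  then show ?thesis by simp
qed

lemma rep_isCont:
  assumes "regulated u" "t \<in> I" "slim True u t = slim False u t"
  shows "isCont (rep u) t"
  using rep_lim[OF assms(1,2), of True] rep_lim[OF assms(1,2), of False] assms(3)
  by (simp add: at_side_def isCont_def filterlim_split_at rep_def)

lemma rep_continuous: "regulated u \<Longrightarrow> jump_free u \<Longrightarrow> continuous_on I (rep u)"
  by (rule continuous_at_imp_continuous_on) (auto simp: jump_free_def rep_isCont)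

lemma jump_free_continuous: "continuous_on I u \<Longrightarrow> jump_free u"
  by (simp add: jump_free_def regulated_continuous(2))

lemma slim_AE_cong: "AE s in lebesgue. s \<in> I \<longrightarrow> f s = g s \<Longrightarrow> t \<in> I \<Longrightarrow> slim b f t = slim b g t"
  using slim_cong[OF opn] by blast

lemma der_rep: "der u h \<Longrightarrow> jump_free u \<Longrightarrow> der (rep u) h"
proof -
  assume "der u h" "jump_free u"
  note u = derD(1)[OF this(1)]
  show ?thesis
    by (rule der_cong[OF \<open>der u h\<close> rep_AE[OF u] _ _ derD(2)[OF \<open>der u h\<close>]])
       (simp_all add: regulated_continuous(1)[OF rep_continuous[OF u \<open>jump_free u\<close>]])
qed

section \<open>Total mass and compactly supported primitives\<close>

definition total :: "(real \<Rightarrow> complex) \<Rightarrow> complex" where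
  "total u = integral I u"

text \<open>Integrating over all of \<open>I\<close> to the left of \<open>t\<close> makes the
  primitive independent of the interval chosen to contain the support.\<close>

definition left_primitive :: "(real \<Rightarrow> complex) \<Rightarrow> real \<Rightarrow> complex" where
  "left_primitive u t = integral (I \<inter> {..t}) u"

lemma integral_test_on:
  assumes "test_on c d u" "S \<subseteq> I"
  shows "integral S u = integral ({c..d} \<inter> S) u"
proof -
  have "integral S u = integral S (\<lambda>s. if s \<in> {c..d} then u s else 0)"
    by (rule integral_AE_cong) (use assms in \<open>auto simp: test_on_def elim: eventually_mono\<close>)
  then show ?thesis by (simp only: Henstock_Kurzweil_Integration.integral_restrict_Int)
qed

lemma total_test_on: "test_on c d u \<Longrightarrow> total u = integral {c..d} u"
  using integral_test_on[of c d u I] Icc_sub[of c d] by (simp add: total_def test_on_def inf_absorb1)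

lemma left_primitive_test_on:
  assumes u: "test_on c d u" and t: "t \<in> I"
  shows "left_primitive u t = signed_integral c u t"
proof -
  have c: "c \<in> I" "d \<in> I" "c < d" using u by (auto simp: test_on_def)
  have "left_primitive u t = integral ({c..d} \<inter> (I \<inter> {..t})) u" unfolding left_primitive_def by (rule integral_test_on[OF u]) auto
  also have "{c..d} \<inter> (I \<inter> {..t}) = {c..d} \<inter> {..t}" using Icc_sub[OF c(1,2)] by auto
  also have "integral \<dots> u = signed_integral c u t"
  proof (cases "c \<le> t")
    case True
    have "integral {c..t} u = integral ({c..d} \<inter> {c..t}) u" by (rule integral_test_on[OF u Icc_sub[OF c(1) t]])
    moreover have "{c..d} \<inter> {c..t} = {c..d} \<inter> {..t}" by auto
    ultimately show ?thesis using True by (simp add: signed_integral_def)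
  next
    case False
    have "integral {t..c} u = integral ({c..d} \<inter> {t..c}) u" by (rule integral_test_on[OF u Icc_sub[OF t c(1)]])
    also have "{c..d} \<inter> {t..c} = {c..c}" using c False by auto
    finally have "integral {t..c} u = 0" by simp
    moreover have "{c..d} \<inter> {..t} = {}" using False by auto
    ultimately show ?thesis using False by (simp add: signed_integral_def)
  qed
  finally show ?thesis .
qed

lemma test_on_integrable: "test_on c d u \<Longrightarrow> a \<in> I \<Longrightarrow> b \<in> I \<Longrightarrow> u integrable_on {a..b}"
  using regulated_integrable smooth_regulated test_on_smooth Icc_sub by blast

lemma total_add: "test_on c d u \<Longrightarrow> test_on c d v \<Longrightarrow> total (\<lambda>s. u s + v s) = total u + total v"
  using test_on_integrable[of c d u c d] test_on_integrable[of c d v c d] test_on_add[of c d u v]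
  by (simp add: total_test_on integral_add) (simp add: test_on_def integral_add)

lemma total_cmult: "test_on c d u \<Longrightarrow> total (\<lambda>s. k * u s) = k * total u"
  using test_on_cmult[of c d u k] by (simp add: total_test_on)

lemma left_primitive_add: "test_on c d u \<Longrightarrow> test_on c d v \<Longrightarrow> t \<in> I \<Longrightarrow> left_primitive (\<lambda>s. u s + v s) t = left_primitive u t + left_primitive v t"
  using test_on_integrable[of c d u c t] test_on_integrable[of c d v c t] test_on_add[of c d u v]
    test_on_integrable[of c d u t c] test_on_integrable[of c d v t c]
  by (simp add: left_primitive_test_on signed_integral_def) (simp add: test_on_def integral_add)

lemma left_primitive_cmult: "test_on c d u \<Longrightarrow> t \<in> I \<Longrightarrow> left_primitive (\<lambda>s. k * u s) t = k * left_primitive u t"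
  using test_on_cmult[of c d u k] by (simp add: left_primitive_test_on signed_integral_def)

text \<open>For finite \<open>S\<close> these are, up to null sets, the piecewise polynomials of
  degree below \<open>n\<close>: the derivative of order \<open>n\<close> vanishes and those of
  lower order jump only at points of \<open>S\<close>. The recursion avoids explicit
  polynomials.\<close>

primrec spline :: "nat \<Rightarrow> real set \<Rightarrow> (real \<Rightarrow> complex) \<Rightarrow> bool" where
  "spline 0 S u \<longleftrightarrow> regulated u \<and> (AE s in lebesgue. s \<in> I \<longrightarrow> u s = 0)"
| "spline (Suc n) S u \<longleftrightarrow> (\<forall>t\<in>I - S. slim True u t = slim False u t) \<and> (\<exists>h. der u h \<and> spline n S h)"

lemma spline_regulated: "spline n S u \<Longrightarrow> regulated u"
  by (cases n) (auto dest: derD)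

lemma spline_smooth: "spline n S u \<Longrightarrow> smooth u"
proof (induction n arbitrary: u)
  case 0
  then show ?case using smooth_cong[OF smooth_const[of 0], of u] by (auto elim: eventually_mono)
next
  case (Suc n) then show ?case using smooth_of_der by auto
qed

lemma spline_Suc: "spline n S u \<Longrightarrow> spline (Suc n) S u"
proof (induction n arbitrary: u)
  case 0
  then have z: "AE s in lebesgue. s \<in> I \<longrightarrow> u s = 0" and r: "regulated u" by auto
  have "der u (\<lambda>_. 0)"
    by (rule der_cong[OF der_const[of 0]]) (use z r regulated_const in \<open>auto elim: eventually_mono\<close>)
  moreover have "slim b u t = 0" if "t \<in> I" for b t
    using slim_AE_cong[of u "\<lambda>_. 0", OF z that] by (simp add: slim_const)
  ultimately show ?case using regulated_const by (auto intro!: exI[of _ "\<lambda>_. 0"])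
next
  case (Suc n)
  then obtain h where h: "der u h" "spline n S h" and j: "\<forall>t\<in>I - S. slim True u t = slim False u t" by auto
  have "spline (Suc n) S h" using Suc.IH h(2) .
  then show ?case using h(1) j by (subst spline.simps(2)) blast
qed

lemma spline_le: "spline n S u \<Longrightarrow> n \<le> m \<Longrightarrow> spline m S u"
proof (induction m)
  case (Suc m)
  then show ?case using spline_Suc by (cases "n = Suc m") auto
qed simp

lemma spline_mono: "spline n S u \<Longrightarrow> S \<subseteq> T \<Longrightarrow> spline n T u"
  by (induction n arbitrary: u) auto

lemma spline_add: "spline n S u \<Longrightarrow> spline n S v \<Longrightarrow> spline n S (\<lambda>s. u s + v s)"
proof (induction n arbitrary: u v)
  case 0
  then show ?case by (auto simp: regulated_add elim: eventually_elim2)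
next
  case (Suc n)
  then obtain h k where "der u h" "spline n S h" "der v k" "spline n S k" by auto
  then have "der (\<lambda>s. u s + v s) (\<lambda>s. h s + k s)" "spline n S (\<lambda>s. h s + k s)"
    using der_add Suc.IH by auto
  moreover have "\<forall>t\<in>I - S. slim True (\<lambda>s. u s + v s) t = slim False (\<lambda>s. u s + v s) t"
    using slim_add[OF spline_regulated[OF Suc.prems(1)] spline_regulated[OF Suc.prems(2)]] Suc.prems by simp
  ultimately show ?case by auto
qed

lemma spline_const: "spline (Suc 0) {} (\<lambda>_. c)"
  using der_const regulated_const by (auto simp: slim_const)

lemma spline_primitive: "spline n S p \<Longrightarrow> a \<in> I \<Longrightarrow> spline (Suc n) S (\<lambda>t. signed_integral a p t + c)"
proof -
  assume a: "spline n S p" "a \<in> I"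
  have "continuous_on I (\<lambda>t. signed_integral a p t + c)"
    by (intro continuous_intros signed_integral_continuous spline_regulated[OF a(1)] a(2))
  then have "\<forall>t\<in>I. slim True (\<lambda>t. signed_integral a p t + c) t = slim False (\<lambda>t. signed_integral a p t + c) t"
    by (simp add: regulated_continuous(2))
  moreover have "der (\<lambda>t. signed_integral a p t + c) p"
    using der_add[OF der_signed_integral[OF spline_regulated[OF a(1)] a(2)] der_const[of c]] by simp
  ultimately show ?thesis using a(1) by auto
qed

lemma spline_step_mult: "spline n S p \<Longrightarrow> spline n (insert a S) (\<lambda>s. step a s * p s)"
proof (induction n arbitrary: p)
  case 0
  then show ?case using regulated_mult smooth_regulated[OF smooth_step] by (auto elim: eventually_mono)
next
  case (Suc n)
  then obtain h where h: "der p h" "spline n S h" by auto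
  have "der (\<lambda>s. step a s * p s) (\<lambda>s. step a s * h s)" using der_mult[OF der_step h(1)] by simp
  moreover have "slim True (\<lambda>s. step a s * p s) t = slim False (\<lambda>s. step a s * p s) t"
    if "t \<in> I - insert a S" for t
    using that Suc.prems slim_mult[OF smooth_regulated[OF smooth_step] spline_regulated[OF Suc.prems], of t]
    by (simp add: slim_step)
  ultimately show ?case using Suc.IH[OF h(2)] by auto
qed

lemma spline_cmult: "spline n S p \<Longrightarrow> spline n S (\<lambda>s. k * p s)"
proof (induction n arbitrary: p)
  case 0
  then show ?case using regulated_mult regulated_const by (auto elim: eventually_mono)
next
  case (Suc n)
  then obtain h where h: "der p h" "spline n S h" by auto
  have "slim True (\<lambda>s. k * p s) t = slim False (\<lambda>s. k * p s) t" if "t \<in> I - S" for t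
    using that Suc.prems slim_cmult[OF spline_regulated[OF Suc.prems], of t] by simp
  then show ?case using Suc.IH[OF h(2)] der_cmult[OF h(1), of k] by auto
qed

lemma spline_add_ex:
  assumes "spline n S u" "finite S" "spline m T v" "finite T"
  shows "\<exists>n S. finite S \<and> spline n S (\<lambda>s. u s + v s)"
  using spline_add[OF spline_mono[OF spline_le[OF assms(1), of "max n m"], of "S \<union> T"]
      spline_mono[OF spline_le[OF assms(3), of "max n m"], of "S \<union> T"]] assms(2,4)
  by (intro exI[of _ "max n m"] exI[of _ "S \<union> T"]) auto

text \<open>The witness is the normalised indicator of an interval that ends midway between
  \<open>c\<close> and \<open>t0\<close>. Being a spline, it does not spoil another spline when a
  multiple of it is subtracted to remove the mean.\<close>

lemma e0_exists: "\<exists>e c d. test_on c d e \<and> d < t0 \<and> total e = 1 \<and> (\<exists>n S. finite S \<and> spline n S e)"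
proof -
  obtain c where c: "c \<in> I" "c < t0" using before_t0 .
  define d where "d = (c + t0) / 2"
  have d: "c < d" "d < t0" "d \<in> I" using c Icc_sub[OF c(1) t0] by (auto simp: d_def)
  define k :: complex where "k = of_real (1 / (d - c))"
  define e where "e = (\<lambda>s. step c s * k + step d s * - k)"
  have "smooth e" unfolding e_def by (intro smooth_mult smooth_const smooth_add smooth_step)
  then have t: "test_on c d e" unfolding test_on_def using c d by (auto simp: e_def step_def)
  have "AE s in lebesgue. s \<notin> {c}" by (rule AE_I'[of "{c}"]) auto
  then have "AE s in lebesgue. s \<in> {c..d} \<longrightarrow> e s = k"
    by eventually_elim (auto simp: e_def step_def)
  then have "integral {c..d} e = integral {c..d} (\<lambda>_. k)" by (rule integral_AE_cong)
  also have "\<dots> = 1" using d by (simp add: k_def scaleR_conv_of_real flip: of_real_diff of_real_divide of_real_mult)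
  finally have "total e = 1" using total_test_on[OF t] by simp
  moreover have "\<exists>n S. finite S \<and> spline n S e" unfolding e_def
    by (rule spline_add_ex[OF spline_step_mult[OF spline_const] _ spline_step_mult[OF spline_const]]) auto
  ultimately show ?thesis using d t by blast
qed

definition e0 :: "real \<Rightarrow> complex" where
  "e0 = (SOME e. \<exists>c d. test_on c d e \<and> d < t0 \<and> total e = 1 \<and> (\<exists>n S. finite S \<and> spline n S e))"

lemma e0: "\<exists>c d. test_on c d e0 \<and> d < t0" "total e0 = 1" "\<exists>n S. finite S \<and> spline n S e0"
  using someI_ex[OF e0_exists] unfolding e0_def by blast+

lemma e0_test: "e0 \<in> test_fun I"
  using e0 test_fun_iff by blast

text \<open>Subtracting the mean, which is placed to the left of \<^term>\<open>t0\<close>, makes the primitive compactly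
  supported; distributions vanishing before \<^term>\<open>t0\<close> do not see the correction.\<close>

definition mean_free :: "(real \<Rightarrow> complex) \<Rightarrow> real \<Rightarrow> complex" where
  "mean_free u = (\<lambda>s. u s - total u * e0 s)"

definition compact_primitive :: "(real \<Rightarrow> complex) \<Rightarrow> real \<Rightarrow> complex" where
  "compact_primitive u = left_primitive (mean_free u)"

lemma mean_free_test_on: "test_on c d u \<Longrightarrow> test_on c d e0 \<Longrightarrow> test_on c d (mean_free u)"
  unfolding mean_free_def by (intro test_on_diff test_on_cmult)

lemma total_mean_free: "test_on c d u \<Longrightarrow> test_on c d e0 \<Longrightarrow> total (mean_free u) = 0"
  using total_add[OF _ test_on_cmult[of c d e0 "- total u"], of u] total_cmult[of c d e0 "- total u"] e0(2)
  by (simp add: mean_free_def)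

lemma compact_primitive_signed_integral: "test_on c d u \<Longrightarrow> test_on c d e0 \<Longrightarrow> t \<in> I \<Longrightarrow> compact_primitive u t = signed_integral c (mean_free u) t"
  unfolding compact_primitive_def using left_primitive_test_on mean_free_test_on by blast

lemma compact_primitive_continuous: "test_on c d u \<Longrightarrow> test_on c d e0 \<Longrightarrow> continuous_on I (compact_primitive u)"
  using signed_integral_continuous[OF smooth_regulated[OF test_on_smooth[OF mean_free_test_on]], of c d u c] compact_primitive_signed_integral[of c d u]
  by (simp add: test_on_def cong: continuous_on_cong)

lemma compact_primitive_der: assumes "test_on c d u" "test_on c d e0" shows "der (compact_primitive u) (mean_free u)"
proof -
  have m: "regulated (mean_free u)" using smooth_regulated[OF test_on_smooth[OF mean_free_test_on[OF assms]]] .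
  have "c \<in> I" using assms by (simp add: test_on_def)
  then show ?thesis
    by (intro der_cong[OF der_signed_integral[OF m, of c] _ _ regulated_continuous(1)[OF compact_primitive_continuous[OF assms]] m])
       (auto simp: compact_primitive_signed_integral[OF assms])
qed

text \<open>To the right of \<open>d\<close> the primitive equals the total mass, which
  \<open>mean_free\<close> has made zero.\<close>

lemma compact_primitive_test_on: assumes "test_on c d u" "test_on c d e0" shows "test_on c d (compact_primitive u)"
proof -
  note m = mean_free_test_on[OF assms]
  have cd: "c \<in> I" "d \<in> I" "c < d" using assms by (auto simp: test_on_def)
  have zero: "compact_primitive u t = 0" if t: "t \<in> I - {c..d}" for t
  proof (cases "t < c")
    case True
    have "integral {t..c} (mean_free u) = integral ({c..d} \<inter> {t..c}) (mean_free u)"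
      by (rule integral_test_on[OF m]) (use Icc_sub t cd in auto)
    also have "{c..d} \<inter> {t..c} = {c..c}" using cd True by auto
    finally show ?thesis using True t compact_primitive_signed_integral[OF assms, of t] by (simp add: signed_integral_def)
  next
    case False
    then have td: "d < t" using t by auto
    have "integral {c..t} (mean_free u) = integral ({c..d} \<inter> {c..t}) (mean_free u)"
      by (rule integral_test_on[OF m]) (use Icc_sub t cd in auto)
    also have "{c..d} \<inter> {c..t} = {c..d}" using td by auto
    also have "integral {c..d} (mean_free u) = 0" using total_mean_free[OF assms] total_test_on[OF m] by simp
    finally show ?thesis using td cd t compact_primitive_signed_integral[OF assms, of t] by (simp add: signed_integral_def)
  qed
  have "smooth (compact_primitive u)" by (rule smooth_of_der[OF compact_primitive_der[OF assms] test_on_smooth[OF m]])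
  then show ?thesis using zero cd by (simp add: test_on_def)
qed

lemma compact_primitive_jump_free: "u \<in> test_fun I \<Longrightarrow> jump_free (compact_primitive u)"
  and compact_primitive_test: "u \<in> test_fun I \<Longrightarrow> compact_primitive u \<in> test_fun I"
  using test_on_common[OF _ e0_test, of u] jump_free_continuous compact_primitive_continuous compact_primitive_test_on test_fun_iff by metis+

lemma compact_primitive_add:
  assumes "test_on c d u" "test_on c d v" "test_on c d e0" "t \<in> I"
  shows "compact_primitive (\<lambda>s. u s + v s) t = compact_primitive u t + compact_primitive v t"
proof -
  have "mean_free (\<lambda>s. u s + v s) = (\<lambda>s. mean_free u s + mean_free v s)"
    unfolding mean_free_def total_add[OF assms(1,2)] by (simp add: algebra_simps)
  then show ?thesis using left_primitive_add[OF mean_free_test_on[OF assms(1,3)] mean_free_test_on[OF assms(2,3)] assms(4)]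
    by (simp add: compact_primitive_def)
qed

lemma compact_primitive_cmult:
  assumes "test_on c d u" "test_on c d e0" "t \<in> I"
  shows "compact_primitive (\<lambda>s. k * u s) t = k * compact_primitive u t"
proof -
  have "mean_free (\<lambda>s. k * u s) = (\<lambda>s. k * mean_free u s)"
    unfolding mean_free_def total_cmult[OF assms(1)] by (simp add: algebra_simps)
  then show ?thesis using left_primitive_cmult[OF mean_free_test_on[OF assms(1,2)] assms(3)] by (simp add: compact_primitive_def)
qed

lemma slim_boundary: "test_on c d u \<Longrightarrow> slim False u c = 0" "test_on c d u \<Longrightarrow> slim True u d = 0"
proof -
  assume u: "test_on c d u"
  then have cd: "c \<in> I" "d \<in> I" "c < d" by (auto simp: test_on_def)
  have z: "AE s in lebesgue. s \<in> I - {c..d} \<longrightarrow> u s = 0" using u by (simp add: test_on_def)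
  obtain e where e: "e > 0" "side False c e \<subseteq> I" using side_in_open[OF opn cd(1)] by metis
  have "eventually (\<lambda>s. u s = 0) (es False c)" unfolding eventually_es using e z
    by (intro exI[of _ e]) (auto simp: side_def elim!: eventually_mono)
  then show "slim False u c = 0" by (intro slimI tendsto_eventually)
  obtain e where e: "e > 0" "side True d e \<subseteq> I" using side_in_open[OF opn cd(2)] by metis
  have "eventually (\<lambda>s. u s = 0) (es True d)" unfolding eventually_es using e z
    by (intro exI[of _ e]) (auto simp: side_def elim!: eventually_mono)
  then show "slim True u d = 0" by (intro slimI tendsto_eventually)
qed

text \<open>A continuous representative is recovered by integrating the derivative from
  \<open>c\<close>, where it starts at zero. As it is zero at \<open>d\<close> too, the total mass
  of the derivative vanishes.\<close>

lemma jump_free_primitive: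
  assumes "test_on c d \<psi>" "jump_free \<psi>" "der \<psi> h" "t \<in> I"
  shows "rep \<psi> t = signed_integral c h t" "total h = 0"
proof -
  have cd: "c \<in> I" "d \<in> I" "c < d" using assms by (auto simp: test_on_def)
  have r: "regulated \<psi>" using smooth_regulated[OF test_on_smooth[OF assms(1)]] .
  have "rep \<psi> c = 0" using slim_boundary(1)[OF assms(1)] assms(2) cd by (simp add: rep_def jump_free_def)
  then have *: "rep \<psi> t = signed_integral c h t" if "t \<in> I" for t
    using der_determines[OF rep_continuous[OF r assms(2)] der_rep[OF assms(3,2)] cd(1) that] by simp
  then show "rep \<psi> t = signed_integral c h t" using assms(4) .
  have "integral {c..d} h = 0" using *[OF cd(2)] cd slim_boundary(2)[OF assms(1)]
    by (simp add: rep_def signed_integral_def)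
  moreover have "total h = integral {c..d} h"
  proof -
    obtain h' where h': "der \<psi> h'" "smooth h'" using smooth_der test_on_smooth[OF assms(1)] by blast
    have eq: "AE s in lebesgue. s \<in> I \<longrightarrow> h s = h' s" using der_unique[OF assms(3) h'(1)] .
    have "total h = total h'" unfolding total_def by (rule integral_AE_cong[OF eq])
    also have "\<dots> = integral {c..d} h'" using total_test_on[OF test_on_der[OF assms(1) h']] .
    also have "\<dots> = integral {c..d} h"
      by (rule integral_AE_cong) (use eq Icc_sub[OF cd(1,2)] in \<open>auto elim!: eventually_mono\<close>)
    finally show ?thesis .
  qed
  ultimately show "total h = 0" by simp
qed

text \<open>The derivative of a jump-free test function has mean zero, so nothing is subtracted and
  integration undoes differentiation.\<close>

lemma compact_primitive_der_inverse:
  assumes "test_on c d \<psi>" "jump_free \<psi>" "der \<psi> h" "smooth h" "test_on c d e0"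
  shows "AE s in lebesgue. s \<in> I \<longrightarrow> compact_primitive h s = \<psi> s"
proof -
  have h: "test_on c d h" using test_on_der[OF assms(1,3,4)] .
  have "mean_free h = h" unfolding mean_free_def using jump_free_primitive(2)[OF assms(1-3) t0] by simp
  then have "compact_primitive h t = rep \<psi> t" if "t \<in> I" for t
    using compact_primitive_signed_integral[OF h assms(5) that] jump_free_primitive(1)[OF assms(1-3) that] by simp
  then show ?thesis using rep_AE[OF smooth_regulated[OF test_on_smooth[OF assms(1)]]] by (auto elim: eventually_mono)
qed

lemma bnd_test_on: "test_on c d \<phi> \<Longrightarrow> \<exists>M\<ge>0. bnd I k M \<phi>"
proof (induction k arbitrary: \<phi>)
  case 0 then show ?case using test_on_bounded by auto
next
  case (Suc k)
  obtain M where M: "M \<ge> 0" "AE s in lebesgue. s \<in> I \<longrightarrow> norm (\<phi> s) \<le> M" using test_on_bounded Suc.prems by blast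
  obtain N where N: "N \<ge> 0" "bnd I k N (dG I \<phi>)" using Suc.IH dG_test_on(2) Suc.prems by blast
  have "bnd I k (max M N) (dG I \<phi>)" using bnd_mono[OF N(2)] by simp
  moreover have "AE s in lebesgue. s \<in> I \<longrightarrow> norm (\<phi> s) \<le> max M N"
    using M(2) by (auto elim: eventually_mono)
  ultimately show ?case using dG_test_on(1)[OF Suc.prems] M(1) by (intro exI[of _ "max M N"]) auto
qed

text \<open>Integration gains one order, since the derivative of the primitive is
  \<open>mean_free u\<close> and the primitive itself is controlled by the length of the
  interval.\<close>

lemma compact_primitive_bnd:
  assumes e: "test_on c d e0"
  shows "\<exists>C\<ge>0. \<forall>u M. test_on c d u \<longrightarrow> M \<ge> 0 \<longrightarrow> bnd I k M u \<longrightarrow> bnd I (Suc k) (C * M) (compact_primitive u)"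
proof -
  have cd: "c \<in> I" "d \<in> I" "c < d" using e by (auto simp: test_on_def)
  obtain E where E: "E \<ge> 0" "bnd I k E e0" using bnd_test_on[OF e] by blast
  \<comment> \<open>\<open>A\<close> bounds \<open>mean_free u\<close> relative to \<open>M\<close>:
    the mass of \<open>u\<close> is at most \<open>(d - c) * M\<close> and multiplies
    \<open>e0\<close>, which is bounded by \<open>E\<close>. \<open>C\<close> then covers both the
    primitive and its derivative.\<close>
  define A where "A = 1 + (d - c) * E"
  define C where "C = A + A * (d - c)"
  have A: "A \<ge> 0" using cd E by (simp add: A_def)
  have "bnd I (Suc k) (C * M) (compact_primitive u)" if u: "test_on c d u" "M \<ge> 0" "bnd I k M u" for u M
  proof -
    have "AE s in lebesgue. s \<in> {c..d} \<longrightarrow> norm (u s - 0) \<le> M"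
      using bnd_AE[OF u(3)] by eventually_elim (use Icc_sub[OF cd(1,2)] in auto)
    then have "norm (integral {c..d} u - of_real (d - c) * 0) \<le> M * (d - c)"
      by (intro integral_AE_bound test_on_integrable[OF u(1)] cd u(2)) (use cd in auto)
    then have "norm (total u) \<le> M * (d - c)" using total_test_on[OF u(1)] by simp
    then have "norm (total u) * E \<le> M * (d - c) * E" using E(1) by (rule mult_right_mono)
    then have w: "bnd I k (A * M) (mean_free u)" unfolding mean_free_def
      by (intro bnd_mono[OF bnd_diff[OF u(3) bnd_cmult[OF E(2)]]]) (simp add: A_def algebra_simps)
    note m = mean_free_test_on[OF u(1) e]
    have wAE: "AE s in lebesgue. s \<in> I \<longrightarrow> norm (mean_free u s) \<le> A * M" using bnd_AE[OF w] .
    have "norm (compact_primitive u t) \<le> C * M" if t: "t \<in> I" for t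
    proof (cases "t \<in> {c..d}")
      case True
      have "AE s in lebesgue. s \<in> {c..t} \<longrightarrow> norm (mean_free u s - 0) \<le> A * M"
        using wAE by eventually_elim (use Icc_sub[OF cd(1) t] in auto)
      then have "norm (integral {c..t} (mean_free u) - of_real (t - c) * 0) \<le> A * M * (t - c)"
        by (intro integral_AE_bound test_on_integrable[OF m] cd t) (use True A u(2) in auto)
      then have "norm (compact_primitive u t) \<le> A * M * (t - c)" using compact_primitive_signed_integral[OF u(1) e t] True by (simp add: signed_integral_def)
      also have "\<dots> \<le> A * M * (d - c)" using True A u(2) by (intro mult_left_mono) auto
      also have "\<dots> \<le> C * M" using A u(2) by (simp add: C_def algebra_simps)
      finally show ?thesis .
    next
      case False
      have "slim True (compact_primitive u) t = 0" by (rule test_on_slim_off[OF compact_primitive_test_on[OF u(1) e] t False])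
      then have "compact_primitive u t = 0" using regulated_continuous(2)[OF compact_primitive_continuous[OF u(1) e] t] by simp
      then show ?thesis using A u(2) cd by (simp add: C_def)
    qed
    moreover have "A * M \<le> C * M" using A u(2) cd by (intro mult_right_mono) (auto simp: C_def)
    ultimately show ?thesis using bnd_mono[OF w] compact_primitive_der[OF u(1) e] by auto
  qed
  moreover have "C \<ge> 0" using A cd by (simp add: C_def)
  ultimately show ?thesis by blast
qed

end

section \<open>Density of splines\<close>

context open_interval
begin

text \<open>A one-sided Taylor expansion in disguise: approximate the derivative near
  \<open>x\<close>, integrate from \<open>x\<close>, and add the one-sided limit of \<phi> as
  constant of integration. The error of order zero is small close to \<open>x\<close> because it
  tends to zero there.\<close>

lemma taylor_spline:
  assumes "x \<in> I" "e > 0"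
  shows "smooth \<phi> \<Longrightarrow> \<exists>n p r. spline n {} p \<and> r > 0 \<and> side b x r \<subseteq> I \<and> bnd (side b x r) k e (\<lambda>s. \<phi> s - p s)"
proof (induction k arbitrary: \<phi>)
  case 0
  obtain r0 where r0: "r0 > 0" "side b x r0 \<subseteq> I" using side_in_open[OF opn assms(1)] by metis
  have "eventually (\<lambda>s. dist (\<phi> s) (slim b \<phi> x) < e) (es b x)"
    by (rule tendstoD[OF regulated_lim[OF smooth_regulated[OF 0] assms(1)] assms(2)])
  then obtain r1 where r1: "r1 > 0" "AE s in lebesgue. s \<in> side b x r1 \<longrightarrow> dist (\<phi> s) (slim b \<phi> x) < e"
    unfolding eventually_es by blast
  have "side b x (min r0 r1) \<subseteq> I" "side b x (min r0 r1) \<subseteq> side b x r1"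
    using r0(2) side_mono[of "min r0 r1" r0 b x] side_mono[of "min r0 r1" r1 b x] by auto
  moreover from this(2) have "AE s in lebesgue. s \<in> side b x (min r0 r1) \<longrightarrow> norm (\<phi> s - slim b \<phi> x) \<le> e"
    using r1(2) by (auto simp: dist_norm elim!: eventually_mono)
  ultimately show ?case using spline_const[of "slim b \<phi> x"] r0 r1
    by (intro exI[of _ "Suc 0"] exI[of _ "\<lambda>_. slim b \<phi> x"] exI[of _ "min r0 r1"]) simp
next
  case (Suc k)
  obtain h where h: "der \<phi> h" "smooth h" using smooth_der Suc.prems by blast
  obtain n p r where p: "spline n {} p" "r > 0" "side b x r \<subseteq> I" "bnd (side b x r) k e (\<lambda>s. h s - p s)"
    using Suc.IH[OF h(2)] by blast
  define q where "q = (\<lambda>t. signed_integral x p t + slim b \<phi> x)"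
  have q: "spline (Suc n) {} q" unfolding q_def by (rule spline_primitive[OF p(1) assms(1)])
  have dq: "der q p" unfolding q_def
    using der_add[OF der_signed_integral[OF spline_regulated[OF p(1)] assms(1)] der_const[of "slim b \<phi> x"]] by simp
  have cq: "continuous_on I q" unfolding q_def
    by (intro continuous_intros signed_integral_continuous spline_regulated[OF p(1)] assms(1))
  have "q x = slim b \<phi> x" by (simp add: q_def)
  then have "((\<lambda>s. \<phi> s - q s) \<longlongrightarrow> 0) (es b x)"
    using tendsto_diff[OF regulated_lim[OF smooth_regulated[OF Suc.prems] assms(1), of b] regulated_lim[OF spline_regulated[OF q] assms(1), of b]]
      regulated_continuous(2)[OF cq assms(1), of b] by simp
  from tendstoD[OF this assms(2)] obtain r1 where r1: "r1 > 0"
    "AE s in lebesgue. s \<in> side b x r1 \<longrightarrow> dist (\<phi> s - q s) 0 < e" unfolding eventually_es by blast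
  have sub: "side b x (min r r1) \<subseteq> side b x r" "side b x (min r r1) \<subseteq> side b x r1"
    using side_mono[of "min r r1" r b x] side_mono[of "min r r1" r1 b x] by auto
  have "AE s in lebesgue. s \<in> side b x (min r r1) \<longrightarrow> norm (\<phi> s - q s) \<le> e"
    using r1(2) sub(2) by (auto elim!: eventually_mono)
  then have "bnd (side b x (min r r1)) (Suc k) e (\<lambda>s. \<phi> s - q s)"
    using bnd_subset[OF p(4) sub(1)] der_diff[OF h(1) dq] by auto
  then show ?case using q p(2,3) sub(1) r1(1)
    by (intro exI[of _ "Suc n"] exI[of _ q] exI[of _ "min r r1"]) auto
qed

lemma spline_glue:
  assumes "spline n S p" "finite S" "spline m T q" "finite T"
  shows "\<exists>n S. finite S \<and> spline n S (\<lambda>s. (1 - step b s) * p s + step b s * q s)"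
proof -
  have 1: "spline n (insert b S) (\<lambda>s. step b s * p s)" using spline_step_mult[OF assms(1)] .
  have 2: "spline m (insert b T) (\<lambda>s. step b s * q s)" using spline_step_mult[OF assms(3)] .
  obtain n' S' where 3: "finite S'" "spline n' S' (\<lambda>s. p s + (- 1) * (step b s * p s))"
    using spline_add_ex[OF assms(1,2) spline_cmult[OF 1, of "- 1"]] assms(2) by auto
  have "\<exists>n S. finite S \<and> spline n S (\<lambda>s. (p s + (- 1) * (step b s * p s)) + step b s * q s)"
    using spline_add_ex[OF 3(2,1) 2] assms(4) by simp
  then show ?thesis by (simp add: algebra_simps)
qed

lemma smooth_spline_diff: "smooth \<phi> \<Longrightarrow> spline n S q \<Longrightarrow> smooth (\<lambda>s. \<phi> s - q s)"
  using smooth_diff spline_smooth by blast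

lemma spline_approx_glue:
  assumes "smooth \<phi>" "a \<le> b" "b \<le> c" "{a<..<c} \<subseteq> I"
    and "finite S" "spline n S p" "bnd {a<..<b} k e (\<lambda>s. \<phi> s - p s)"
    and "finite T" "spline m T q" "bnd {b<..<c} k e (\<lambda>s. \<phi> s - q s)"
  shows "\<exists>n S r. finite S \<and> spline n S r \<and> bnd {a<..<c} k e (\<lambda>s. \<phi> s - r s)"
proof -
  let ?r = "\<lambda>s. (1 - step b s) * p s + step b s * q s"
  obtain n' S' where r: "finite S'" "spline n' S' ?r" using spline_glue[OF assms(6,5,9,8)] by blast
  have "bnd {a<..<b} k e (\<lambda>s. \<phi> s - ?r s)"
    by (rule bnd_cong[OF assms(7) _ smooth_spline_diff[OF assms(1) r(2)]])
       (use assms(2-4) in \<open>auto simp: step_def\<close>)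
  moreover have "bnd {b<..<c} k e (\<lambda>s. \<phi> s - ?r s)"
    by (rule bnd_cong[OF assms(10) _ smooth_spline_diff[OF assms(1) r(2)]])
       (use assms(2-4) in \<open>auto simp: step_def\<close>)
  ultimately have "bnd {a<..<c} k e (\<lambda>s. \<phi> s - ?r s)"
    using bnd_glue[OF _ _ smooth_spline_diff[OF assms(1) r(2)] assms(4,2,3)] by blast
  with r show ?thesis by blast
qed

text \<open>Bisection joins the local approximations. As neighbouring pieces need not match, the
  error \<open>e\<close> is never increased.\<close>

lemma spline_approx_on:
  assumes "smooth \<phi>" "e > 0" "c \<in> I" "d \<in> I" "c \<le> d"
  shows "\<exists>n S q. finite S \<and> spline n S q \<and> bnd {c<..<d} k e (\<lambda>s. \<phi> s - q s)"
proof -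
  \<comment> \<open>The inclusion stays inside the induction as a guard, because joining two pieces
    needs the whole interval to lie in \<open>I\<close>.\<close>
  have "{c<..<d} \<subseteq> I \<longrightarrow> (\<exists>n S q. finite S \<and> spline n S q \<and> bnd {c<..<d} k e (\<lambda>s. \<phi> s - q s))"
    using assms(5)
  proof (induction rule: Bolzano)
    case (trans a b c)
    show ?case
    proof
      assume "{a<..<c} \<subseteq> I"
      then have "{a<..<b} \<subseteq> I" "{b<..<c} \<subseteq> I" using trans(3,4) by auto
      with trans(1,2) have "\<exists>n S q. finite S \<and> spline n S q \<and> bnd {a<..<b} k e (\<lambda>s. \<phi> s - q s)"
        "\<exists>n S q. finite S \<and> spline n S q \<and> bnd {b<..<c} k e (\<lambda>s. \<phi> s - q s)" by simp_all
      then show "\<exists>n S q. finite S \<and> spline n S q \<and> bnd {a<..<c} k e (\<lambda>s. \<phi> s - q s)"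
        by (elim exE conjE) (rule spline_approx_glue[OF assms(1) trans(3,4) \<open>{a<..<c} \<subseteq> I\<close>])
    qed
  next
    case (local x)
    have xI: "x \<in> I" using local Icc_sub[OF assms(3,4)] by auto
    obtain n p r where 1: "spline n {} p" "r > 0" "side False x r \<subseteq> I" "bnd (side False x r) k e (\<lambda>s. \<phi> s - p s)"
      using taylor_spline[OF xI assms(2,1), of False k] by blast
    obtain m q r' where 2: "spline m {} q" "r' > 0" "side True x r' \<subseteq> I" "bnd (side True x r') k e (\<lambda>s. \<phi> s - q s)"
      using taylor_spline[OF xI assms(2,1), of True k] by blast
    show ?case
    proof (rule exI[of _ "min r r'"], intro conjI allI impI)
      show "0 < min r r'" using 1 2 by simp
      fix a b assume ab: "a \<le> x \<and> x \<le> b \<and> b - a < min r r'" and sub: "{a<..<b} \<subseteq> I"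
      have "{a<..<x} \<subseteq> side False x r" "{x<..<b} \<subseteq> side True x r'" using ab by (auto simp: side_def)
      then have "bnd {a<..<x} k e (\<lambda>s. \<phi> s - p s)" "bnd {x<..<b} k e (\<lambda>s. \<phi> s - q s)"
        using bnd_subset[OF 1(4)] bnd_subset[OF 2(4)] by blast+
      then show "\<exists>n S q. finite S \<and> spline n S q \<and> bnd {a<..<b} k e (\<lambda>s. \<phi> s - q s)"
        using spline_approx_glue[OF assms(1) _ _ sub, of x "{}" n p k e "{}" m q] ab 1(1) 2(1) by blast
    qed
  qed
  moreover have "{c<..<d} \<subseteq> I" using Icc_sub[OF assms(3,4)] by auto
  ultimately show ?thesis by blast
qed

text \<open>Cutting the approximant off at \<open>c\<close> and \<open>d\<close> restores the
  support at the price of jumps there, which splines may have.\<close>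

lemma spline_approx:
  assumes \<phi>: "test_on c d \<phi>" and e: "e > 0"
  shows "\<exists>n S q. finite S \<and> spline n S q \<and> test_on c d q \<and> bnd I k e (\<lambda>s. \<phi> s - q s)"
proof -
  have cd: "c \<in> I" "d \<in> I" "c < d" and smooth: "smooth \<phi>" using \<phi> by (auto simp: test_on_def)
  obtain n S p where p: "finite S" "spline n S p" "bnd {c<..<d} k e (\<lambda>s. \<phi> s - p s)"
    using spline_approx_on[OF smooth e cd(1,2) less_imp_le[OF cd(3)]] by blast
  have 1: "spline n (insert c S) (\<lambda>s. step c s * p s)" using spline_step_mult[OF p(2)] .
  have 2: "spline n (insert d S) (\<lambda>s. - 1 * (step d s * p s))" using spline_cmult[OF spline_step_mult[OF p(2)]] .
  let ?q = "\<lambda>s. step c s * p s + - 1 * (step d s * p s)"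
  obtain n' S' where q: "finite S'" "spline n' S' ?q"
    using spline_add_ex[OF 1 _ 2] p(1) by auto
  have "test_on c d ?q" using cd spline_smooth[OF q(2)] by (simp add: test_on_def step_def)
  moreover have "bnd {c<..<d} k e (\<lambda>s. \<phi> s - ?q s)"
    by (rule bnd_cong[OF p(3) _ smooth_spline_diff[OF smooth q(2)]])
       (use Icc_sub[OF cd(1,2)] in \<open>auto simp: step_def\<close>)
  then have "bnd I k e (\<lambda>s. \<phi> s - ?q s)"
    using bnd_extend[OF test_on_diff[OF \<phi> \<open>test_on c d ?q\<close>]] e by simp
  ultimately show ?thesis using q by blast
qed

lemma bnd_AE_cong: "bnd I k M g \<Longrightarrow> AE s in lebesgue. s \<in> I \<longrightarrow> g s = g' s \<Longrightarrow> smooth g' \<Longrightarrow> bnd I k M g'"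
  using bnd_cong[of I k M g g'] opn by simp

text \<open>Approximating the derivative and integrating keeps the approximants free of jumps of order zero.\<close>

lemma jump_free_spline_approx:
  assumes \<psi>: "test_on c d \<psi>" "jump_free \<psi>" and te: "test_on c d e0" and e: "e > 0"
  shows "\<exists>n S q. finite S \<and> spline n S q \<and> test_on c d q \<and> jump_free q \<and> bnd I k e (\<lambda>s. \<psi> s - q s)"
proof -
  obtain h where h: "der \<psi> h" "smooth h" using smooth_der test_on_smooth[OF \<psi>(1)] by blast
  have th: "test_on c d h" using test_on_der[OF \<psi>(1) h] .
  obtain C where C: "C \<ge> 0" "\<And>u M. test_on c d u \<Longrightarrow> M \<ge> 0 \<Longrightarrow> bnd I k M u \<Longrightarrow> bnd I (Suc k) (C * M) (compact_primitive u)"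
    using compact_primitive_bnd[OF te, of k] by blast
  define r where "r = e / (C + 1)"
  have r: "r > 0" "C * r \<le> e" using e C(1) by (auto simp: r_def field_simps)
  obtain n S q where q: "finite S" "spline n S q" "test_on c d q" "bnd I k r (\<lambda>s. h s - q s)"
    using spline_approx[OF th r(1)] by blast
  have "\<exists>n S. finite S \<and> spline n S (mean_free q)"
  proof -
    obtain m T where "finite T" "spline m T e0" using e0(3) by blast
    then have "\<exists>n S. finite S \<and> spline n S (\<lambda>s. q s + - total q * e0 s)"
      using spline_add_ex[OF q(2,1) spline_cmult] by blast
    then show ?thesis by (simp add: mean_free_def)
  qed
  then obtain m T where mT: "finite T" "spline m T (mean_free q)" by blast
  note Q = compact_primitive_test_on[OF q(3) te]
  have nj: "jump_free (compact_primitive q)" using compact_primitive_jump_free q(3) test_fun_iff by blast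
  have "spline (Suc m) T (compact_primitive q)" using mT(2) nj compact_primitive_der[OF q(3) te] by (auto simp: jump_free_def)
  moreover have "bnd I k e (\<lambda>s. \<psi> s - compact_primitive q s)"
  proof (rule bnd_AE_cong)
    have "bnd I (Suc k) (C * r) (compact_primitive (\<lambda>s. h s - q s))"
      using C(2) test_on_diff[OF th q(3)] q(4) r(1) by simp
    then show "bnd I k e (compact_primitive (\<lambda>s. h s - q s))" using bnd_mono[OF bnd_le[of I "Suc k" _ _ k] r(2)] by simp
    have "compact_primitive (\<lambda>s. h s + - 1 * q s) t = compact_primitive h t + - 1 * compact_primitive q t" if "t \<in> I" for t
      using compact_primitive_add[OF th test_on_cmult[OF q(3)] te that] compact_primitive_cmult[OF q(3) te that] by metis
    then show "AE s in lebesgue. s \<in> I \<longrightarrow> compact_primitive (\<lambda>s. h s - q s) s = \<psi> s - compact_primitive q s"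
      using compact_primitive_der_inverse[OF \<psi> h te] by (auto elim!: eventually_mono)
    show "smooth (\<lambda>s. \<psi> s - compact_primitive q s)" using smooth_diff test_on_smooth \<psi>(1) Q by blast
  qed
  ultimately show ?thesis using mT(1) Q nj by blast
qed

end

section \<open>Functions with a single jump of a given order\<close>

text \<open>The logistic function decays together with all its derivatives, which makes the correction
  bounded also when the interval is not.\<close>

definition logistic :: "real \<Rightarrow> real \<Rightarrow> real" where
  "logistic t s = 1 / (1 + exp (s - t))"

lemma logistic_01: "0 < logistic t s" "logistic t s < 1"
  by (auto simp: logistic_def add_pos_pos)

lemma logistic_der: "(logistic t has_real_derivative - (logistic t s * (1 - logistic t s))) (at s)"
proof -
  have "1 + exp (s - t) \<noteq> 0" by (smt (verit) exp_gt_zero)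
  then show ?thesis unfolding logistic_def
    by (auto intro!: derivative_eq_intros simp: field_simps power2_eq_square)
qed

lemma logistic_decay: "logistic t s \<le> exp (- (s - t))" "1 - logistic t s \<le> exp (s - t)"
proof -
  have p: "0 < 1 + exp (s - t)" by (smt (verit) exp_gt_zero)
  have "exp (- (s - t)) * (1 + exp (s - t)) = exp (- (s - t)) + 1"
    by (simp add: distrib_left flip: exp_add)
  then show "logistic t s \<le> exp (- (s - t))" using p by (simp add: logistic_def pos_divide_le_eq)
  have "1 - logistic t s = exp (s - t) / (1 + exp (s - t))" using p by (simp add: logistic_def field_simps)
  also have "\<dots> \<le> exp (s - t)" using p by (simp add: field_simps)
  finally show "1 - logistic t s \<le> exp (s - t)" .
qed

lemma power_le_exp: "\<bar>x::real\<bar> ^ p \<le> real p ^ p * exp \<bar>x\<bar>"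
\<comment> \<open>For \<open>p = 0\<close> the constant \<open>real p ^ p\<close> is 1.\<close>
proof (cases "p = 0")
  case False
  have "\<bar>x\<bar> / p \<le> exp (\<bar>x\<bar> / p)" using exp_ge_add_one_self[of "\<bar>x\<bar> / p"] by linarith
  then have "(\<bar>x\<bar> / p) ^ p \<le> exp (\<bar>x\<bar> / p) ^ p" by (rule power_mono) simp
  also have "\<dots> = exp \<bar>x\<bar>" using False by (simp flip: exp_of_nat_mult)
  finally show ?thesis using False by (simp add: power_divide field_simps)
qed simp

text \<open>One factor \<open>logistic\<close> and one factor \<open>1 - logistic\<close> are always
  present, so that every term decays at both ends in spite of the power. Differentiation stays in
  the class because \<open>logistic\<close> has the derivative
  \<open>- (logistic * (1 - logistic))\<close>.\<close>

inductive decaying :: "real \<Rightarrow> (real \<Rightarrow> complex) \<Rightarrow> bool" for t where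
  monomial: "decaying t (\<lambda>s. of_real (c * (s - t) ^ p * logistic t s ^ Suc a * (1 - logistic t s) ^ Suc b))"
| add: "decaying t f \<Longrightarrow> decaying t g \<Longrightarrow> decaying t (\<lambda>s. f s + g s)"

lemma decaying_der: "decaying t f \<Longrightarrow> \<exists>h. decaying t h \<and> (\<forall>s. (f has_vector_derivative h s) (at s))"
proof (induction rule: decaying.induct)
  case (monomial c p a b)
  let ?m = "\<lambda>c p a b s. complex_of_real (c * (s - t) ^ p * logistic t s ^ Suc a * (1 - logistic t s) ^ Suc b)"
  \<comment> \<open>The three summands come from differentiating the power, \<open>logistic\<close>
    and \<open>1 - logistic\<close>. For \<open>p = 0\<close> the truncated exponent
    \<open>p - 1\<close> does no harm, as the coefficient \<open>c * p\<close> vanishes.\<close>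
  let ?h = "\<lambda>s. (?m (c * p) (p - 1) a b s + ?m (- c * Suc a) p a (Suc b) s) + ?m (c * Suc b) p (Suc a) b s"
  have "decaying t ?h" by (intro decaying.intros)
  moreover have "(?m c p a b has_vector_derivative ?h s) (at s)" for s
  proof -
    have "((\<lambda>s. c * (s - t) ^ p * logistic t s ^ Suc a * (1 - logistic t s) ^ Suc b) has_real_derivative
       (c * p * (s - t) ^ (p - 1) * logistic t s ^ Suc a * (1 - logistic t s) ^ Suc b
        + - c * Suc a * (s - t) ^ p * logistic t s ^ Suc a * (1 - logistic t s) ^ Suc (Suc b))
        + c * Suc b * (s - t) ^ p * logistic t s ^ Suc (Suc a) * (1 - logistic t s) ^ Suc b) (at s)"
      by (rule derivative_eq_intros logistic_der refl | simp)+ (simp add: algebra_simps)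
    from bounded_linear.has_vector_derivative[OF bounded_linear_of_real this[unfolded has_real_derivative_iff_has_vector_derivative]]
    show ?thesis by simp
  qed
  ultimately show ?case by blast
next
  case (add f g)
  then obtain f' g' where "decaying t f'" "\<forall>s. (f has_vector_derivative f' s) (at s)"
    "decaying t g'" "\<forall>s. (g has_vector_derivative g' s) (at s)" by blast
  then show ?case using decaying.add[of t f' g'] has_vector_derivative_add
    by (intro exI[of _ "\<lambda>s. f' s + g' s"]) blast
qed

lemma logistic_prod_decay: "\<bar>s - t\<bar> ^ p * (logistic t s * (1 - logistic t s)) \<le> real p ^ p"
proof -
  have "logistic t s * (1 - logistic t s) \<le> exp (- \<bar>s - t\<bar>)"
  proof (cases "s \<ge> t")
    case True
    have "logistic t s * (1 - logistic t s) \<le> exp (- (s - t)) * 1"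
      using logistic_decay logistic_01 by (intro mult_mono) (auto intro: less_imp_le)
    then show ?thesis using True by simp
  next
    case False
    have "logistic t s * (1 - logistic t s) \<le> 1 * exp (s - t)"
      using logistic_decay logistic_01 by (intro mult_mono) (auto intro: less_imp_le)
    then show ?thesis using False by simp
  qed
  then have "\<bar>s - t\<bar> ^ p * (logistic t s * (1 - logistic t s)) \<le> real p ^ p * exp \<bar>s - t\<bar> * exp (- \<bar>s - t\<bar>)"
    using power_le_exp[of "s - t" p] logistic_01[of t s] by (intro mult_mono) (auto intro: less_imp_le)
  then show ?thesis by (simp add: exp_minus field_simps)
qed

lemma decaying_bounded: "decaying t f \<Longrightarrow> \<exists>C. \<forall>s. norm (f s) \<le> C"
proof (induction rule: decaying.induct)
  case (monomial c p a b)
  have "norm (complex_of_real (c * (s - t) ^ p * logistic t s ^ Suc a * (1 - logistic t s) ^ Suc b)) \<le> \<bar>c\<bar> * real p ^ p" for s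
  proof -
    have l: "0 \<le> logistic t s" "logistic t s \<le> 1" using logistic_01[of t s] by auto
    then have nn: "0 \<le> logistic t s ^ Suc a * (1 - logistic t s) ^ Suc b" by simp
    from l have "logistic t s ^ Suc a * (1 - logistic t s) ^ Suc b \<le> logistic t s * (1 - logistic t s)"
      by (intro mult_mono) (auto simp: mult_left_le power_le_one mult_le_cancel_left1)
    then have "\<bar>s - t\<bar> ^ p * (logistic t s ^ Suc a * (1 - logistic t s) ^ Suc b) \<le> \<bar>s - t\<bar> ^ p * (logistic t s * (1 - logistic t s))"
      by (rule mult_left_mono) simp
    also have "\<dots> \<le> real p ^ p" by (rule logistic_prod_decay)
    finally have "\<bar>c\<bar> * (\<bar>s - t\<bar> ^ p * (logistic t s ^ Suc a * (1 - logistic t s) ^ Suc b)) \<le> \<bar>c\<bar> * real p ^ p"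
      by (rule mult_left_mono) simp
    moreover have "norm (complex_of_real (c * (s - t) ^ p * logistic t s ^ Suc a * (1 - logistic t s) ^ Suc b))
       = \<bar>c\<bar> * (\<bar>s - t\<bar> ^ p * (logistic t s ^ Suc a * (1 - logistic t s) ^ Suc b))"
      by (simp only: norm_of_real mult.assoc abs_mult[of c] abs_mult[of "(s - t) ^ p"] power_abs
          abs_of_nonneg[OF nn])
    ultimately show ?thesis by simp
  qed
  then show ?case by blast
next
  case (add f g)
  then obtain A B where "\<forall>s. norm (f s) \<le> A" "\<forall>s. norm (g s) \<le> B" by blast
  then have "\<forall>s. norm (f s + g s) \<le> A + B" using norm_triangle_mono by blast
  then show ?case by blast
qed

context open_interval
begin

lemma decaying_chain:
  assumes "decaying t f"
  shows "\<exists>d. d 0 = f \<and> (\<forall>k::nat. der (d k) (d (Suc k)) \<and> (\<exists>C. \<forall>s. norm (d k s) \<le> C) \<and> continuous_on I (d k))"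
proof -
  have c: "continuous_on I f" if "decaying t f" for f
    using decaying_der[OF that] has_vector_derivative_continuous
    by (metis continuous_at_imp_continuous_on)
  have "\<exists>d. \<forall>n::nat. (decaying t (d n) \<and> (n = 0 \<longrightarrow> d n = f)) \<and> der (d n) (d (Suc n))"
  proof (rule dependent_nat_choice)
    show "\<exists>x. decaying t x \<and> (0 = (0::nat) \<longrightarrow> x = f)" using assms by blast
    show "\<exists>y. (decaying t y \<and> (Suc n = 0 \<longrightarrow> y = f)) \<and> der x y" if x: "decaying t x \<and> (n = 0 \<longrightarrow> x = f)" for x n
    proof -
      obtain y where "decaying t y" "\<forall>s. (x has_vector_derivative y s) (at s)" using decaying_der x by blast
      then show ?thesis using der_smooth[of x y] c by blast
    qed
  qed
  then show ?thesis using c decaying_bounded by metis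
qed

text \<open>The sum of \<open>logistic\<close> and \<open>step\<close> minus 1 has a unit jump at
  \<open>t\<close> and decays at both ends; the factor \<open>(s - t) ^ i / fact i\<close> moves
  this jump into the derivative of order \<open>i\<close> and into no other. A polynomial times a
  step has the same jumps but may be unbounded on \<open>I\<close>.\<close>

lemma single_jump:
  assumes t: "t \<in> I"
  shows "\<exists>E. E 0 = (\<lambda>s. of_real ((s - t) ^ i / fact i) * (of_real (logistic t s) + step t s - 1)) \<and>
    (\<forall>j. der (E j) (E (Suc j))) \<and> (\<forall>j. \<exists>C. AE s in lebesgue. s \<in> I \<longrightarrow> norm (E j s) \<le> C) \<and>
    (\<forall>j. \<forall>s\<in>I. jump s (E j) = (if s = t \<and> j = i then 1 else 0))"
proof -
  define \<rho> where "\<rho> = (\<lambda>s. complex_of_real (logistic t s) + step t s - 1)"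
  define m where "m = (\<lambda>i s. complex_of_real ((s - t) ^ i / fact i))"
  have lc: "continuous_on I (\<lambda>s. complex_of_real (logistic t s))"
    unfolding logistic_def by (intro continuous_intros) (smt (verit) exp_gt_zero)
  have mc: "continuous_on I (m i)" for i unfolding m_def by (intro continuous_intros) simp_all
  define \<delta> where "\<delta> = (\<lambda>i s. complex_of_real ((- 1 / fact i) * (s - t) ^ i * logistic t s ^ Suc 0 * (1 - logistic t s) ^ Suc 0))"
  have d\<delta>: "decaying t (\<delta> i)" for i unfolding \<delta>_def by (rule decaying.monomial)
  have \<delta>_m: "\<delta> i = (\<lambda>s. m i s * \<delta> 0 s)" for i by (simp add: \<delta>_def m_def fun_eq_iff)
  have dl: "der (\<lambda>s. complex_of_real (logistic t s)) (\<delta> 0)"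
  proof (rule der_smooth)
    show "continuous_on I (\<delta> 0)" using decaying_chain[OF d\<delta>] by metis
    fix s
    from bounded_linear.has_vector_derivative[OF bounded_linear_of_real logistic_der[of t s, unfolded has_real_derivative_iff_has_vector_derivative]]
    show "((\<lambda>s. complex_of_real (logistic t s)) has_vector_derivative \<delta> 0 s) (at s)"
      by (simp add: \<delta>_def)
  qed
  have d\<rho>: "der \<rho> (\<delta> 0)"
    using der_diff[OF der_add[OF dl der_step[of t]] der_const[of 1]] by (simp add: \<rho>_def)
  have dm: "der (m (Suc i)) (m i)" for i
  proof (rule der_smooth[OF _ mc])
    fix s
    have "((\<lambda>s. (s - t) ^ Suc i / fact (Suc i)) has_real_derivative (Suc i) * (s - t) ^ i / fact (Suc i)) (at s)"
      by (rule derivative_eq_intros refl | simp)+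
    moreover have "(Suc i) * (s - t) ^ i / fact (Suc i) = (s - t) ^ i / fact i"
      by (simp only: fact_Suc of_nat_mult) (simp add: divide_simps)
    ultimately have "((\<lambda>s. (s - t) ^ Suc i / fact (Suc i)) has_real_derivative (s - t) ^ i / fact i) (at s)" by simp
    from bounded_linear.has_vector_derivative[OF bounded_linear_of_real this[unfolded has_real_derivative_iff_has_vector_derivative]]
    show "(m (Suc i) has_vector_derivative m i s) (at s)" unfolding m_def .
  qed
  have s\<rho>: "slim b \<rho> s = of_real (logistic t s) + (if t < s \<or> t = s \<and> b then 1 else 0) - 1" if "s \<in> I" for b s
    using slim_diff[OF regulated_add[OF regulated_continuous(1)[OF lc] smooth_regulated[OF smooth_step]] regulated_const that, of b t 1]
      slim_add[OF regulated_continuous(1)[OF lc] smooth_regulated[OF smooth_step[of t]] that, of b]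
      regulated_continuous(2)[OF lc that, of b] by (simp add: \<rho>_def slim_step slim_const)
  have r\<rho>: "regulated \<rho>" using d\<rho> derD by blast
  have j\<rho>: "jump s (\<lambda>s. m i s * \<rho> s) = (if s = t \<and> i = 0 then 1 else 0)" if "s \<in> I" for s i
  proof -
    have "slim b (\<lambda>s. m i s * \<rho> s) s = m i s * slim b \<rho> s" for b
      using slim_mult[OF regulated_continuous(1)[OF mc] r\<rho> that] regulated_continuous(2)[OF mc that] by simp
    then show ?thesis by (auto simp: jump_slim s\<rho>[OF that] m_def)
  qed
  have b\<rho>: "\<exists>C. \<forall>s. norm (m i s * \<rho> s) \<le> C" for i
  proof (intro exI allI)
    fix s
    have "norm (\<rho> s) \<le> exp (- \<bar>s - t\<bar>)"
    proof (cases "t < s")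
      case True
      then have "norm (\<rho> s) = logistic t s" using logistic_01[of t s] by (simp add: \<rho>_def step_def)
      then show ?thesis using logistic_decay(1)[of t s] True by simp
    next
      case False
      then have "\<rho> s = - of_real (1 - logistic t s)" by (simp add: \<rho>_def step_def)
      then have "norm (\<rho> s) = \<bar>1 - logistic t s\<bar>" by (simp only: norm_minus_cancel norm_of_real)
      then have "norm (\<rho> s) = 1 - logistic t s" using logistic_01[of t s] by simp
      then show ?thesis using logistic_decay(2)[of t s] False by simp
    qed
    moreover have "norm (m i s) \<le> real i ^ i * exp \<bar>s - t\<bar>"
    proof -
      have "norm (m i s) = \<bar>s - t\<bar> ^ i / fact i" by (simp only: m_def norm_of_real) (simp add: power_abs)
      also have "\<dots> \<le> \<bar>s - t\<bar> ^ i" by (simp add: divide_le_eq mult_le_cancel_left1 fact_ge_1)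
      also have "\<dots> \<le> real i ^ i * exp \<bar>s - t\<bar>" by (rule power_le_exp)
      finally show ?thesis .
    qed
    ultimately have "norm (m i s * \<rho> s) \<le> (real i ^ i * exp \<bar>s - t\<bar>) * exp (- \<bar>s - t\<bar>)"
      unfolding norm_mult by (intro mult_mono) auto
    then show "norm (m i s * \<rho> s) \<le> real i ^ i" by (simp add: exp_minus mult.assoc)
  qed
  have "\<exists>E. E 0 = (\<lambda>s. m i s * \<rho> s) \<and>
    (\<forall>j. der (E j) (E (Suc j))) \<and> (\<forall>j. \<exists>C. AE s in lebesgue. s \<in> I \<longrightarrow> norm (E j s) \<le> C) \<and>
    (\<forall>j. \<forall>s\<in>I. jump s (E j) = (if s = t \<and> j = i then 1 else 0))"
  proof (induction i)
    case 0
    obtain d where d: "d 0 = \<delta> 0" "\<And>k. der (d k) (d (Suc k))" "\<And>k. \<exists>C. \<forall>s. norm (d k s) \<le> C" "\<And>k. continuous_on I (d k)"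
      using decaying_chain[OF d\<delta>[of 0]] by metis
    let ?E = "case_nat (\<lambda>s. m 0 s * \<rho> s) d"
    have m0: "(\<lambda>s. m 0 s * \<rho> s) = \<rho>" by (simp add: m_def)
    have "der (?E j) (?E (Suc j))" for j using d d\<rho> m0 by (cases j) auto
    moreover have "\<exists>C. AE s in lebesgue. s \<in> I \<longrightarrow> norm (?E j s) \<le> C" for j
    proof (cases j)
      case 0 then show ?thesis using b\<rho>[of 0] by (auto intro!: AE_I2)
    next
      case (Suc k) then show ?thesis using d(3)[of k] by (auto intro!: AE_I2)
    qed
    moreover have "jump s (?E j) = (if s = t \<and> j = 0 then 1 else 0)" if "s \<in> I" for s j
      using j\<rho>[OF that, of 0] regulated_continuous(2)[OF d(4) that] by (cases j) (auto simp: jump_slim)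
    ultimately show ?case by (intro exI[of _ ?E]) simp
  next
    case (Suc i)
    then obtain E where E: "E 0 = (\<lambda>s. m i s * \<rho> s)" "\<And>j. der (E j) (E (Suc j))"
      "\<And>j. \<exists>C. AE s in lebesgue. s \<in> I \<longrightarrow> norm (E j s) \<le> C"
      "\<And>j s. s \<in> I \<Longrightarrow> jump s (E j) = (if s = t \<and> j = i then 1 else 0)" by blast
    obtain d where d: "d 0 = \<delta> (Suc i)" "\<And>k. der (d k) (d (Suc k))" "\<And>k. \<exists>C. \<forall>s. norm (d k s) \<le> C" "\<And>k. continuous_on I (d k)"
      using decaying_chain[OF d\<delta>[of "Suc i"]] by metis
    \<comment> \<open>By the Leibniz rule the derivative of \<open>m (Suc i) * \<rho>\<close> is
      \<open>m i * \<rho>\<close> plus the decaying smooth function \<open>\<delta> (Suc i)\<close>.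
      From order one on, the new chain is the old one plus the chain of that function.\<close>
    let ?E = "case_nat (\<lambda>s. m (Suc i) s * \<rho> s) (\<lambda>j s. E j s + d j s)"
    have "der (?E j) (?E (Suc j))" for j
    proof (cases j)
      case 0
      have "der (\<lambda>s. m (Suc i) s * \<rho> s) (\<lambda>s. m i s * \<rho> s + m (Suc i) s * \<delta> 0 s)" by (rule der_mult[OF dm d\<rho>])
      then show ?thesis using 0 E(1) d(1) \<delta>_m[of "Suc i"] by simp
    next
      case (Suc k)
      then show ?thesis using der_add[OF E(2) d(2)] by simp
    qed
    moreover have "\<exists>C. AE s in lebesgue. s \<in> I \<longrightarrow> norm (?E j s) \<le> C" for j
    proof (cases j)
      case 0 then show ?thesis using b\<rho>[of "Suc i"] by (auto intro!: AE_I2)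
    next
      case (Suc k)
      obtain A B where "AE s in lebesgue. s \<in> I \<longrightarrow> norm (E k s) \<le> A" "\<forall>s. norm (d k s) \<le> B" using E(3) d(3) by metis
      then have "AE s in lebesgue. s \<in> I \<longrightarrow> norm (E k s + d k s) \<le> A + B"
        by (auto elim!: eventually_mono intro: norm_triangle_mono)
      then show ?thesis using Suc by auto
    qed
    moreover have "jump s (?E j) = (if s = t \<and> j = Suc i then 1 else 0)" if "s \<in> I" for s j
    proof (cases j)
      case 0 then show ?thesis using j\<rho>[OF that, of "Suc i"] by simp
    next
      case (Suc k)
      have "slim b (\<lambda>s. E k s + d k s) s = slim b (E k) s + d k s" for b
        using slim_add[OF derD(1)[OF E(2)] regulated_continuous(1)[OF d(4)] that] regulated_continuous(2)[OF d(4) that] by simp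
      then show ?thesis using Suc E(4)[OF that, of k] by (simp add: jump_slim)
    qed
    ultimately show ?case by (intro exI[of _ ?E]) simp
  qed
  then show ?thesis by (simp only: m_def \<rho>_def)
qed

end

section \<open>The multivalued derivative in terms of jump-free test functions\<close>

lemma fun_module: "module (\<lambda>(c::complex) (g::real \<Rightarrow> complex) s. c * g s)"
  by unfold_locales (auto simp: plus_fun_def algebra_simps)

context open_interval
begin

section \<open>Splines in the span of the spaces \<open>F_k\<close>\<close>

lemma G_fun_add: "f \<in> G_fun I \<Longrightarrow> g \<in> G_fun I \<Longrightarrow> (\<lambda>s. f s + g s) \<in> G_fun I"
proof -
  assume a: "f \<in> G_fun I" "g \<in> G_fun I"
  then obtain A B where "AE s in lebesgue. s \<in> I \<longrightarrow> norm (f s) \<le> A" "AE s in lebesgue. s \<in> I \<longrightarrow> norm (g s) \<le> B"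
    unfolding G_fun_iff by blast
  then have "AE s in lebesgue. s \<in> I \<longrightarrow> norm (f s + g s) \<le> A + B"
    by eventually_elim (use norm_triangle_mono in blast)
  then show ?thesis using a regulated_add unfolding G_fun_iff by blast
qed

lemma G_fun_cmult: "f \<in> G_fun I \<Longrightarrow> (\<lambda>s. c * f s) \<in> G_fun I"
proof -
  assume a: "f \<in> G_fun I"
  then obtain A where "AE s in lebesgue. s \<in> I \<longrightarrow> norm (f s) \<le> A" unfolding G_fun_iff by blast
  then have "AE s in lebesgue. s \<in> I \<longrightarrow> norm (c * f s) \<le> norm c * A"
    by eventually_elim (auto simp: norm_mult intro: mult_left_mono)
  then show ?thesis using a regulated_mult[OF regulated_const] unfolding G_fun_iff by blast
qed

lemma G_fun_sum: "(\<And>a. a \<in> K \<Longrightarrow> f a \<in> G_fun I) \<Longrightarrow> (\<lambda>s. \<Sum>a\<in>K. f a s) \<in> G_fun I"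
proof (induction K rule: infinite_finite_induct)
  case (insert x F) then show ?case using G_fun_add by simp
qed (auto simp: G_fun_iff regulated_const intro!: exI[of _ 0])

lemma jump_add: "regulated f \<Longrightarrow> regulated g \<Longrightarrow> t \<in> I \<Longrightarrow> jump t (\<lambda>s. f s + g s) = jump t f + jump t g"
  by (simp add: jump_slim slim_add)

lemma jump_diff: "regulated f \<Longrightarrow> regulated g \<Longrightarrow> t \<in> I \<Longrightarrow> jump t (\<lambda>s. f s - g s) = jump t f - jump t g"
  by (simp add: jump_slim slim_diff)

lemma jump_cmult: "regulated f \<Longrightarrow> t \<in> I \<Longrightarrow> jump t (\<lambda>s. c * f s) = c * jump t f"
  by (simp add: jump_slim slim_cmult algebra_simps)

lemma regulated_sum: "(\<And>a. a \<in> K \<Longrightarrow> regulated (f a)) \<Longrightarrow> regulated (\<lambda>s. \<Sum>a\<in>K. f a s)"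
  by (induction K rule: infinite_finite_induct) (simp_all add: regulated_const regulated_add)

lemma jump_sum: "(\<And>a. a \<in> K \<Longrightarrow> regulated (f a)) \<Longrightarrow> t \<in> I \<Longrightarrow> jump t (\<lambda>s. \<Sum>a\<in>K. f a s) = (\<Sum>a\<in>K. jump t (f a))"
  by (induction K rule: infinite_finite_induct) (simp_all add: jump_add regulated_sum jump_slim[of t "\<lambda>_. 0"] slim_const)

lemma jump_free_jump: "jump_free u \<longleftrightarrow> (\<forall>t\<in>I. jump t u = 0)"
  by (simp add: jump_free_def jump_slim)

lemma dG_chain:
  assumes "\<And>j. der (d j) (d (Suc j))" "\<And>j. d j \<in> G_fun I"
  shows "(dG I ^^ j) (d 0) \<in> G_fun I \<and> (AE s in lebesgue. s \<in> I \<longrightarrow> d j s = (dG I ^^ j) (d 0) s)"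
proof (induction j)
  case (Suc j)
  let ?g = "(dG I ^^ j) (d 0)"
  have "der ?g (d (Suc j))"
    using Suc by (intro der_cong[OF assms(1)[of j], of ?g "d (Suc j)"]) (auto simp: G_fun_iff derD(2)[OF assms(1)])
  then have "G_deriv I ?g (d (Suc j))" using Suc assms(2) by (simp add: G_deriv_iff)
  then have g: "G_deriv I ?g (dG I ?g)" unfolding dG_def by (rule someI[of "G_deriv I _"])
  then show ?case using der_unique[OF \<open>der ?g (d (Suc j))\<close>] by (simp add: G_deriv_iff)
qed (use assms in simp)

lemma ess_piecewiseI:
  assumes "u \<in> G_fun I" "finite S" "\<And>t. t \<in> I - S \<Longrightarrow> jump t u = 0"
  shows "ess_piecewise_continuous I u"
proof -
  have r: "regulated u" using assms(1) by (simp add: G_fun_iff)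
  have "continuous_on (I - S) (rep u)"
    by (rule continuous_at_imp_continuous_on) (use assms(3) rep_isCont[OF r] in \<open>auto simp: jump_slim\<close>)
  then show ?thesis unfolding ess_piecewise_continuous_def AE_on using rep_AE[OF r] assms(2) by blast
qed

lemma ess_continuousI:
  assumes "u \<in> G_fun I" "jump_free u"
  shows "ess_continuous I u"
proof -
  have r: "regulated u" using assms(1) by (simp add: G_fun_iff)
  have c: "continuous_on I (rep u)" by (rule rep_continuous[OF r assms(2)])
  obtain C where C: "AE s in lebesgue. s \<in> I \<longrightarrow> norm (u s) \<le> C" using assms(1) by (auto simp: G_fun_iff)
  have "norm (rep u t) \<le> C" if "t \<in> I" for t
  proof (rule AE_le_continuous[OF opn _ _ that])
    show "continuous_on I (\<lambda>t. norm (rep u t))" by (intro continuous_intros c)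
    show "AE s in lebesgue. s \<in> I \<longrightarrow> norm (rep u s) \<le> C" using C rep_AE[OF r] by eventually_elim auto
  qed
  then have "bounded (rep u ` I)" by (auto simp: bounded_iff)
  then show ?thesis unfolding ess_continuous_def AE_on using c rep_AE[OF r] by blast
qed

lemma F_kI:
  assumes d: "\<And>j. der (d j) (d (Suc j))" "\<And>j. d j \<in> G_fun I"
    and j: "\<And>j s. s \<in> I \<Longrightarrow> j \<noteq> k \<or> s \<noteq> t \<Longrightarrow> jump s (d j) = 0"
  shows "d 0 \<in> F_k I k"
proof -
  note c = dG_chain[of d, OF d]
  have jmp: "jump s ((dG I ^^ j) (d 0)) = jump s (d j)" if "s \<in> I" for s j
    using slim_AE_cong[OF conjunct2[OF c] that] by (simp add: jump_slim)
  have "d 0 \<in> G_inf I" using d unfolding G_inf_def G_deriv_iff by blast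
  moreover have "ess_continuous I ((dG I ^^ i) (d 0))" if "i \<noteq> k" for i
    by (rule ess_continuousI) (use c j that in \<open>auto simp: jump_free_jump jmp\<close>)
  moreover have "ess_piecewise_continuous I ((dG I ^^ k) (d 0))"
    by (rule ess_piecewiseI[where S = "{t}"]) (use c j in \<open>auto simp: jmp\<close>)
  ultimately show ?thesis by (simp add: F_k_def)
qed

lemma F_span_base: "g \<in> F_k I k \<Longrightarrow> g \<in> F_span I"
  unfolding F_span_def by (rule module.span_base[OF fun_module]) blast

lemma F_span_add: "f \<in> F_span I \<Longrightarrow> g \<in> F_span I \<Longrightarrow> (\<lambda>s. f s + g s) \<in> F_span I"
  using module.span_add[OF fun_module, of f "\<Union>k. F_k I k" g] by (simp add: F_span_def plus_fun_def)

lemma F_span_cmult: "f \<in> F_span I \<Longrightarrow> (\<lambda>s. c * f s) \<in> F_span I"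
  using module.span_scale[OF fun_module] by (simp add: F_span_def)

lemma F_span_sum: "(\<And>a. a \<in> K \<Longrightarrow> f a \<in> F_span I) \<Longrightarrow> (\<lambda>s. \<Sum>a\<in>K. f a s) \<in> F_span I"
proof (induction K rule: infinite_finite_induct)
  have z: "(\<lambda>_. 0) \<in> F_span I"
    using module.span_zero[OF fun_module, of "\<Union>k. F_k I k"] by (simp add: F_span_def zero_fun_def)
  { case (infinite A) then show ?case using z by simp }
  { case empty then show ?case using z by simp }
  { case (insert x F) then show ?case using F_span_add by simp }
qed

lemma spline_AE_cong: "spline n S u \<Longrightarrow> AE s in lebesgue. s \<in> I \<longrightarrow> u s = v s \<Longrightarrow> regulated v \<Longrightarrow> spline n S v"
proof (cases n)
  case 0
  then show "spline n S u \<Longrightarrow> AE s in lebesgue. s \<in> I \<longrightarrow> u s = v s \<Longrightarrow> regulated v \<Longrightarrow> spline n S v"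
    by (auto elim: eventually_elim2)
next
  case (Suc m)
  assume a: "spline n S u" "AE s in lebesgue. s \<in> I \<longrightarrow> u s = v s" "regulated v"
  then obtain h where h: "der u h" "spline m S h" using Suc by auto
  have "der v h" by (rule der_cong[OF h(1) a(2) _ a(3) derD(2)[OF h(1)]]) simp
  then show ?thesis using Suc a(1) h(2) slim_AE_cong[OF a(2)] by auto
qed

lemma spline_dG:
  "spline n S u \<Longrightarrow> test_on c d u \<Longrightarrow> s \<in> I \<Longrightarrow> s \<notin> S \<or> j \<ge> n \<Longrightarrow> jump s ((dG I ^^ j) u) = 0"
proof (induction n arbitrary: u j)
  case 0
  have z: "test_on c d w \<Longrightarrow> AE s in lebesgue. s \<in> I \<longrightarrow> w s = 0 \<Longrightarrow> jump s ((dG I ^^ j) w) = 0" for w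
  proof (induction j arbitrary: w)
    case 0
    show ?case using slim_AE_cong[OF 0(2) \<open>s \<in> I\<close>] by (simp add: jump_slim slim_const)
  next
    case (Suc j)
    have "AE s in lebesgue. s \<in> I \<longrightarrow> dG I w s = 0"
      using der_cong_on[OF dG_test_on(1)[OF Suc.prems(1)] der_const opn subset_refl Suc.prems(2)] by simp
    then show ?case using Suc.IH[OF dG_test_on(2)[OF Suc.prems(1)]] by (simp add: funpow_swap1)
  qed
  show ?case using 0 z by simp
next
  case (Suc n)
  obtain h where h: "der u h" "spline n S h" using Suc.prems by auto
  have f: "spline n S (dG I u)"
    using spline_AE_cong[OF h(2) der_unique[OF h(1) dG_test_on(1)]] derD(2)[OF dG_test_on(1)] Suc.prems(2) by blast
  show ?case
  proof (cases j)
    case 0 then show ?thesis using Suc.prems by (simp add: jump_slim)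
  next
    case (Suc i)
    then show ?thesis using Suc.IH[OF f dG_test_on(2)[OF Suc.prems(2)] Suc.prems(3), of i] Suc.prems(4)
      by (auto simp: funpow_swap1)
  qed
qed

lemma spline_test_fun_F:
  assumes "spline n S u" "finite S" "u \<in> test_fun I"
  shows "u \<in> test_fun_F I"
proof -
  obtain c d where u: "test_on c d u" using assms(3) test_fun_iff by blast
  define U where "U = (\<lambda>j. (dG I ^^ j) u)"
  have U0: "U 0 = u" by (simp add: U_def)
  have tU: "test_on c d (U j)" for j by (induction j) (use u dG_test_on in \<open>simp_all add: U_def\<close>)
  have dU: "der (U j) (U (Suc j))" for j using dG_test_on(1)[OF tU[of j]] by (simp add: U_def)
  have gU: "U j \<in> G_fun I" for j using test_on_G_fun[OF tU] .
  define Q where "Q = (\<lambda>t i (e :: nat \<Rightarrow> real \<Rightarrow> complex). (\<forall>j. der (e j) (e (Suc j))) \<and>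
      (\<forall>j. \<exists>C. AE s in lebesgue. s \<in> I \<longrightarrow> norm (e j s) \<le> C) \<and>
      (\<forall>j. \<forall>s\<in>I. jump s (e j) = (if s = t \<and> j = (i::nat) then 1 else 0)))"
  define E where "E = (\<lambda>t i. SOME e. Q t i e)"
  have Q: "Q t i (E t i)" if "t \<in> I" for t i
  proof -
    have "\<exists>e. Q t i e" using single_jump[OF that, of i] unfolding Q_def by blast
    then show ?thesis unfolding E_def by (rule someI_ex)
  qed
  have E: "\<And>t i j. t \<in> I \<Longrightarrow> der (E t i j) (E t i (Suc j))"
    "\<And>t i j. t \<in> I \<Longrightarrow> \<exists>C. AE s in lebesgue. s \<in> I \<longrightarrow> norm (E t i j s) \<le> C"
    "\<And>t i j s. t \<in> I \<Longrightarrow> s \<in> I \<Longrightarrow> jump s (E t i j) = (if s = t \<and> j = i then 1 else 0)"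
    using Q unfolding Q_def by blast+
  have gE: "E t i j \<in> G_fun I" if "t \<in> I" for t i j
    using E(2)[OF that, of i j] derD(1)[OF E(1)[OF that]] by (simp add: G_fun_iff)
  have EF: "E t i 0 \<in> F_k I i" if "t \<in> I" for t i
    by (rule F_kI[where d = "E t i" and t = t]) (use that E(1,3) gE in auto)
  define J where "J = (\<lambda>i t. jump t (U i))"
  define T where "T = S \<inter> I"
  have T: "finite T" "\<And>t. t \<in> T \<Longrightarrow> t \<in> I" using assms(2) by (auto simp: T_def)
  \<comment> \<open>Each chain \<open>E t i\<close> has a single jump, of size one, at
    \<open>t\<close> and in order \<open>i\<close>. Hence the coefficients are simply the jumps of
    \<open>u\<close> and its derivatives, and the remainder \<open>V\<close> has no jumps in any
    order.\<close>
  define W where "W = (\<lambda>j s. \<Sum>i<n. \<Sum>t\<in>T. J i t * E t i j s)"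
  define V where "V = (\<lambda>j s. U j s + - 1 * W j s)"
  have gW: "W j \<in> G_fun I" for j unfolding W_def by (intro G_fun_sum G_fun_cmult gE T(2))
  have "der (V j) (V (Suc j))" for j
    unfolding V_def W_def by (intro der_add der_cmult der_sum dU E(1) T(2))
  moreover have "V j \<in> G_fun I" for j unfolding V_def by (intro G_fun_add G_fun_cmult gU gW)
  moreover have "jump s (V j) = 0" if s: "s \<in> I" for j s
  proof -
    have "jump s (W j) = (\<Sum>i<n. \<Sum>t\<in>T. J i t * jump s (E t i j))"
      unfolding W_def using gE T(2) s
      by (simp add: jump_sum jump_cmult regulated_sum regulated_mult regulated_const G_fun_iff)
    also have "\<dots> = (\<Sum>i<n. if j = i then (\<Sum>t\<in>T. if s = t then J i t else 0) else 0)"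
    proof (intro sum.cong refl)
      fix i
      have "(\<Sum>t\<in>T. J i t * jump s (E t i j)) = (\<Sum>t\<in>T. if j = i then (if s = t then J i t else 0) else 0)"
        by (intro sum.cong refl) (use E(3) T(2) s in simp)
      then show "(\<Sum>t\<in>T. J i t * jump s (E t i j)) = (if j = i then (\<Sum>t\<in>T. if s = t then J i t else 0) else 0)"
        by simp
    qed
    also have "\<dots> = (if j < n \<and> s \<in> T then J j s else 0)"
      using T(1) by (simp add: sum.delta)
    also have "\<dots> = jump s (U j)"
      using spline_dG[OF assms(1) u s, of j] s by (auto simp: J_def T_def U_def)
    finally have "jump s (W j) = jump s (U j)" .
    then show ?thesis unfolding V_def using gU gW s regulated_mult[OF regulated_const, of "W j" "- 1"]
      jump_add[of "U j" "\<lambda>s. - 1 * W j s" s] jump_cmult[of "W j" s "- 1"] by (simp add: G_fun_iff)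
  qed
  ultimately have "V 0 \<in> F_k I 0" by (intro F_kI) auto
  moreover have "W 0 \<in> F_span I" unfolding W_def
    using EF T(2) F_span_base by (intro F_span_sum F_span_cmult) blast
  ultimately have "(\<lambda>s. V 0 s + W 0 s) \<in> F_span I" using F_span_base F_span_add by blast
  then have "u \<in> F_span I" by (simp add: V_def U0)
  then show ?thesis using assms(3) by (simp add: test_fun_F_def)
qed

text \<open>Needed for the sum in \<open>Delta\<close> to be finite. A generator can jump in order
  zero only if its exceptional order is zero, and then only at the finitely many points left out by
  piecewise continuity.\<close>

lemma F_span_finite_jumps: "g \<in> F_span I \<Longrightarrow> regulated g \<and> finite {t \<in> I. jump t g \<noteq> 0}"
  unfolding F_span_def
proof (induction rule: module.span_induct_alt[OF fun_module, consumes 1])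
  case 1
  show ?case unfolding zero_fun_def by (simp add: jump_slim slim_const regulated_const)
next
  case (2 c x y)
  then obtain k where x: "x \<in> G_inf I" "\<forall>i. i \<noteq> k \<longrightarrow> ess_continuous I ((dG I ^^ i) x)"
    "ess_piecewise_continuous I ((dG I ^^ k) x)" by (auto simp: F_k_def)
  have rx: "regulated x" using smooth_regulated[OF G_inf_smooth[OF x(1)]] .
  have "ess_piecewise_continuous I x"
  proof (cases "k = 0")
    case False
    then have "ess_continuous I x" using x(2) by (metis funpow_0)
    then show ?thesis unfolding ess_continuous_def ess_piecewise_continuous_def
      by (metis Diff_empty finite.emptyI)
  qed (use x in simp)
  then obtain h S where h: "finite S" "continuous_on (I - S) h" "AE s in lebesgue. s \<in> I \<longrightarrow> x s = h s"
    unfolding ess_piecewise_continuous_def AE_on by blast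
  have "jump t x = 0" if t: "t \<in> I - S" for t
  proof -
    have "isCont h t" using h(1,2) t opn by (simp add: continuous_on_eq_continuous_at open_Diff finite_imp_closed)
    moreover have "es b t \<le> at t" for b
      using es_le[of b t] by (rule order_trans) (simp add: at_side_def at_le)
    ultimately have "(h \<longlongrightarrow> h t) (es b t)" for b unfolding isCont_def by (meson tendsto_mono)
    then have "slim b x t = h t" for b using slimI slim_AE_cong[OF h(3)] t by auto
    then show ?thesis by (simp add: jump_slim)
  qed
  then have "finite {t \<in> I. jump t x \<noteq> 0}" using h(1) by (auto intro: finite_subset)
  moreover have "{t \<in> I. jump t (\<lambda>s. c * x s + y s) \<noteq> 0} \<subseteq> {t \<in> I. jump t x \<noteq> 0} \<union> {t \<in> I. jump t y \<noteq> 0}"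
    using jump_add[OF regulated_mult[OF regulated_const rx], of y _ c] jump_cmult[OF rx] 2 by auto
  ultimately have "finite {t \<in> I. jump t (\<lambda>s. c * x s + y s) \<noteq> 0}" using 2 by (meson finite_UnI finite_subset)
  then show ?case using regulated_add[OF regulated_mult[OF regulated_const rx]] 2 by (simp add: plus_fun_def)
qed

text \<open>Some test function whose only jump is a unit jump at \<open>t\<close>; a linear ramp cut
  off by two steps is one. The value of a functional on it will be the coefficient attached to
  \<open>t\<close> in \<open>Delta\<close>.\<close>

definition tent :: "real \<Rightarrow> real \<Rightarrow> complex" where
  "tent t = (SOME e. e \<in> test_fun I \<and> (\<forall>s\<in>I. jump s e = (if s = t then 1 else 0)))"

lemma tent:
  assumes "t \<in> I"
  shows "tent t \<in> test_fun I" "s \<in> I \<Longrightarrow> jump s (tent t) = (if s = t then 1 else 0)"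
proof -
  obtain r where r: "r > 0" "{t-r<..<t+r} \<subseteq> I" using side_in_open[OF opn assms] by metis
  define b where "b = t + r/2"
  have b: "t < b" "b \<in> I" using r by (auto simp: b_def intro!: subsetD[OF r(2)])
  define l :: "real \<Rightarrow> complex" where "l = (\<lambda>s. of_real ((b - s) / (b - t)))"
  define e where "e = (\<lambda>s. (step t s - step b s) * l s)"
  have l: "continuous_on I l" unfolding l_def by (intro continuous_intros) (use b in auto)
  have "l = (\<lambda>s. of_real (b / (b - t)) + of_real (- 1 / (b - t)) * of_real s)"
    using b by (auto simp: l_def diff_divide_distrib)
  moreover have "smooth \<dots>" by (intro smooth_add smooth_mult smooth_const smooth_id(2))
  ultimately have "smooth l" by simp
  then have sme: "smooth e" unfolding e_def by (intro smooth_mult smooth_diff smooth_step)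
  have "e s = 0" if "s \<notin> {t..b}" for s using that b by (auto simp: e_def step_def)
  then have "test_on t b e" using sme assms b by (auto simp: test_on_def intro!: AE_I2)
  then have "e \<in> test_fun I" using test_fun_iff by blast
  moreover have "jump s e = (if s = t then 1 else 0)" if s: "s \<in> I" for s
  proof -
    have "slim x e s = (slim x (step t) s - slim x (step b) s) * l s" for x
      unfolding e_def using s regulated_continuous[OF l]
      by (simp add: slim_mult slim_diff regulated_diff smooth_regulated[OF smooth_step])
    then show ?thesis using b by (auto simp: jump_slim slim_step l_def)
  qed
  ultimately have "\<exists>e. e \<in> test_fun I \<and> (\<forall>s\<in>I. jump s e = (if s = t then 1 else 0))" by blast
  from someI_ex[OF this] show "tent t \<in> test_fun I" "s \<in> I \<Longrightarrow> jump s (tent t) = (if s = t then 1 else 0)"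
    unfolding tent_def by blast+
qed

lemma test_fun_sum: "(\<And>a. a \<in> K \<Longrightarrow> f a \<in> test_fun I) \<Longrightarrow> (\<lambda>s. \<Sum>a\<in>K. f a s) \<in> test_fun I"
  by (induction K rule: infinite_finite_induct) (simp_all add: test_fun_0 test_fun_add)

lemma lin_sum:
  "lin f \<Longrightarrow> (\<And>a. a \<in> K \<Longrightarrow> g a \<in> test_fun I) \<Longrightarrow> f (\<lambda>s. \<Sum>a\<in>K. g a s) = (\<Sum>a\<in>K. f (g a))"
proof (induction K rule: infinite_finite_induct)
  case (insert x F)
  then show ?case using lin_add[of f "g x" "\<lambda>s. \<Sum>a\<in>F. g a s"] test_fun_sum[of F g] by simp
qed (simp_all add: lin_0)

text \<open>The coefficients in \<^const>\<open>Delta\<close> are arbitrary, so only the jumps of order zero matter. Density of the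
  jump-free splines removes the restriction to \<^const>\<open>test_fun_F\<close>.\<close>

lemma Delta_iff: "f \<in> Delta I \<longleftrightarrow> f \<in> distributions I \<and> (\<forall>\<psi>\<in>test_fun I. jump_free \<psi> \<longrightarrow> f \<psi> = 0)"
proof
  assume "f \<in> Delta I"
  then obtain k where f: "f \<in> distributions I"
    and k: "\<And>\<phi>. \<phi> \<in> test_fun_F I \<Longrightarrow> f \<phi> = (\<Sum>t\<in>{t \<in> I. jump t \<phi> \<noteq> 0}. k t * jump t \<phi>)"
    unfolding Delta_def by blast
  have "f \<psi> = 0" if \<psi>: "\<psi> \<in> test_fun I" and nj: "jump_free \<psi>" for \<psi>
  proof -
    obtain c d where cd: "test_on c d \<psi>" "test_on c d e0" using test_on_common[OF \<psi> e0_test] by blast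
    then have "c \<in> I" "d \<in> I" "c < d" by (auto simp: test_on_def)
    then obtain n C where nC: "dist_bound c d n C f" using f unfolding distributions_iff by blast
    have "norm (f \<psi>) \<le> 0"
    proof (rule field_le_epsilon)
      fix e :: real assume e: "e > 0"
      have C: "C \<ge> 0" using nC by (simp add: dist_bound_def)
      define r where "r = e / (C + 1)"
      have r: "r > 0" "C * r \<le> e" using e C by (auto simp: r_def field_simps)
      obtain m S q where q: "finite S" "spline m S q" "test_on c d q" "jump_free q" "bnd I n r (\<lambda>s. \<psi> s - q s)"
        using jump_free_spline_approx[OF cd(1) nj cd(2) r(1)] by blast
      have tq: "q \<in> test_fun I" using q(3) test_fun_iff by blast
      have "{t \<in> I. jump t q \<noteq> 0} = {}" using q(4) by (simp add: jump_free_jump)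
      then have "f q = 0" using k[OF spline_test_fun_F[OF q(2,1) tq]] by simp
      moreover have "norm (f (\<lambda>s. \<psi> s - q s)) \<le> C * r"
        using nC test_on_diff[OF cd(1) q(3)] q(5) r(1) unfolding dist_bound_def by simp
      ultimately show "norm (f \<psi>) \<le> 0 + e" using lin_diff[OF dist_lin[OF f] \<psi> tq] r(2) by simp
    qed
    then show ?thesis by simp
  qed
  with f show "f \<in> distributions I \<and> (\<forall>\<psi>\<in>test_fun I. jump_free \<psi> \<longrightarrow> f \<psi> = 0)" by blast
next
  assume a: "f \<in> distributions I \<and> (\<forall>\<psi>\<in>test_fun I. jump_free \<psi> \<longrightarrow> f \<psi> = 0)"
  then have L: "lin f" by (simp add: dist_lin)
  have "f \<phi> = (\<Sum>t\<in>{t \<in> I. jump t \<phi> \<noteq> 0}. f (tent t) * jump t \<phi>)" if "\<phi> \<in> test_fun_F I" for \<phi>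
  proof -
    define J where "J = {t \<in> I. jump t \<phi> \<noteq> 0}"
    have J: "finite J" and \<phi>: "\<phi> \<in> test_fun I" and r: "regulated \<phi>"
      using F_span_finite_jumps[of \<phi>] that by (auto simp: test_fun_F_def J_def)
    have tJ: "\<And>t. t \<in> J \<Longrightarrow> tent t \<in> test_fun I" using tent(1) by (auto simp: J_def)
    \<comment> \<open>Removing the jumps of \<phi> with the functions \<open>tent t\<close> leaves a
      jump-free test function, on which \<open>f\<close> vanishes. So \<open>f \<phi>\<close>
      depends on the jumps alone.\<close>
    define w where "w = (\<lambda>s. \<Sum>t\<in>J. jump t \<phi> * tent t s)"
    have w: "w \<in> test_fun I" unfolding w_def by (intro test_fun_sum test_fun_cmult tJ)
    have "jump s w = jump s \<phi>" if s: "s \<in> I" for s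
    proof -
      have "jump s w = (\<Sum>t\<in>J. jump t \<phi> * jump s (tent t))"
        unfolding w_def using tJ s
        by (subst jump_sum) (auto intro!: sum.cong jump_cmult smooth_regulated test_fun_smooth test_fun_cmult)
      also have "\<dots> = (\<Sum>t\<in>J. if s = t then jump t \<phi> else 0)"
        using s tent(2) by (intro sum.cong) (auto simp: J_def)
      also have "\<dots> = jump s \<phi>" using J s by (auto simp: sum.delta J_def)
      finally show ?thesis .
    qed
    then have "jump_free (\<lambda>s. \<phi> s - w s)"
      using jump_diff[OF r smooth_regulated[OF test_fun_smooth[OF w]]] by (simp add: jump_free_jump)
    then have "f \<phi> = f w" using a test_fun_diff[OF \<phi> w] lin_diff[OF L \<phi> w] by simp
    also have "\<dots> = (\<Sum>t\<in>J. f (\<lambda>s. jump t \<phi> * tent t s))"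
      unfolding w_def by (intro lin_sum[OF L] test_fun_cmult tJ)
    also have "\<dots> = (\<Sum>t\<in>J. f (tent t) * jump t \<phi>)"
      using lin_cmult[OF L tJ] by (intro sum.cong) (auto simp: mult.commute)
    finally show ?thesis by (simp add: J_def)
  qed
  then show "f \<in> Delta I"
    unfolding Delta_def using a by (intro CollectI conjI exI[of _ "\<lambda>t. f (tent t)"] ballI) auto
qed

section \<open>Calculus of distributions\<close>

lemma dist_lincomb:
  assumes f: "f \<in> distributions I" and g: "g \<in> distributions I"
  shows "(\<lambda>\<phi>. a * f \<phi> + b * g \<phi>) \<in> distributions I"
  unfolding distributions_iff
proof (intro conjI ballI impI)
  show "lin (\<lambda>\<phi>. a * f \<phi> + b * g \<phi>)"
    using dist_lin[OF f] dist_lin[OF g] by (simp add: lin_def algebra_simps)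
  fix c d assume cd: "c \<in> I" "d \<in> I" "c < d"
  obtain k A where A: "dist_bound c d k A f" using f cd unfolding distributions_iff by blast
  obtain l B where B: "dist_bound c d l B g" using g cd unfolding distributions_iff by blast
  have "dist_bound c d (max k l) (norm a * A + norm b * B) (\<lambda>\<phi>. a * f \<phi> + b * g \<phi>)"
    unfolding dist_bound_def
  proof (intro conjI allI impI)
    show "0 \<le> norm a * A + norm b * B" using A B by (simp add: dist_bound_def)
    fix \<phi> M assume p: "test_on c d \<phi>" "0 \<le> M" "bnd I (max k l) M \<phi>"
    then have "bnd I k M \<phi>" "bnd I l M \<phi>" using bnd_le by (metis max.cobounded1 max.cobounded2)+
    then have "norm (f \<phi>) \<le> A * M" "norm (g \<phi>) \<le> B * M" using A B p unfolding dist_bound_def by blast+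
    then have "norm (a * f \<phi>) + norm (b * g \<phi>) \<le> norm a * (A * M) + norm b * (B * M)"
      unfolding norm_mult by (intro add_mono mult_left_mono) auto
    then show "norm (a * f \<phi> + b * g \<phi>) \<le> (norm a * A + norm b * B) * M"
      using norm_triangle_ineq[of "a * f \<phi>" "b * g \<phi>"] by (simp add: algebra_simps)
  qed
  then show "\<exists>k C. dist_bound c d k C (\<lambda>\<phi>. a * f \<phi> + b * g \<phi>)" by blast
qed

lemma dist_zero: "0 \<in> distributions I"
  unfolding distributions_iff lin_def dist_bound_def zero_fun_def
  by (auto intro!: exI[of _ 0])

lemma dist_add: "f \<in> distributions I \<Longrightarrow> g \<in> distributions I \<Longrightarrow> f + g \<in> distributions I"
  using dist_lincomb[of f g 1 1] by (simp add: plus_fun_def)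

lemma dist_diff: "f \<in> distributions I \<Longrightarrow> g \<in> distributions I \<Longrightarrow> f - g \<in> distributions I"
  using dist_lincomb[of f g 1 "- 1"] by (simp add: fun_diff_def)

lemma dist_sum: "(\<And>a. a \<in> K \<Longrightarrow> f a \<in> distributions I) \<Longrightarrow> (\<Sum>a\<in>K. f a) \<in> distributions I"
  by (induction K rule: infinite_finite_induct) (auto simp: dist_zero dist_add)

lemma dist_mult_apply: "\<phi> \<in> test_fun I \<Longrightarrow> dist_mult I g f \<phi> = f (\<lambda>s. g s * \<phi> s)"
  by (simp add: dist_mult_def times_fun_def)

lemma dist_mult_dist:
  assumes g: "smooth g" and f: "f \<in> distributions I"
  shows "dist_mult I g f \<in> distributions I"
  unfolding distributions_iff
proof (intro conjI ballI impI)
  have L: "lin f" using f by (rule dist_lin)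
  show "lin (dist_mult I g f)" unfolding lin_def
  proof (intro conjI ballI allI impI)
    show "\<phi> \<notin> test_fun I \<Longrightarrow> dist_mult I g f \<phi> = 0" for \<phi> by (simp add: dist_mult_def)
    show "dist_mult I g f (\<lambda>s. \<phi> s + \<psi> s) = dist_mult I g f \<phi> + dist_mult I g f \<psi>"
      if "\<phi> \<in> test_fun I" "\<psi> \<in> test_fun I" for \<phi> \<psi>
      using lin_add[OF L test_fun_mult[OF g that(1)] test_fun_mult[OF g that(2)]] test_fun_add[OF that]
      by (simp add: dist_mult_apply that distrib_left)
    show "dist_mult I g f (\<lambda>s. c * \<phi> s) = c * dist_mult I g f \<phi>" if "\<phi> \<in> test_fun I" for \<phi> c
      using lin_cmult[OF L test_fun_mult[OF g that], of c] test_fun_cmult[OF that]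
      by (simp add: dist_mult_apply that algebra_simps)
  qed
  fix c d assume cd: "c \<in> I" "d \<in> I" "c < d"
  obtain k A where A: "dist_bound c d k A f" using f cd unfolding distributions_iff by blast
  obtain C where C: "C \<ge> 0" "\<And>\<phi> M. bnd {c<..<d} k M \<phi> \<Longrightarrow> M \<ge> 0 \<Longrightarrow> bnd {c<..<d} k (C * M) (\<lambda>s. g s * \<phi> s)"
    using bnd_mult[OF cd g] by blast
  have "dist_bound c d k (A * C) (dist_mult I g f)" unfolding dist_bound_def
  proof (intro conjI allI impI)
    show "0 \<le> A * C" using A C by (simp add: dist_bound_def)
    fix \<phi> M assume p: "test_on c d \<phi>" "0 \<le> M" "bnd I k M \<phi>"
    have "bnd {c<..<d} k (C * M) (\<lambda>s. g s * \<phi> s)"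
      using C(2)[OF bnd_subset[OF p(3)] p(2)] Icc_sub[OF cd(1,2)] by fastforce
    then have "bnd I k (C * M) (\<lambda>s. g s * \<phi> s)"
      using bnd_extend[OF test_on_mult[OF g p(1)]] C(1) p(2) by simp
    then have "norm (f (\<lambda>s. g s * \<phi> s)) \<le> A * (C * M)"
      using A test_on_mult[OF g p(1)] C(1) p(2) unfolding dist_bound_def by simp
    then show "norm (dist_mult I g f \<phi>) \<le> A * C * M"
      using p(1) test_fun_iff dist_mult_apply by (metis mult.assoc)
  qed
  then show "\<exists>k C. dist_bound c d k C (dist_mult I g f)" by blast
qed

lemma dG_test: "\<phi> \<in> test_fun I \<Longrightarrow> der \<phi> (dG I \<phi>)" "\<phi> \<in> test_fun I \<Longrightarrow> dG I \<phi> \<in> test_fun I"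
  using dG_test_on test_fun_iff by blast+

lemma dist_dG:
  assumes "f \<in> distributions I" "\<phi> \<in> test_fun I" "der \<phi> h" "h \<in> test_fun I"
  shows "f (dG I \<phi>) = f h"
  using dist_AE_cong[OF assms(1) dG_test(2)[OF assms(2)] assms(4)] der_unique[OF dG_test(1)[OF assms(2)] assms(3)]
  by blast

lemma ddt_dist:
  assumes f: "f \<in> distributions I"
  shows "ddt I f \<in> distributions I"
  unfolding distributions_iff
proof (intro conjI ballI impI)
  have L: "lin f" using f by (rule dist_lin)
  show "lin (ddt I f)" unfolding lin_def
  proof (intro conjI ballI allI impI)
    show "\<phi> \<notin> test_fun I \<Longrightarrow> ddt I f \<phi> = 0" for \<phi> by (simp add: ddt_def)
    show "ddt I f (\<lambda>s. \<phi> s + \<psi> s) = ddt I f \<phi> + ddt I f \<psi>" if "\<phi> \<in> test_fun I" "\<psi> \<in> test_fun I" for \<phi> \<psi>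
      using dist_dG[OF f test_fun_add[OF that] der_add[OF dG_test(1)[OF that(1)] dG_test(1)[OF that(2)]]
          test_fun_add[OF dG_test(2)[OF that(1)] dG_test(2)[OF that(2)]]]
        lin_add[OF L dG_test(2)[OF that(1)] dG_test(2)[OF that(2)]] test_fun_add[OF that] that
      by (simp add: ddt_def)
    show "ddt I f (\<lambda>s. c * \<phi> s) = c * ddt I f \<phi>" if "\<phi> \<in> test_fun I" for \<phi> c
      using dist_dG[OF f test_fun_cmult[OF that] der_cmult[OF dG_test(1)[OF that]]
          test_fun_cmult[OF dG_test(2)[OF that]], of c]
        lin_cmult[OF L dG_test(2)[OF that], of c] test_fun_cmult[OF that, of c] that
      by (simp add: ddt_def)
  qed
  fix c d assume cd: "c \<in> I" "d \<in> I" "c < d"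
  obtain k A where A: "dist_bound c d k A f" using f cd unfolding distributions_iff by blast
  have "dist_bound c d (Suc k) A (ddt I f)" unfolding dist_bound_def
  proof (intro conjI allI impI)
    show "0 \<le> A" using A by (simp add: dist_bound_def)
    fix \<phi> M assume p: "test_on c d \<phi>" "0 \<le> M" "bnd I (Suc k) M \<phi>"
    have "bnd I k M (dG I \<phi>)"
      using bnd_Suc[OF dG_test_on(1)[OF p(1)] test_on_smooth[OF dG_test_on(2)[OF p(1)]] opn subset_refl] p(3) by blast
    then show "norm (ddt I f \<phi>) \<le> A * M"
      using A dG_test_on(2)[OF p(1)] p(1,2) test_fun_iff[of \<phi>] unfolding dist_bound_def ddt_def by auto
  qed
  then show "\<exists>k C. dist_bound c d k C (ddt I f)" by blast
qed

lemma D_iff: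
  assumes f: "f \<in> distributions I"
  shows "g \<in> D I f \<longleftrightarrow> g \<in> distributions I \<and> (\<forall>\<psi>\<in>test_fun I. jump_free \<psi> \<longrightarrow> g \<psi> = - f (dG I \<psi>))"
proof -
  have "g \<in> D I f \<longleftrightarrow> g - ddt I f \<in> Delta I"
  proof
    assume "g - ddt I f \<in> Delta I"
    moreover have "g = ddt I f + (g - ddt I f)" by simp
    ultimately show "g \<in> D I f" unfolding D_def by blast
  qed (auto simp: D_def)
  moreover have "g - ddt I f \<in> distributions I \<longleftrightarrow> g \<in> distributions I"
    using dist_add[OF _ ddt_dist[OF f], of "g - ddt I f"] dist_diff[OF _ ddt_dist[OF f], of g] by auto
  ultimately show ?thesis by (simp add: Delta_iff ddt_def eq_neg_iff_add_eq_0)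
qed

lemma D_add:
  assumes "f \<in> distributions I" "g \<in> distributions I" "f' \<in> D I f" "g' \<in> D I g"
  shows "f' + g' \<in> D I (f + g)"
  using assms by (simp add: D_iff dist_add)

lemma D_sum:
  "(\<And>a. a \<in> K \<Longrightarrow> f a \<in> distributions I) \<Longrightarrow> (\<And>a. a \<in> K \<Longrightarrow> f' a \<in> D I (f a)) \<Longrightarrow>
   (\<Sum>a\<in>K. f' a) \<in> D I (\<Sum>a\<in>K. f a)"
proof (induction K rule: infinite_finite_induct)
  case (insert x F)
  then have "f' x + sum f' F \<in> D I (f x + sum f F)" by (intro D_add dist_sum) auto
  then show ?case by (simp only: sum.insert[OF insert(1,2)])
qed (simp_all add: D_iff dist_zero)

text \<open>If \<open>g\<close> and \<psi> have no jumps, neither has their product, so the value of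
  \<open>f'\<close> on it is prescribed. The derivative \<open>h\<close> of \<open>g\<close> is free
  to jump, as the coefficients of the equation do.\<close>

lemma D_mult:
  assumes f: "f \<in> distributions I" and f': "f' \<in> D I f"
    and g: "jump_free g" "der g h" "smooth h"
  shows "dist_mult I g f' + dist_mult I h f \<in> D I (dist_mult I g f)"
proof -
  have sg: "smooth g" using smooth_of_der g by blast
  have df': "f' \<in> distributions I" using f' D_iff[OF f] by blast
  have "dist_mult I g f' \<psi> + dist_mult I h f \<psi> = - dist_mult I g f (dG I \<psi>)"
    if \<psi>: "\<psi> \<in> test_fun I" "jump_free \<psi>" for \<psi>
  proof -
    note t = test_fun_mult[OF sg \<psi>(1)]
    note a = test_fun_mult[OF g(3) \<psi>(1)] and b = test_fun_mult[OF sg dG_test(2)[OF \<psi>(1)]]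
    have "jump_free (\<lambda>s. g s * \<psi> s)" unfolding jump_free_def
      using slim_mult[OF smooth_regulated[OF sg] smooth_regulated[OF test_fun_smooth[OF \<psi>(1)]]] g(1) \<psi>(2) by (simp add: jump_free_def)
    then have "f' (\<lambda>s. g s * \<psi> s) = - f (dG I (\<lambda>s. g s * \<psi> s))" using D_iff[OF f] f' t by blast
    also have "f (dG I (\<lambda>s. g s * \<psi> s)) = f (\<lambda>s. h s * \<psi> s + g s * dG I \<psi> s)"
      by (rule dist_dG[OF f t der_mult[OF g(2) dG_test(1)[OF \<psi>(1)]] test_fun_add[OF a b]])
    also have "\<dots> = f (\<lambda>s. h s * \<psi> s) + f (\<lambda>s. g s * dG I \<psi> s)" by (rule lin_add[OF dist_lin[OF f] a b])
    finally show ?thesis using \<psi> dG_test(2) by (simp add: dist_mult_apply)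
  qed
  then show ?thesis
    unfolding D_iff[OF dist_mult_dist[OF sg f]]
    using dist_add[OF dist_mult_dist[OF sg df'] dist_mult_dist[OF g(3) f]] by simp
qed

section \<open>Primitives vanishing before \<open>t0\<close>\<close>

lemma zero_before_sum: "(\<And>a. a \<in> K \<Longrightarrow> zero_before I t0 (f a)) \<Longrightarrow> zero_before I t0 (\<Sum>a\<in>K. f a)"
  by (induction K rule: infinite_finite_induct) (auto simp: zero_before_def)

lemma zero_before_mult: "smooth g \<Longrightarrow> zero_before I t0 f \<Longrightarrow> zero_before I t0 (dist_mult I g f)"
  using test_on_mult test_fun_iff dist_mult_apply unfolding zero_before_iff by metis

text \<open>The mass removed from \<phi> is carried by \<open>e0\<close>, whose support ends before
  \<open>t0\<close> as well.\<close>

lemma compact_primitive_before: "test_on c d \<phi> \<Longrightarrow> d < t0 \<Longrightarrow> \<exists>c d. test_on c d (compact_primitive \<phi>) \<and> d < t0"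
proof -
  assume a: "test_on c d \<phi>" "d < t0"
  obtain a b where e: "test_on a b e0" "b < t0" using e0(1) by blast
  have "min a c \<in> I" "max b d \<in> I" using a e by (auto simp: test_on_def min_def max_def)
  then have "test_on (min a c) (max b d) \<phi>" "test_on (min a c) (max b d) e0" using a e by (auto intro: test_on_mono)
  then show ?thesis using compact_primitive_test_on a e by (intro exI[of _ "min a c"] exI[of _ "max b d"]) auto
qed

text \<open>The requirement \<open>H \<psi> = - T \<psi>'\<close> dictates \<open>T\<close> on
  derivatives of jump-free functions. \<open>compact_primitive\<close> inverts that differentiation,
  and the remaining multiple of \<open>e0\<close> has to be sent to zero by a functional vanishing
  before \<open>t0\<close>.\<close>

lemma primitive_exists:
  assumes H: "H \<in> distributions I" "zero_before I t0 H"
  shows "\<exists>T\<in>distributions I. H \<in> D I T \<and> zero_before I t0 T"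
proof -
  define T where "T = (\<lambda>\<phi>. if \<phi> \<in> test_fun I then - H (compact_primitive \<phi>) else 0)"
  note L = dist_lin[OF H(1)]
  have T: "T \<in> distributions I" unfolding distributions_iff
  proof (intro conjI ballI impI)
    show "lin T" unfolding lin_def
    proof (intro conjI ballI allI impI)
      show "\<phi> \<notin> test_fun I \<Longrightarrow> T \<phi> = 0" for \<phi> by (simp add: T_def)
      show "T (\<lambda>s. \<phi> s + \<psi> s) = T \<phi> + T \<psi>" if p: "\<phi> \<in> test_fun I" "\<psi> \<in> test_fun I" for \<phi> \<psi>
      proof -
        obtain c d where 1: "test_on c d (\<lambda>s. \<phi> s + \<psi> s)" "test_on c d e0"
          using test_on_common[OF test_fun_add[OF p] e0_test] by blast
        obtain c' d' where 2: "test_on c' d' \<phi>" "test_on c' d' \<psi>" using test_on_common[OF p] by blast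
        have cd: "min c c' \<in> I" "max d d' \<in> I" using 1 2 by (auto simp: test_on_def min_def max_def)
        have "test_on (min c c') (max d d') \<phi>" "test_on (min c c') (max d d') \<psi>" "test_on (min c c') (max d d') e0"
          using 1 2 cd by (auto intro: test_on_mono)
        then have "compact_primitive (\<lambda>s. \<phi> s + \<psi> s) t = compact_primitive \<phi> t + compact_primitive \<psi> t" if "t \<in> I" for t using compact_primitive_add that by blast
        then have "H (compact_primitive (\<lambda>s. \<phi> s + \<psi> s)) = H (\<lambda>s. compact_primitive \<phi> s + compact_primitive \<psi> s)"
          by (intro dist_AE_cong[OF H(1)] compact_primitive_test test_fun_add p) auto
        then show ?thesis using lin_add[OF L compact_primitive_test[OF p(1)] compact_primitive_test[OF p(2)]] test_fun_add[OF p] p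
          by (simp add: T_def)
      qed
      show "T (\<lambda>s. k * \<phi> s) = k * T \<phi>" if p: "\<phi> \<in> test_fun I" for \<phi> k
      proof -
        obtain c d where "test_on c d \<phi>" "test_on c d e0" using test_on_common[OF p e0_test] by blast
        then have "compact_primitive (\<lambda>s. k * \<phi> s) t = k * compact_primitive \<phi> t" if "t \<in> I" for t using compact_primitive_cmult that by blast
        then have "H (compact_primitive (\<lambda>s. k * \<phi> s)) = H (\<lambda>s. k * compact_primitive \<phi> s)"
          by (intro dist_AE_cong[OF H(1)] compact_primitive_test test_fun_cmult p) auto
        then show ?thesis using lin_cmult[OF L compact_primitive_test[OF p], of k] test_fun_cmult[OF p, of k] p
          by (simp add: T_def)
      qed
    qed
    fix c d assume cd: "c \<in> I" "d \<in> I" "c < d"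
    obtain a b where e: "test_on a b e0" using e0(1) by blast
    \<comment> \<open>The primitive of a function supported in \<open>[c, d]\<close> may reach to
      the support of \<open>e0\<close>, so \<open>H\<close> is estimated on an interval containing
      both.\<close>
    define c' d' where "c' = min a c" and "d' = max b d"
    have cd': "c' \<in> I" "d' \<in> I" "c' < d'" using cd e by (auto simp: test_on_def c'_def d'_def min_def max_def)
    have e': "test_on c' d' e0" by (rule test_on_mono[OF e cd'(1,2)]) (auto simp: c'_def d'_def)
    obtain k A where A: "dist_bound c' d' k A H" using H(1) cd' unfolding distributions_iff by blast
    obtain C where C: "C \<ge> 0" "\<And>u M. test_on c' d' u \<Longrightarrow> M \<ge> 0 \<Longrightarrow> bnd I k M u \<Longrightarrow> bnd I (Suc k) (C * M) (compact_primitive u)"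
      using compact_primitive_bnd[OF e', of k] by blast
    have "dist_bound c d k (A * C) T" unfolding dist_bound_def
    proof (intro conjI allI impI)
      show "0 \<le> A * C" using A C by (simp add: dist_bound_def)
      fix \<phi> M assume p: "test_on c d \<phi>" "0 \<le> M" "bnd I k M \<phi>"
      have p': "test_on c' d' \<phi>" by (rule test_on_mono[OF p(1) cd'(1,2)]) (auto simp: c'_def d'_def)
      have "bnd I k (C * M) (compact_primitive \<phi>)" using bnd_le[OF C(2)[OF p' p(2,3)], of k] by simp
      then have "norm (H (compact_primitive \<phi>)) \<le> A * (C * M)"
        using A compact_primitive_test_on[OF p' e'] C(1) p(2) unfolding dist_bound_def by simp
      then show "norm (T \<phi>) \<le> A * C * M" using p(1) test_fun_iff[of \<phi>] by (auto simp: T_def mult.assoc)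
    qed
    then show "\<exists>k C. dist_bound c d k C T" by blast
  qed
  moreover have "H \<in> D I T" unfolding D_iff[OF T]
  proof (intro conjI ballI impI H(1))
    fix \<psi> assume \<psi>: "\<psi> \<in> test_fun I" "jump_free \<psi>"
    obtain c d where cd: "test_on c d \<psi>" "test_on c d e0" using test_on_common[OF \<psi>(1) e0_test] by blast
    have "H (compact_primitive (dG I \<psi>)) = H \<psi>"
      by (intro dist_AE_cong[OF H(1)] compact_primitive_test dG_test(2) \<psi>(1)
            compact_primitive_der_inverse[OF cd(1) \<psi>(2) dG_test_on(1)[OF cd(1)] test_on_smooth[OF dG_test_on(2)[OF cd(1)]] cd(2)])
    then show "H \<psi> = - T (dG I \<psi>)" using dG_test(2)[OF \<psi>(1)] by (simp add: T_def)
  qed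
  moreover have "zero_before I t0 T" unfolding zero_before_iff
  proof (intro allI impI)
    fix c d \<phi> assume "test_on c d \<phi>" "d < t0"
    then show "T \<phi> = 0" using compact_primitive_before[of c d \<phi>] H(2) unfolding zero_before_iff T_def by auto
  qed
  ultimately show ?thesis by blast
qed

text \<open>Up to null sets, every test function is the derivative of its jump-free
  \<open>compact_primitive\<close> plus a multiple of \<open>e0\<close>. The first part is governed
  by \<open>H\<close>, and the second is annihilated by vanishing before \<open>t0\<close>.\<close>

lemma primitive_unique:
  assumes "S \<in> distributions I" "H \<in> D I S" "zero_before I t0 S"
    and "T \<in> distributions I" "H \<in> D I T" "zero_before I t0 T"
  shows "S = T"
proof
  fix \<phi>
  show "S \<phi> = T \<phi>"
  proof (cases "\<phi> \<in> test_fun I")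
    case False
    then show ?thesis using dist_lin[OF assms(1)] dist_lin[OF assms(4)] by (simp add: lin_def)
  next
    case True
    obtain c d where cd: "test_on c d \<phi>" "test_on c d e0" using test_on_common[OF True e0_test] by blast
    have mean_free: "der (compact_primitive \<phi>) (mean_free \<phi>)" "mean_free \<phi> \<in> test_fun I"
      using compact_primitive_der[OF cd] mean_free_test_on[OF cd] test_fun_iff by blast+
    have ez: "R e0 = 0" if "zero_before I t0 R" for R using that e0(1) unfolding zero_before_iff by blast
    have R: "H (compact_primitive \<phi>) = - R \<phi>" if "R \<in> distributions I" "H \<in> D I R" "zero_before I t0 R" for R
    proof -
      have "H (compact_primitive \<phi>) = - R (dG I (compact_primitive \<phi>))"
        using D_iff[OF that(1)] that(2) compact_primitive_test[OF True] compact_primitive_jump_free[OF True] by blast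
      also have "R (dG I (compact_primitive \<phi>)) = R (mean_free \<phi>)" by (rule dist_dG[OF that(1) compact_primitive_test[OF True] mean_free])
      also have "\<dots> = R \<phi> - total \<phi> * R e0"
        unfolding mean_free_def using lin_diff[OF dist_lin[OF that(1)] True test_fun_cmult[OF e0_test]]
          lin_cmult[OF dist_lin[OF that(1)] e0_test] by simp
      finally show ?thesis using ez[OF that(3)] by simp
    qed
    show ?thesis using R[OF assms(1-3)] R[OF assms(4-6)] by simp
  qed
qed

end

section \<open>Linear systems with regulated coefficients\<close>

lemma integral_AE_dominated:
  fixes u :: "real \<Rightarrow> complex"
  assumes "u integrable_on {x..y}" "(g has_integral G) {x..y}"
    and "\<And>s. s \<in> {x..y} \<Longrightarrow> 0 \<le> g s" "AE s in lebesgue. s \<in> {x..y} \<longrightarrow> norm (u s) \<le> g s"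
  shows "norm (integral {x..y} u) \<le> G"
proof -
  let ?v = "\<lambda>s. if norm (u s) \<le> g s then u s else 0"
  have i: "integral {x..y} u = integral {x..y} ?v"
    by (rule integral_AE_cong) (use assms(4) in \<open>auto elim: eventually_mono\<close>)
  have "?v integrable_on {x..y}"
    by (rule integrable_spike[OF assms(1) AE_negligible[OF assms(4)]]) auto
  then have "norm (integral {x..y} ?v) \<le> integral {x..y} g"
    by (rule integral_norm_bound_integral) (use assms(2,3) in auto)
  then show ?thesis using i assms(2) by (simp add: integral_unique)
qed

context open_interval
begin

text \<open>Bielecki's weight: the integral of \<open>L * exp (2 * L * \<bar>s - a\<bar>)\<close>
  between \<open>a\<close> and \<open>t\<close> is at most half of
  \<open>exp (2 * L * \<bar>t - a\<bar>)\<close>. Integration against coefficients of size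
  \<open>L\<close> thus contracts by 1/2 on intervals of any length.\<close>

lemma signed_integral_exp_bound:
  assumes u: "regulated u" and I: "a \<in> I" "t \<in> I" and L: "L \<ge> 0" "X \<ge> 0"
    and b: "AE s in lebesgue. s \<in> {min a t..max a t} \<longrightarrow> norm (u s) \<le> L * X * exp (2 * L * \<bar>s - a\<bar>)"
  shows "norm (signed_integral a u t) \<le> X / 2 * exp (2 * L * \<bar>t - a\<bar>)"
proof (cases "a \<le> t")
  case True
  have "((\<lambda>s. L * X * exp (2 * L * \<bar>s - a\<bar>)) has_integral
      (X / 2 * exp (2 * L * (t - a)) - X / 2 * exp (2 * L * (a - a)))) {a..t}"
  proof (rule has_integral_eq[rotated], rule fundamental_theorem_of_calculus[OF True])
    fix s assume "s \<in> {a..t}"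
    show "((\<lambda>s. X / 2 * exp (2 * L * (s - a))) has_vector_derivative L * X * exp (2 * L * (s - a))) (at s within {a..t})"
      unfolding has_real_derivative_iff_has_vector_derivative[symmetric]
      by (rule derivative_eq_intros refl | simp)+
  qed auto
  then have "norm (integral {a..t} u) \<le> X / 2 * exp (2 * L * (t - a)) - X / 2 * exp (2 * L * (a - a))"
    by (rule integral_AE_dominated[OF regulated_integrable[OF u Icc_sub[OF I]]]) (use b L True in auto)
  then show ?thesis using True L by (simp add: signed_integral_def)
next
  case False
  have "((\<lambda>s. L * X * exp (2 * L * \<bar>s - a\<bar>)) has_integral
      (- (X / 2) * exp (2 * L * (a - a)) - - (X / 2) * exp (2 * L * (a - t)))) {t..a}"
  proof (rule has_integral_eq[rotated], rule fundamental_theorem_of_calculus)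
    show "t \<le> a" using False by simp
    fix s assume "s \<in> {t..a}"
    show "((\<lambda>s. - (X / 2) * exp (2 * L * (a - s))) has_vector_derivative L * X * exp (2 * L * (a - s))) (at s within {t..a})"
      unfolding has_real_derivative_iff_has_vector_derivative[symmetric]
      by (rule derivative_eq_intros refl | simp)+
  qed auto
  then have "norm (integral {t..a} u) \<le> - (X / 2) * exp (2 * L * (a - a)) - - (X / 2) * exp (2 * L * (a - t))"
    by (rule integral_AE_dominated[OF regulated_integrable[OF u Icc_sub[OF I(2,1)]]]) (use b L False in auto)
  then show ?thesis using False L by (simp add: signed_integral_def)
qed

lemma signed_integral_add: "regulated u \<Longrightarrow> regulated v \<Longrightarrow> a \<in> I \<Longrightarrow> t \<in> I \<Longrightarrow> signed_integral a (\<lambda>s. u s + v s) t = signed_integral a u t + signed_integral a v t"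
  using regulated_integrable[OF _ Icc_sub[of a t]] regulated_integrable[OF _ Icc_sub[of t a]]
  by (simp add: signed_integral_def integral_add)

lemma signed_integral_diff_fun: "regulated u \<Longrightarrow> regulated v \<Longrightarrow> a \<in> I \<Longrightarrow> t \<in> I \<Longrightarrow> signed_integral a (\<lambda>s. u s - v s) t = signed_integral a u t - signed_integral a v t"
  using regulated_integrable[OF _ Icc_sub[of a t]] regulated_integrable[OF _ Icc_sub[of t a]]
  by (simp add: signed_integral_def Henstock_Kurzweil_Integration.integral_diff)

lemma signed_integral_sum:
  "(\<And>n. n \<in> N \<Longrightarrow> regulated (u n)) \<Longrightarrow> a \<in> I \<Longrightarrow> t \<in> I \<Longrightarrow> signed_integral a (\<lambda>s. \<Sum>n\<in>N. u n s) t = (\<Sum>n\<in>N. signed_integral a (u n) t)"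
proof (induction N rule: infinite_finite_induct)
  case (insert x F)
  then show ?case using signed_integral_add[of "u x" "\<lambda>s. \<Sum>n\<in>F. u n s" a t] regulated_sum[of F u] by simp
qed (simp_all add: signed_integral_def)

text \<open>The terms of the Neumann series, that is, the differences of successive Picard iterates
  rather than the iterates; the solution is their sum.\<close>

primrec picard :: "'k set \<Rightarrow> ('k \<Rightarrow> 'k \<Rightarrow> real \<Rightarrow> complex) \<Rightarrow> ('k \<Rightarrow> complex) \<Rightarrow> real \<Rightarrow> nat \<Rightarrow> 'k \<Rightarrow> real \<Rightarrow> complex" where
  "picard K B y0 a 0 = (\<lambda>p t. y0 p)"
| "picard K B y0 a (Suc n) = (\<lambda>p. signed_integral a (\<lambda>s. \<Sum>q\<in>K. B p q s * picard K B y0 a n q s))"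

lemma picard_continuous:
  assumes "\<And>p q. p \<in> K \<Longrightarrow> q \<in> K \<Longrightarrow> regulated (B p q)" "a \<in> I"
  shows "p \<in> K \<Longrightarrow> continuous_on I (picard K B y0 a n p)"
proof (induction n arbitrary: p)
  case (Suc n)
  show ?case unfolding picard.simps
    by (intro signed_integral_continuous regulated_sum regulated_mult assms Suc.prems regulated_continuous(1) Suc.IH)
qed simp

lemma coefficient_bound:
  assumes "finite K" "\<And>p q. p \<in> K \<Longrightarrow> q \<in> K \<Longrightarrow> regulated (B p q)" "{c..d} \<subseteq> I"
  shows "\<exists>L\<ge>0. AE s in lebesgue. s \<in> {c..d} \<longrightarrow> (\<forall>p\<in>K. \<forall>q\<in>K. norm (B p q s) \<le> L)"
proof -
  have "\<forall>x\<in>K\<times>K. \<exists>M\<ge>0. AE s in lebesgue. s \<in> {c..d} \<longrightarrow> norm (B (fst x) (snd x) s) \<le> M"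
    using regulated_locally_bounded[OF _ assms(3)] assms(2) by auto
  then obtain M where M: "\<And>x. x \<in> K\<times>K \<Longrightarrow> M x \<ge> 0"
    "\<And>x. x \<in> K\<times>K \<Longrightarrow> AE s in lebesgue. s \<in> {c..d} \<longrightarrow> norm (B (fst x) (snd x) s) \<le> M x" by metis
  have le: "M x \<le> (\<Sum>x\<in>K\<times>K. M x)" if "x \<in> K\<times>K" for x
    using assms(1) M(1) that by (intro member_le_sum) auto
  have "AE s in lebesgue. \<forall>x\<in>K\<times>K. s \<in> {c..d} \<longrightarrow> norm (B (fst x) (snd x) s) \<le> M x"
    using M(2) assms(1) by (intro AE_finite_allI) auto
  then have "AE s in lebesgue. s \<in> {c..d} \<longrightarrow> (\<forall>p\<in>K. \<forall>q\<in>K. norm (B p q s) \<le> (\<Sum>x\<in>K\<times>K. M x))"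
  proof eventually_elim
    case (elim s)
    show ?case
    proof (intro impI ballI)
      fix p q assume s: "s \<in> {c..d}" and pq: "p \<in> K" "q \<in> K"
      then have "norm (B p q s) \<le> M (p, q)" using bspec[OF elim, of "(p, q)"] by simp
      also have "\<dots> \<le> (\<Sum>x\<in>K\<times>K. M x)" by (rule le) (use pq in simp)
      finally show "norm (B p q s) \<le> (\<Sum>x\<in>K\<times>K. M x)" .
    qed
  qed
  moreover have "(\<Sum>x\<in>K\<times>K. M x) \<ge> 0" using M(1) by (intro sum_nonneg) auto
  ultimately show ?thesis by blast
qed

lemma system_bound:
  fixes B :: "'k \<Rightarrow> 'k \<Rightarrow> real \<Rightarrow> complex"
  assumes "finite K" "AE s in lebesgue. s \<in> J \<longrightarrow> (\<forall>p\<in>K. \<forall>q\<in>K. norm (B p q s) \<le> L)"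
    and "p \<in> K" "L \<ge> 0" "\<And>q s. q \<in> K \<Longrightarrow> s \<in> J \<Longrightarrow> norm (v q s) \<le> X s"
  shows "AE s in lebesgue. s \<in> J \<longrightarrow> norm (\<Sum>q\<in>K. B p q s * v q s) \<le> real (card K) * L * X s"
  using assms(2)
proof eventually_elim
  case (elim s)
  show ?case
  proof
    assume s: "s \<in> J"
    have "norm (\<Sum>q\<in>K. B p q s * v q s) \<le> (\<Sum>q\<in>K. L * X s)"
    proof (rule sum_norm_le)
      fix q assume q: "q \<in> K"
      have "norm (B p q s) \<le> L" "norm (v q s) \<le> X s" using elim s assms(3,5) q by auto
      then show "norm (B p q s * v q s) \<le> L * X s"
        unfolding norm_mult using assms(4) by (intro mult_mono) auto
    qed
    then show "norm (\<Sum>q\<in>K. B p q s * v q s) \<le> real (card K) * L * X s" by simp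
  qed
qed

lemma strict_bounds: "x \<in> I \<Longrightarrow> \<exists>c\<in>I. c < x" "x \<in> I \<Longrightarrow> \<exists>d\<in>I. x < d"
proof -
  assume "x \<in> I"
  then obtain r where r: "r > 0" "{x-r<..<x+r} \<subseteq> I" using side_in_open[OF opn] by metis
  have "x - r/2 \<in> I" "x + r/2 \<in> I" by (rule subsetD[OF r(2)], use r(1) in simp)+
  then show "\<exists>c\<in>I. c < x" "\<exists>d\<in>I. x < d" using r(1) by (auto intro: bexI[of _ "x - r/2"] bexI[of _ "x + r/2"])
qed

text \<open>Each integration contributes one factor 1/2 to the weighted bound, with
  \<open>card K * L\<close> as the size of the coefficient matrix.\<close>

lemma picard_bound:
  assumes K: "finite K" "\<And>p q. p \<in> K \<Longrightarrow> q \<in> K \<Longrightarrow> regulated (B p q)" and a: "a \<in> I" and cd: "{c..d} \<subseteq> I" "a \<in> {c..d}"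
    and L: "L \<ge> 0" "AE s in lebesgue. s \<in> {c..d} \<longrightarrow> (\<forall>p\<in>K. \<forall>q\<in>K. norm (B p q s) \<le> L)"
  shows "p \<in> K \<Longrightarrow> t \<in> {c..d} \<Longrightarrow>
    norm (picard K B y0 a n p t) \<le> (\<Sum>q\<in>K. norm (y0 q)) * (1/2)^n * exp (2 * (real (card K) * L) * \<bar>t - a\<bar>)"
proof (induction n arbitrary: p t)
  case 0
  have "norm (y0 p) \<le> (\<Sum>q\<in>K. norm (y0 q))" using K(1) 0 by (intro member_le_sum) auto
  also have "\<dots> \<le> (\<Sum>q\<in>K. norm (y0 q)) * exp (2 * (real (card K) * L) * \<bar>t - a\<bar>)"
    using mult_left_mono[of 1 "exp (2 * (real (card K) * L) * \<bar>t - a\<bar>)" "\<Sum>q\<in>K. norm (y0 q)"] L(1)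
    by (simp add: sum_nonneg)
  finally show ?case by simp
next
  case (Suc n)
  let ?Y = "\<Sum>q\<in>K. norm (y0 q)"
  let ?X = "?Y * (1/2)^n"
  let ?u = "\<lambda>s. \<Sum>q\<in>K. B p q s * picard K B y0 a n q s"
  have r: "regulated ?u"
    using picard_continuous[OF K(2) a] by (intro regulated_sum regulated_mult K(2) Suc.prems(1) regulated_continuous(1)) auto
  have sub: "{min a t..max a t} \<subseteq> {c..d}" using cd(2) Suc.prems(2) by auto
  have "AE s in lebesgue. s \<in> {c..d} \<longrightarrow> norm (?u s) \<le> real (card K) * L * (?X * exp (2 * (real (card K) * L) * \<bar>s - a\<bar>))"
    by (rule system_bound[OF K(1) L(2) Suc.prems(1) L(1)]) (rule Suc.IH)
  then have b: "AE s in lebesgue. s \<in> {min a t..max a t} \<longrightarrow> norm (?u s) \<le> real (card K) * L * ?X * exp (2 * (real (card K) * L) * \<bar>s - a\<bar>)"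
    by eventually_elim (use sub in \<open>auto simp: mult.assoc\<close>)
  have "norm (signed_integral a ?u t) \<le> ?X / 2 * exp (2 * (real (card K) * L) * \<bar>t - a\<bar>)"
    by (rule signed_integral_exp_bound[OF r a _ _ _ b]) (use cd Suc.prems L in \<open>auto intro!: mult_nonneg_nonneg sum_nonneg\<close>)
  then show ?case by simp
qed

text \<open>The Neumann series converges uniformly on compact subintervals and may be integrated
  term by term. Since the coefficients may jump, the solution is described by the integral equation,
  which holds at every point.\<close>

lemma linear_system:
  assumes K: "finite K" "\<And>p q. p \<in> K \<Longrightarrow> q \<in> K \<Longrightarrow> regulated (B p q)" and a: "a \<in> I"
  shows "\<exists>y. \<forall>p\<in>K. continuous_on I (y p) \<and> (\<forall>t\<in>I. y p t = y0 p + signed_integral a (\<lambda>s. \<Sum>q\<in>K. B p q s * y q s) t)"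
proof -
  define f where "f = picard K B y0 a"
  define y where "y = (\<lambda>p t. \<Sum>n. f n p t)"
  have fc: "continuous_on I (f n p)" if "p \<in> K" for n p unfolding f_def using picard_continuous[OF K(2) a that] .
  \<comment> \<open>An interval with \<open>t\<close> in its interior that also contains the base
    point \<open>a\<close>. It serves both the continuity of the sum at \<open>t\<close> and the
    passage to the limit in the integral from \<open>a\<close> to \<open>t\<close>.\<close>
  have ul: "\<exists>c d L. c \<in> I \<and> d \<in> I \<and> c < t \<and> t < d \<and> a \<in> {c..d} \<and> L \<ge> 0 \<and>
      (AE s in lebesgue. s \<in> {c..d} \<longrightarrow> (\<forall>p\<in>K. \<forall>q\<in>K. norm (B p q s) \<le> L)) \<and>
      (\<forall>p\<in>K. uniform_limit {c..d} (\<lambda>N s. \<Sum>n<N. f n p s) (y p) sequentially)" if t: "t \<in> I" for t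
  proof -
    have "min a t \<in> I" "max a t \<in> I" using a t by (auto simp: min_def max_def)
    then obtain c d where cd: "c \<in> I" "c < min a t" "d \<in> I" "max a t < d" using strict_bounds by metis
    have sub: "{c..d} \<subseteq> I" using Icc_sub cd by blast
    have acd: "a \<in> {c..d}" using cd by auto
    obtain L where L: "L \<ge> 0" "AE s in lebesgue. s \<in> {c..d} \<longrightarrow> (\<forall>p\<in>K. \<forall>q\<in>K. norm (B p q s) \<le> L)"
      using coefficient_bound[where B = B, OF K(1) K(2) sub] by blast
    define C where "C = (\<Sum>q\<in>K. norm (y0 q)) * exp (2 * (real (card K) * L) * (d - c))"
    have "norm (f n p s) \<le> C * (1/2)^n" if "p \<in> K" "s \<in> {c..d}" for n p s
    proof -
      have "norm (f n p s) \<le> (\<Sum>q\<in>K. norm (y0 q)) * (1/2)^n * exp (2 * (real (card K) * L) * \<bar>s - a\<bar>)"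
        unfolding f_def by (rule picard_bound[OF K a sub acd L that])
      also have "\<dots> \<le> (\<Sum>q\<in>K. norm (y0 q)) * (1/2)^n * exp (2 * (real (card K) * L) * (d - c))"
        using L(1) that(2) acd
        by (intro mult_left_mono) (auto intro!: mult_left_mono mult_nonneg_nonneg sum_nonneg)
      finally show ?thesis by (simp add: C_def mult_ac)
    qed
    moreover have "summable (\<lambda>n. C * (1/2)^n)" by (intro summable_mult summable_geometric) simp
    ultimately have "\<forall>p\<in>K. uniform_limit {c..d} (\<lambda>N s. \<Sum>n<N. f n p s) (y p) sequentially"
      unfolding y_def by (intro ballI Weierstrass_m_test) auto
    moreover have "c < t" "t < d" using cd by auto
    ultimately show ?thesis using cd acd L by blast
  qed
  have yc: "continuous_on I (y p)" if p: "p \<in> K" for p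
  proof (rule continuous_at_imp_continuous_on, rule ballI)
    fix t assume t: "t \<in> I"
    from ul[OF t] obtain c d where cd: "c \<in> I" "d \<in> I" "c < t" "t < d"
      "\<forall>p\<in>K. uniform_limit {c..d} (\<lambda>N s. \<Sum>n<N. f n p s) (y p) sequentially" by blast
    have "continuous_on {c..d} (y p)"
    proof (rule uniform_limit_theorem)
      show "uniform_limit {c..d} (\<lambda>N s. \<Sum>n<N. f n p s) (y p) sequentially" using cd p by blast
      show "\<forall>\<^sub>F N in sequentially. continuous_on {c..d} (\<lambda>s. \<Sum>n<N. f n p s)"
        by (intro always_eventually allI continuous_on_sum continuous_on_subset[OF fc[OF p] Icc_sub[OF cd(1,2)]])
    qed simp
    then have "continuous_on {c<..<d} (y p)" by (rule continuous_on_subset) auto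
    then show "isCont (y p) t" using cd by (simp add: continuous_on_eq_continuous_at)
  qed
  have yr: "regulated (y p)" and fr: "regulated (f n p)" if "p \<in> K" for p n
    using regulated_continuous(1) yc fc that by blast+
  have "y p t = y0 p + signed_integral a (\<lambda>s. \<Sum>q\<in>K. B p q s * y q s) t" if p: "p \<in> K" and t: "t \<in> I" for p t
  proof -
    obtain c d L where cd: "c \<in> I" "d \<in> I" "c < t" "t < d" "a \<in> {c..d}" and L: "L \<ge> 0"
      "AE s in lebesgue. s \<in> {c..d} \<longrightarrow> (\<forall>p\<in>K. \<forall>q\<in>K. norm (B p q s) \<le> L)"
      and u: "\<forall>p\<in>K. uniform_limit {c..d} (\<lambda>N s. \<Sum>n<N. f n p s) (y p) sequentially"
      using ul[OF t] by blast
    define S where "S = (\<lambda>N q s. \<Sum>n<N. f n q s)"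
    have Sr: "regulated (S N q)" if "q \<in> K" for N q unfolding S_def by (intro regulated_sum fr that)
    define u1 where "u1 = (\<lambda>N. signed_integral a (\<lambda>s. \<Sum>q\<in>K. B p q s * S N q s) t)"
    define u2 where "u2 = signed_integral a (\<lambda>s. \<Sum>q\<in>K. B p q s * y q s) t"
    define \<Lambda> where "\<Lambda> = real (card K) * L"
    have "u1 \<longlonglongrightarrow> u2"
    proof (rule tendstoI)
      fix e :: real assume e: "e > 0"
      \<comment> \<open>The weighted estimate for the difference between partial sum and limit
        multiplies \<open>r\<close> by half the weight at \<open>t\<close>; this choice makes the
        outcome \<open>e / 2\<close>.\<close>
      define r where "r = e / exp (2 * \<Lambda> * \<bar>t - a\<bar>)"
      have r: "r > 0" using e by (simp add: r_def)
      have "\<forall>\<^sub>F N in sequentially. \<forall>q\<in>K. \<forall>s\<in>{c..d}. dist (S N q s) (y q s) < r"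
        using u r K(1) unfolding S_def uniform_limit_iff by (intro eventually_ball_finite) auto
      then show "\<forall>\<^sub>F N in sequentially. dist (u1 N) u2 < e"
      proof eventually_elim
        case (elim N)
        let ?w = "\<lambda>s. \<Sum>q\<in>K. B p q s * (S N q s - y q s)"
        have wr: "regulated ?w" using K(2) p by (intro regulated_sum regulated_mult regulated_diff Sr yr) auto
        have w: "?w s = (\<Sum>q\<in>K. B p q s * S N q s) - (\<Sum>q\<in>K. B p q s * y q s)" for s
          by (simp add: right_diff_distrib sum_subtractf)
        have "AE s in lebesgue. s \<in> {c..d} \<longrightarrow> norm (?w s) \<le> real (card K) * L * r"
          by (rule system_bound[OF K(1) L(2) p L(1)]) (use elim in \<open>auto simp: dist_norm less_imp_le\<close>)
        then have "AE s in lebesgue. s \<in> {min a t..max a t} \<longrightarrow> norm (?w s) \<le> \<Lambda> * r * exp (2 * \<Lambda> * \<bar>s - a\<bar>)"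
        proof eventually_elim
          case (elim s)
          have "\<Lambda> * r \<le> \<Lambda> * r * exp (2 * \<Lambda> * \<bar>s - a\<bar>)"
            using mult_left_mono[of 1 "exp (2 * \<Lambda> * \<bar>s - a\<bar>)" "\<Lambda> * r"] L(1) r by (simp add: \<Lambda>_def)
          then show ?case using elim cd by (auto simp: \<Lambda>_def)
        qed
        then have "norm (signed_integral a ?w t) \<le> r / 2 * exp (2 * \<Lambda> * \<bar>t - a\<bar>)"
          using L(1) r by (intro signed_integral_exp_bound[OF wr a t]) (auto simp: \<Lambda>_def)
        also have "\<dots> = e / 2" by (simp add: r_def)
        also have "\<dots> < e" using e by simp
        finally have "norm (signed_integral a ?w t) < e" .
        moreover have "signed_integral a ?w t = u1 N - u2" unfolding w u1_def u2_def
          using K(2) p by (intro signed_integral_diff_fun regulated_sum regulated_mult Sr yr a t) auto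
        ultimately show ?case by (simp add: dist_norm)
      qed
    qed
    moreover have "u1 = (\<lambda>N. S (Suc N) p t - y0 p)"
    proof (rule ext)
      fix N
      have "(\<Sum>q\<in>K. B p q s * S N q s) = (\<Sum>n<N. \<Sum>q\<in>K. B p q s * f n q s)" for s
        unfolding S_def sum_distrib_left by (rule sum.swap)
      then have "u1 N = (\<Sum>n<N. signed_integral a (\<lambda>s. \<Sum>q\<in>K. B p q s * f n q s) t)"
        unfolding u1_def using K(2) p by (simp only:) (intro signed_integral_sum regulated_sum regulated_mult fr a t; auto)
      also have "\<dots> = (\<Sum>n<N. f (Suc n) p t)" by (simp add: f_def)
      also have "\<dots> = S (Suc N) p t - f 0 p t" unfolding S_def by (simp only: sum.lessThan_Suc_shift) simp
      finally show "u1 N = S (Suc N) p t - y0 p" by (simp add: f_def)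
    qed
    moreover have "(\<lambda>N. S N p t) \<longlonglongrightarrow> y p t"
      unfolding S_def by (rule tendsto_uniform_limitI[OF bspec[OF u p]]) (use cd in auto)
    then have "(\<lambda>N. S (Suc N) p t) \<longlonglongrightarrow> y p t" by (rule LIMSEQ_Suc)
    then have "(\<lambda>N. S (Suc N) p t - y0 p) \<longlonglongrightarrow> y p t - y0 p" by (intro tendsto_diff tendsto_const)
    ultimately have "u1 \<longlonglongrightarrow> u2" "u1 \<longlonglongrightarrow> y p t - y0 p" by simp_all
    then have "y p t - y0 p = u2" using LIMSEQ_unique by blast
    then show ?thesis by (simp add: u2_def algebra_simps)
  qed
  with yc show ?thesis by blast
qed

text \<open>Ordinary quotients with the values of \<open>y\<close>, as a classical solution has
  them, but one-sided limits of the right-hand side, because the coefficients are known only almost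
  everywhere.\<close>

definition solves :: "'k set \<Rightarrow> ('k \<Rightarrow> 'k \<Rightarrow> real \<Rightarrow> complex) \<Rightarrow> ('k \<Rightarrow> real \<Rightarrow> complex) \<Rightarrow> bool" where
  "solves K B y \<longleftrightarrow> (\<forall>p\<in>K. \<forall>t\<in>I. \<forall>b.
     ((\<lambda>s. (y p s - y p t) / of_real (s - t)) \<longlongrightarrow> slim b (\<lambda>s. \<Sum>q\<in>K. B p q s * y q s) t) (at_side b t)) \<and>
     (\<forall>p\<in>K. continuous_on I (y p))"

lemma linear_system_solves:
  assumes K: "finite K" "\<And>p q. p \<in> K \<Longrightarrow> q \<in> K \<Longrightarrow> regulated (B p q)" and a: "a \<in> I"
  shows "\<exists>y. solves K B y \<and> (\<forall>p\<in>K. y p a = y0 p)"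
proof -
  obtain y where y: "\<And>p. p \<in> K \<Longrightarrow> continuous_on I (y p)"
    "\<And>p t. p \<in> K \<Longrightarrow> t \<in> I \<Longrightarrow> y p t = y0 p + signed_integral a (\<lambda>s. \<Sum>q\<in>K. B p q s * y q s) t"
    using linear_system[where B = B and ?y0.0 = y0, OF K a] by blast
  have "((\<lambda>s. (y p s - y p t) / of_real (s - t)) \<longlongrightarrow> slim b (\<lambda>s. \<Sum>q\<in>K. B p q s * y q s) t) (at_side b t)"
    if p: "p \<in> K" and t: "t \<in> I" for p t b
  proof (rule Lim_transform_eventually)
    let ?u = "\<lambda>s. \<Sum>q\<in>K. B p q s * y q s"
    have "regulated ?u" using K(2) p regulated_continuous(1)[OF y(1)] by (intro regulated_sum regulated_mult) auto
    then show "((\<lambda>s. (signed_integral a ?u s - signed_integral a ?u t) / of_real (s - t)) \<longlongrightarrow> slim b ?u t) (at_side b t)"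
      by (rule signed_integral_quotient[OF _ a t])
    obtain r where r: "r > 0" "side b t r \<subseteq> I" using side_in_open[OF opn t] by metis
    then show "\<forall>\<^sub>F s in at_side b t. (signed_integral a ?u s - signed_integral a ?u t) / of_real (s - t) = (y p s - y p t) / of_real (s - t)"
      unfolding eventually_at_side using y(2)[OF p] t by (intro exI[of _ r]) auto
  qed
  then show ?thesis using y a unfolding solves_def by (intro exI[of _ y]) simp
qed

lemma solves_continuous: "solves K B y \<Longrightarrow> p \<in> K \<Longrightarrow> continuous_on I (y p)"
  by (simp add: solves_def)

lemma solves_der:
  assumes "solves K B y" "\<And>p q. p \<in> K \<Longrightarrow> q \<in> K \<Longrightarrow> regulated (B p q)" "p \<in> K"
  shows "der (y p) (\<lambda>s. \<Sum>q\<in>K. B p q s * y q s)"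
proof (rule der_classical(2))
  show "regulated (\<lambda>s. \<Sum>q\<in>K. B p q s * y q s)"
    by (intro regulated_sum regulated_mult assms(2,3) regulated_continuous(1) solves_continuous[OF assms(1)])
qed (use assms in \<open>simp add: solves_def\<close>)

lemma alg_sum: "(\<And>a. a \<in> K \<Longrightarrow> alg A (f a)) \<Longrightarrow> alg A (\<lambda>s. \<Sum>a\<in>K. f a s)"
  by (induction K rule: infinite_finite_induct) (auto intro: alg.intros)

text \<open>The derivative of a component is a polynomial in the components and the smooth
  coefficients, so these together generate an algebra closed under differentiation.\<close>

lemma solves_smooth:
  assumes y: "solves K B y" "\<And>p q. p \<in> K \<Longrightarrow> q \<in> K \<Longrightarrow> smooth (B p q)" "p \<in> K"
  shows "smooth (y p)"
proof -
  define A where "A = (\<lambda>f. smooth f \<or> (\<exists>p\<in>K. f = y p))"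
  show ?thesis
  proof (rule smooth_algI[of A])
    fix f assume "A f"
    then consider "smooth f" | p where "p \<in> K" "f = y p" by (auto simp: A_def)
    then show "\<exists>h. der f h \<and> alg A h"
    proof cases
      case 1
      then obtain h where "der f h" "smooth h" using smooth_der by blast
      then show ?thesis using alg.base[of A h] by (auto simp: A_def)
    next
      case 2
      have "alg A (\<lambda>s. \<Sum>q\<in>K. B p q s * y q s)"
        using y(2) 2 by (intro alg_sum alg.mult alg.base) (auto simp: A_def)
      then show ?thesis using solves_der[OF y(1) smooth_regulated[OF y(2)], of p] 2 by auto
    qed
  next
    show "alg A (y p)" using y(3) by (intro alg.base) (auto simp: A_def)
  qed
qed

text \<open>Coefficients of the adjoint system \<open>z' = - B^T z\<close>; the rows of the inverse
  of a fundamental matrix solve it.\<close>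

definition adj :: "('k \<Rightarrow> 'k \<Rightarrow> real \<Rightarrow> complex) \<Rightarrow> 'k \<Rightarrow> 'k \<Rightarrow> real \<Rightarrow> complex" where
  "adj B = (\<lambda>p q s. - B q p s)"

text \<open>In the product rule the contributions of \<open>B\<close> and of minus its transpose
  cancel, and a continuous function with zero derivative is constant.\<close>

lemma pairing_constant:
  assumes K: "finite K" "\<And>p q. p \<in> K \<Longrightarrow> q \<in> K \<Longrightarrow> smooth (B p q)"
    and y: "solves K B y" and z: "solves K (adj B) z" and st: "s \<in> I" "t \<in> I"
  shows "(\<Sum>r\<in>K. z r s * y r s) = (\<Sum>r\<in>K. z r t * y r t)"
proof -
  have adj: "smooth (adj B p q)" if "p \<in> K" "q \<in> K" for p q
    using smooth_diff[OF smooth_const[of 0] K(2)[OF that(2,1)]] by (simp add: adj_def)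
  let ?y' = "\<lambda>p s. \<Sum>q\<in>K. B p q s * y q s" and ?z' = "\<lambda>p s. \<Sum>q\<in>K. adj B p q s * z q s"
  have d: "der (\<lambda>s. \<Sum>r\<in>K. z r s * y r s) (\<lambda>s. \<Sum>r\<in>K. ?z' r s * y r s + z r s * ?y' r s)"
    by (intro der_sum der_mult solves_der[OF y] solves_der[OF z] smooth_regulated K(2) adj)
  have "(\<Sum>r\<in>K. ?z' r s * y r s + z r s * ?y' r s) = 0" for s
  proof -
    have "(\<Sum>r\<in>K. ?z' r s * y r s) = - (\<Sum>r\<in>K. \<Sum>q\<in>K. B q r s * z q s * y r s)"
      by (simp add: adj_def sum_distrib_right sum_negf)
    also have "(\<Sum>r\<in>K. \<Sum>q\<in>K. B q r s * z q s * y r s) = (\<Sum>q\<in>K. \<Sum>r\<in>K. B q r s * z q s * y r s)" by (rule sum.swap)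
    also have "\<dots> = (\<Sum>q\<in>K. z q s * ?y' q s)" by (simp add: sum_distrib_left mult_ac)
    finally show ?thesis by (simp add: sum.distrib)
  qed
  then have d: "der (\<lambda>s. \<Sum>r\<in>K. z r s * y r s) (\<lambda>_. 0)" using d by simp
  show ?thesis
    by (rule zero_derivative_constant[OF _ d _ st])
       (auto simp: slim_const intro!: continuous_intros solves_continuous[OF y] solves_continuous[OF z])
qed

text \<open>The right inverse needs no linear algebra: the pairing is independent of the time, so the
  solutions based at two points determine each other.\<close>

lemma fundamental_pair:
  assumes K: "finite K" "\<And>p q. p \<in> K \<Longrightarrow> q \<in> K \<Longrightarrow> smooth (B p q)" and a: "a \<in> I"
  shows "\<exists>\<Phi> \<Psi>. (\<forall>q\<in>K. solves K B (\<lambda>p. \<Phi> p q)) \<and> (\<forall>p\<in>K. solves K (adj B) (\<Psi> p)) \<and>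
    (\<forall>p\<in>K. \<forall>q\<in>K. \<Psi> p q a = (if p = q then 1 else 0)) \<and>
    (\<forall>t\<in>I. \<forall>p\<in>K. \<forall>q\<in>K. (\<Sum>r\<in>K. \<Psi> p r t * \<Phi> r q t) = (if p = q then 1 else 0) \<and>
       (\<Sum>r\<in>K. \<Phi> p r t * \<Psi> r q t) = (if p = q then 1 else 0))"
proof -
  have adj: "smooth (adj B p q)" if "p \<in> K" "q \<in> K" for p q
    using smooth_diff[OF smooth_const[of 0] K(2)[OF that(2,1)]] by (simp add: adj_def)
  define Y where "Y = (\<lambda>b q. SOME y. solves K B y \<and> (\<forall>p\<in>K. y p b = (if p = q then 1 else 0)))"
  define Z where "Z = (\<lambda>b q. SOME y. solves K (adj B) y \<and> (\<forall>p\<in>K. y p b = (if q = p then 1 else 0)))"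
  have Y0: "solves K B (Y b q) \<and> (\<forall>p\<in>K. Y b q p b = (if p = q then 1 else 0))" if "b \<in> I" for b q
    unfolding Y_def
    by (rule someI_ex[OF linear_system_solves[where B = B and ?y0.0 = "\<lambda>p. if p = q then 1 else 0",
          OF K(1) smooth_regulated[OF K(2)] that]])
  have Z0: "solves K (adj B) (Z b q) \<and> (\<forall>p\<in>K. Z b q p b = (if q = p then 1 else 0))" if "b \<in> I" for b q
    unfolding Z_def
    by (rule someI_ex[OF linear_system_solves[where B = "adj B" and ?y0.0 = "\<lambda>p. if q = p then 1 else 0",
          OF K(1) smooth_regulated[OF adj] that]])
  have Y: "\<And>b q. b \<in> I \<Longrightarrow> solves K B (Y b q)" "\<And>b q p. b \<in> I \<Longrightarrow> p \<in> K \<Longrightarrow> Y b q p b = (if p = q then 1 else 0)"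
    and Z: "\<And>b q. b \<in> I \<Longrightarrow> solves K (adj B) (Z b q)" "\<And>b q p. b \<in> I \<Longrightarrow> p \<in> K \<Longrightarrow> Z b q p b = (if q = p then 1 else 0)"
    using Y0 Z0 by simp_all
  have ZY: "(\<Sum>r\<in>K. Z b p r t * Y c q r t) = (\<Sum>r\<in>K. Z b p r s * Y c q r s)"
    if "b \<in> I" "c \<in> I" "s \<in> I" "t \<in> I" for b c p q s t
    by (rule pairing_constant[OF K Y(1) Z(1)]) (use that in auto)
  \<comment> \<open>Evaluated at either of the two base points, the constant pairing picks out a
    single entry.\<close>
  have swap: "Y c q p b = Z b p q c" if "b \<in> I" "c \<in> I" "p \<in> K" "q \<in> K" for b c p q
  proof -
    have "(\<Sum>r\<in>K. Z b p r b * Y c q r b) = Y c q p b"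
      using that K(1) by (simp add: Z(2) if_distrib[of "\<lambda>x. x * _"] cong: if_cong)
    moreover have "(\<Sum>r\<in>K. Z b p r c * Y c q r c) = Z b p q c"
      using that K(1) by (simp add: Y(2) if_distrib[of "\<lambda>x. _ * x"] cong: if_cong)
    ultimately show ?thesis using ZY[of b c b c p q] that by simp
  qed
  have left: "(\<Sum>r\<in>K. Z b p r t * Y b q r t) = (if p = q then 1 else 0)"
    if "b \<in> I" "t \<in> I" "p \<in> K" "q \<in> K" for b t p q
  proof -
    have "(\<Sum>r\<in>K. Z b p r t * Y b q r t) = (\<Sum>r\<in>K. Z b p r b * Y b q r b)" by (rule ZY) (use that in auto)
    also have "\<dots> = Y b q p b" using that K(1) by (simp add: Z(2) if_distrib[of "\<lambda>x. x * _"] cong: if_cong)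
    finally show ?thesis using Y(2) that by simp
  qed
  \<comment> \<open>By \<open>swap\<close>, the product of \<open>Y\<close> and \<open>Z\<close>
    based at \<open>a\<close> and taken at time \<open>t\<close> becomes a product based at
    \<open>t\<close> and taken at time \<open>a\<close>, in the order treated by
    \<open>left\<close>.\<close>
  have right: "(\<Sum>r\<in>K. Y a r p t * Z a r q t) = (if p = q then 1 else 0)"
    if "t \<in> I" "p \<in> K" "q \<in> K" for t p q
  proof -
    have "(\<Sum>r\<in>K. Y a r p t * Z a r q t) = (\<Sum>r\<in>K. Z t p r a * Y t q r a)"
      using that a swap[of t a p] swap[of a t _ q] by (intro sum.cong) auto
    then show ?thesis using left[of t a p q] that a by simp
  qed
  show ?thesis
    by (rule exI[of _ "\<lambda>p q. Y a q p"], rule exI[of _ "Z a"])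
       (use Y Z left right a in auto)
qed

end

section \<open>Linear systems of distributions\<close>

context open_interval
begin

lemma dist_off: "f \<in> distributions I \<Longrightarrow> \<phi> \<notin> test_fun I \<Longrightarrow> f \<phi> = 0"
  using dist_lin by (simp add: lin_def)

lemma sum_fun_app: "(\<Sum>a\<in>N. f a) x = (\<Sum>a\<in>N. f a x)" for f :: "'a \<Rightarrow> 'b \<Rightarrow> 'c::comm_monoid_add"
  by (induction N rule: infinite_finite_induct) (simp_all add: zero_fun_def)

lemma dist_mult_cong:
  assumes "f \<in> distributions I" "smooth g" "smooth h" "\<And>s. s \<in> I \<Longrightarrow> g s = h s"
  shows "dist_mult I g f = dist_mult I h f"
proof
  fix \<phi>
  show "dist_mult I g f \<phi> = dist_mult I h f \<phi>"
  proof (cases "\<phi> \<in> test_fun I")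
    case True
    have "f (\<lambda>s. g s * \<phi> s) = f (\<lambda>s. h s * \<phi> s)"
      by (rule dist_AE_cong[OF assms(1) test_fun_mult[OF assms(2) True] test_fun_mult[OF assms(3) True]])
         (use assms(4) in simp)
    then show ?thesis using True by (simp add: dist_mult_apply)
  qed (simp add: dist_mult_def)
qed

lemma dist_mult_mult:
  assumes "smooth g" shows "dist_mult I g (dist_mult I h f) = dist_mult I (\<lambda>s. g s * h s) f"
proof
  fix \<phi>
  have "(\<lambda>s. h s * (g s * \<phi> s)) = (\<lambda>s. g s * h s * \<phi> s)" by (simp add: mult_ac)
  then show "dist_mult I g (dist_mult I h f) \<phi> = dist_mult I (\<lambda>s. g s * h s) f \<phi>"
    using dist_mult_apply[OF test_fun_mult[OF assms, of \<phi>], of h f]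
    by (cases "\<phi> \<in> test_fun I") (simp_all add: dist_mult_apply, simp add: dist_mult_def)
qed

lemma dist_mult_sum_left:
  assumes "f \<in> distributions I" "\<And>a. a \<in> N \<Longrightarrow> smooth (g a)"
  shows "dist_mult I (\<lambda>s. \<Sum>a\<in>N. g a s) f = (\<Sum>a\<in>N. dist_mult I (g a) f)"
proof
  fix \<phi>
  show "dist_mult I (\<lambda>s. \<Sum>a\<in>N. g a s) f \<phi> = (\<Sum>a\<in>N. dist_mult I (g a) f) \<phi>"
  proof (cases "\<phi> \<in> test_fun I")
    case True
    have "f (\<lambda>s. \<Sum>a\<in>N. g a s * \<phi> s) = (\<Sum>a\<in>N. f (\<lambda>s. g a s * \<phi> s))"
      by (rule lin_sum[OF dist_lin[OF assms(1)]]) (use test_fun_mult assms(2) True in blast)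
    then show ?thesis using True by (simp add: dist_mult_apply sum_fun_app sum_distrib_right)
  qed (simp add: dist_mult_def sum_fun_app)
qed

lemma dist_mult_sum_right: "dist_mult I g (\<Sum>a\<in>N. f a) = (\<Sum>a\<in>N. dist_mult I g (f a))"
  by (rule ext) (simp add: dist_mult_def sum_fun_app)

lemma dist_mult_add_right: "dist_mult I g (f + f') = dist_mult I g f + dist_mult I g f'"
  by (rule ext) (simp add: dist_mult_def)

lemma dist_mult_zero_right: "dist_mult I g 0 = 0"
  by (rule ext) (simp add: dist_mult_def)

lemma dist_mult_if:
  assumes "f \<in> distributions I"
  shows "dist_mult I (\<lambda>s. if P then 1 else 0) f = (if P then f else 0)"
proof
  fix \<phi>
  show "dist_mult I (\<lambda>s. if P then 1 else 0) f \<phi> = (if P then f else 0) \<phi>"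
    using dist_off[OF assms] lin_0[OF dist_lin[OF assms]]
    by (cases "\<phi> \<in> test_fun I") (simp_all add: dist_mult_apply, simp add: dist_mult_def)
qed

lemma dist_mult_minus:
  assumes "f \<in> distributions I" "smooth g"
  shows "dist_mult I (\<lambda>s. - g s) f = - dist_mult I g f"
proof
  fix \<phi>
  show "dist_mult I (\<lambda>s. - g s) f \<phi> = (- dist_mult I g f) \<phi>"
    using lin_cmult[OF dist_lin[OF assms(1)] test_fun_mult[OF assms(2)], of \<phi> "- 1"]
    by (cases "\<phi> \<in> test_fun I") (simp_all add: dist_mult_apply, simp add: dist_mult_def)
qed

lemma smooth_uminus: "smooth g \<Longrightarrow> smooth (\<lambda>s. - g s)"
  using smooth_diff[OF smooth_const[of 0]] by simp

lemma inverse_dist_mult: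
  assumes K: "finite K" and smooth: "\<And>p q. p \<in> K \<Longrightarrow> q \<in> K \<Longrightarrow> smooth (R p q)" "\<And>p q. p \<in> K \<Longrightarrow> q \<in> K \<Longrightarrow> smooth (S p q)"
    and RS: "\<And>t p q. t \<in> I \<Longrightarrow> p \<in> K \<Longrightarrow> q \<in> K \<Longrightarrow> (\<Sum>r\<in>K. R p r t * S r q t) = (if p = q then 1 else 0)"
    and g: "\<And>p. p \<in> K \<Longrightarrow> g p \<in> distributions I" and p: "p \<in> K"
  shows "(\<Sum>q\<in>K. dist_mult I (R p q) (\<Sum>r\<in>K. dist_mult I (S q r) (g r))) = g p"
proof -
  have "(\<Sum>q\<in>K. dist_mult I (R p q) (\<Sum>r\<in>K. dist_mult I (S q r) (g r)))
      = (\<Sum>q\<in>K. \<Sum>r\<in>K. dist_mult I (\<lambda>s. R p q s * S q r s) (g r))"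
    using p by (simp add: dist_mult_sum_right dist_mult_mult smooth)
  also have "\<dots> = (\<Sum>r\<in>K. \<Sum>q\<in>K. dist_mult I (\<lambda>s. R p q s * S q r s) (g r))" by (rule sum.swap)
  also have "\<dots> = (\<Sum>r\<in>K. if r = p then g r else 0)"
  proof (rule sum.cong[OF refl])
    fix r assume r: "r \<in> K"
    have s: "\<And>q. q \<in> K \<Longrightarrow> smooth (\<lambda>s. R p q s * S q r s)" by (intro smooth_mult smooth p r)
    have "(\<Sum>q\<in>K. dist_mult I (\<lambda>s. R p q s * S q r s) (g r)) = dist_mult I (\<lambda>s. \<Sum>q\<in>K. R p q s * S q r s) (g r)"
      by (rule dist_mult_sum_left[OF g[OF r] s, symmetric])
    also have "\<dots> = dist_mult I (\<lambda>s. if r = p then 1 else 0) (g r)"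
      by (rule dist_mult_cong[OF g[OF r] smooth_sum[OF s] smooth_const]) (use RS[OF _ p r] in auto)
    also have "\<dots> = (if r = p then g r else 0)" by (rule dist_mult_if[OF g[OF r]])
    finally show "(\<Sum>q\<in>K. dist_mult I (\<lambda>s. R p q s * S q r s) (g r)) = (if r = p then g r else 0)" .
  qed
  also have "\<dots> = g p" using K p by (simp add: sum.delta)
  finally show ?thesis .
qed

text \<open>The multivalued derivative causes no ambiguity: the derivative \<open>B v + f\<close>
  prescribed for \<open>v\<close> singles out one derivative of \<open>S v\<close>, namely
  \<open>S f\<close>, and only one primitive of that vanishes before \<open>t0\<close>.\<close>

lemma system_dist_unique:
  assumes K: "finite K" and B: "\<And>p q. p \<in> K \<Longrightarrow> q \<in> K \<Longrightarrow> smooth (B p q)"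
    and smooth: "\<And>p q. p \<in> K \<Longrightarrow> q \<in> K \<Longrightarrow> smooth (R p q)" "\<And>p q. p \<in> K \<Longrightarrow> q \<in> K \<Longrightarrow> smooth (S p q)"
    and RS: "\<And>t p q. t \<in> I \<Longrightarrow> p \<in> K \<Longrightarrow> q \<in> K \<Longrightarrow> (\<Sum>r\<in>K. R p r t * S r q t) = (if p = q then 1 else 0)"
    and S: "\<And>p q. p \<in> K \<Longrightarrow> q \<in> K \<Longrightarrow> jump_free (S p q)"
      "\<And>p q. p \<in> K \<Longrightarrow> q \<in> K \<Longrightarrow> der (S p q) (\<lambda>s. \<Sum>r\<in>K. adj B q r s * S p r s)"
    and f: "\<And>p. p \<in> K \<Longrightarrow> f p \<in> distributions I"
    and v: "\<And>p. p \<in> K \<Longrightarrow> v p \<in> distributions I" "\<And>p. p \<in> K \<Longrightarrow> zero_before I t0 (v p)"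
      "\<And>p. p \<in> K \<Longrightarrow> (\<Sum>q\<in>K. dist_mult I (B p q) (v q)) + f p \<in> D I (v p)"
    and T: "\<And>p. p \<in> K \<Longrightarrow> T p \<in> distributions I" "\<And>p. p \<in> K \<Longrightarrow> zero_before I t0 (T p)"
      "\<And>p. p \<in> K \<Longrightarrow> (\<Sum>q\<in>K. dist_mult I (S p q) (f q)) \<in> D I (T p)"
    and p: "p \<in> K"
  shows "v p = (\<Sum>q\<in>K. dist_mult I (R p q) (T q))"
proof -
  have "T p = (\<Sum>q\<in>K. dist_mult I (S p q) (v q))" if p: "p \<in> K" for p
  proof (rule primitive_unique[OF T(1)[OF p] T(3)[OF p] T(2)[OF p]])
    show "(\<Sum>q\<in>K. dist_mult I (S p q) (v q)) \<in> distributions I"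
      by (intro dist_sum dist_mult_dist smooth v p)
    show "zero_before I t0 (\<Sum>q\<in>K. dist_mult I (S p q) (v q))"
      by (intro zero_before_sum zero_before_mult smooth v p)
    have s': "smooth (\<lambda>s. \<Sum>r\<in>K. adj B q r s * S p r s)" if "q \<in> K" for q
      unfolding adj_def by (intro smooth_sum smooth_mult smooth_uminus B smooth p that)
    have "(\<Sum>q\<in>K. dist_mult I (S p q) ((\<Sum>r\<in>K. dist_mult I (B q r) (v r)) + f q)
         + dist_mult I (\<lambda>s. \<Sum>r\<in>K. adj B q r s * S p r s) (v q)) \<in> D I (\<Sum>q\<in>K. dist_mult I (S p q) (v q))"
      by (intro D_sum D_mult dist_mult_dist v S smooth s' p)
    moreover have "(\<Sum>q\<in>K. dist_mult I (S p q) ((\<Sum>r\<in>K. dist_mult I (B q r) (v r)) + f q)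
         + dist_mult I (\<lambda>s. \<Sum>r\<in>K. adj B q r s * S p r s) (v q)) = (\<Sum>q\<in>K. dist_mult I (S p q) (f q))"
    proof -
      \<comment> \<open>The product \<open>S B v\<close> from the equation and the term from the
        derivative of \<open>S\<close> both expand into these entries, once with the indices
        interchanged; exchanging the summations cancels them.\<close>
      define X where "X = (\<lambda>q r. dist_mult I (\<lambda>s. S p q s * B q r s) (v r))"
      have 1: "dist_mult I (S p q) ((\<Sum>r\<in>K. dist_mult I (B q r) (v r)) + f q) = (\<Sum>r\<in>K. X q r) + dist_mult I (S p q) (f q)"
        if "q \<in> K" for q
        unfolding X_def using smooth(2)[OF p that]
        by (simp add: dist_mult_add_right dist_mult_sum_right dist_mult_mult)
      have 2: "dist_mult I (\<lambda>s. \<Sum>r\<in>K. adj B q r s * S p r s) (v q) = (\<Sum>r\<in>K. - X r q)" if q: "q \<in> K" for q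
      proof -
        have "dist_mult I (\<lambda>s. \<Sum>r\<in>K. adj B q r s * S p r s) (v q) = (\<Sum>r\<in>K. dist_mult I (\<lambda>s. adj B q r s * S p r s) (v q))"
          unfolding adj_def by (intro dist_mult_sum_left v q smooth_mult smooth_uminus B smooth p)
        also have "\<dots> = (\<Sum>r\<in>K. - X r q)"
        proof (rule sum.cong[OF refl])
          fix r assume r: "r \<in> K"
          have "(\<lambda>s. adj B q r s * S p r s) = (\<lambda>s. - (S p r s * B r q s))" by (simp add: adj_def mult.commute)
          then show "dist_mult I (\<lambda>s. adj B q r s * S p r s) (v q) = - X r q"
            unfolding X_def by (simp only:) (intro dist_mult_minus v q smooth_mult smooth B p r)
        qed
        finally show ?thesis .
      qed
      have "(\<Sum>q\<in>K. dist_mult I (S p q) ((\<Sum>r\<in>K. dist_mult I (B q r) (v r)) + f q)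
         + dist_mult I (\<lambda>s. \<Sum>r\<in>K. adj B q r s * S p r s) (v q))
         = (\<Sum>q\<in>K. (\<Sum>r\<in>K. X q r) + dist_mult I (S p q) (f q) + (\<Sum>r\<in>K. - X r q))"
        by (rule sum.cong[OF refl]) (simp only: 1 2)
      also have "\<dots> = (\<Sum>q\<in>K. \<Sum>r\<in>K. X q r) + (\<Sum>q\<in>K. dist_mult I (S p q) (f q)) - (\<Sum>q\<in>K. \<Sum>r\<in>K. X r q)"
        by (simp only: sum.distrib sum_negf) (simp add: algebra_simps)
      also have "(\<Sum>q\<in>K. \<Sum>r\<in>K. X r q) = (\<Sum>q\<in>K. \<Sum>r\<in>K. X q r)" by (rule sum.swap)
      finally show ?thesis by (simp only: add_diff_cancel_left')
    qed
    ultimately show "(\<Sum>q\<in>K. dist_mult I (S p q) (f q)) \<in> D I (\<Sum>q\<in>K. dist_mult I (S p q) (v q))" by simp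
  qed
  then have "(\<Sum>q\<in>K. dist_mult I (R p q) (T q))
      = (\<Sum>q\<in>K. dist_mult I (R p q) (\<Sum>r\<in>K. dist_mult I (S q r) (v r)))"
    by (intro sum.cong refl) simp
  also have "\<dots> = v p" by (rule inverse_dist_mult[OF K smooth RS v(1) p])
  finally show ?thesis by simp
qed

text \<open>The product rule for \<open>v = R T\<close>: the derivative of \<open>R\<close>
  contributes \<open>B R T = B v\<close>, and the derivative of \<open>T\<close> contributes
  \<open>R S f = f\<close>.\<close>

lemma system_dist_exists:
  assumes K: "finite K" and B: "\<And>p q. p \<in> K \<Longrightarrow> q \<in> K \<Longrightarrow> smooth (B p q)"
    and smooth: "\<And>p q. p \<in> K \<Longrightarrow> q \<in> K \<Longrightarrow> smooth (R p q)" "\<And>p q. p \<in> K \<Longrightarrow> q \<in> K \<Longrightarrow> smooth (S p q)"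
    and RS: "\<And>t p q. t \<in> I \<Longrightarrow> p \<in> K \<Longrightarrow> q \<in> K \<Longrightarrow> (\<Sum>r\<in>K. R p r t * S r q t) = (if p = q then 1 else 0)"
    and R: "\<And>p q. p \<in> K \<Longrightarrow> q \<in> K \<Longrightarrow> jump_free (R p q)"
      "\<And>p q. p \<in> K \<Longrightarrow> q \<in> K \<Longrightarrow> der (R p q) (\<lambda>s. \<Sum>r\<in>K. B p r s * R r q s)"
    and f: "\<And>p. p \<in> K \<Longrightarrow> f p \<in> distributions I"
    and T: "\<And>p. p \<in> K \<Longrightarrow> T p \<in> distributions I" "\<And>p. p \<in> K \<Longrightarrow> zero_before I t0 (T p)"
      "\<And>p. p \<in> K \<Longrightarrow> (\<Sum>q\<in>K. dist_mult I (S p q) (f q)) \<in> D I (T p)"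
    and v: "v = (\<lambda>p. \<Sum>q\<in>K. dist_mult I (R p q) (T q))" and p: "p \<in> K"
  shows "v p \<in> distributions I" "zero_before I t0 (v p)"
    "(\<Sum>q\<in>K. dist_mult I (B p q) (v q)) + f p \<in> D I (v p)"
proof -
  show "v p \<in> distributions I" unfolding v by (intro dist_sum dist_mult_dist smooth T p)
  show "zero_before I t0 (v p)" unfolding v by (intro zero_before_sum zero_before_mult smooth T p)
  have s': "smooth (\<lambda>s. \<Sum>r\<in>K. B p r s * R r q s)" if "q \<in> K" for q
    by (intro smooth_sum smooth_mult B smooth p that)
  have "(\<Sum>q\<in>K. dist_mult I (R p q) (\<Sum>r\<in>K. dist_mult I (S q r) (f r))
       + dist_mult I (\<lambda>s. \<Sum>r\<in>K. B p r s * R r q s) (T q)) \<in> D I (v p)"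
    unfolding v by (intro D_sum D_mult dist_mult_dist T R smooth s' p)
  moreover have "(\<Sum>q\<in>K. dist_mult I (\<lambda>s. \<Sum>r\<in>K. B p r s * R r q s) (T q)) = (\<Sum>q\<in>K. dist_mult I (B p q) (v q))"
  proof -
    have "(\<Sum>q\<in>K. dist_mult I (\<lambda>s. \<Sum>r\<in>K. B p r s * R r q s) (T q))
        = (\<Sum>q\<in>K. \<Sum>r\<in>K. dist_mult I (\<lambda>s. B p r s * R r q s) (T q))"
    proof (rule sum.cong[OF refl])
      fix q assume q: "q \<in> K"
      show "dist_mult I (\<lambda>s. \<Sum>r\<in>K. B p r s * R r q s) (T q) = (\<Sum>r\<in>K. dist_mult I (\<lambda>s. B p r s * R r q s) (T q))"
        by (intro dist_mult_sum_left T q smooth_mult B smooth p)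
    qed
    also have "\<dots> = (\<Sum>r\<in>K. \<Sum>q\<in>K. dist_mult I (\<lambda>s. B p r s * R r q s) (T q))" by (rule sum.swap)
    also have "\<dots> = (\<Sum>r\<in>K. dist_mult I (B p r) (v r))"
      using p by (intro sum.cong) (simp_all add: v dist_mult_sum_right dist_mult_mult B)
    finally show ?thesis .
  qed
  moreover have "(\<Sum>q\<in>K. dist_mult I (R p q) (\<Sum>r\<in>K. dist_mult I (S q r) (f r))) = f p"
    by (rule inverse_dist_mult[OF K smooth RS f p])
  ultimately show "(\<Sum>q\<in>K. dist_mult I (B p q) (v q)) + f p \<in> D I (v p)"
    by (simp only: sum.distrib) (simp add: add.commute)
qed

text \<open>\<open>S\<close> is given only pointwise, as a matrix inverse chosen separately at each
  time. If \<Psi> is the fundamental matrix of the adjoint system that is the identity at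
  \<open>t0\<close>, then the product of \<Psi> and \<open>R\<close> is constant; so
  \<open>S\<close> equals its value at \<open>t0\<close> times \<Psi> and inherits the regularity of
  \<Psi>.\<close>

lemma inverse_solves:
  assumes K: "finite K" and B: "\<And>p q. p \<in> K \<Longrightarrow> q \<in> K \<Longrightarrow> smooth (B p q)"
    and R: "\<And>q. q \<in> K \<Longrightarrow> solves K B (\<lambda>p. R p q)"
    and RS: "\<And>t p q. t \<in> I \<Longrightarrow> p \<in> K \<Longrightarrow> q \<in> K \<Longrightarrow> (\<Sum>r\<in>K. R p r t * S r q t) = (if p = q then 1 else 0)"
    and SR: "\<And>t p q. t \<in> I \<Longrightarrow> p \<in> K \<Longrightarrow> q \<in> K \<Longrightarrow> (\<Sum>r\<in>K. S p r t * R r q t) = (if p = q then 1 else 0)"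
    and pq: "p \<in> K" "q \<in> K"
  shows "continuous_on I (S p q)" "smooth (S p q)" "der (S p q) (\<lambda>s. \<Sum>r\<in>K. adj B q r s * S p r s)"
proof -
  have adj: "smooth (adj B p q)" if "p \<in> K" "q \<in> K" for p q
    unfolding adj_def by (intro smooth_uminus B that)
  obtain \<Psi> where \<Psi>: "\<And>p. p \<in> K \<Longrightarrow> solves K (adj B) (\<Psi> p)"
    "\<And>p q. p \<in> K \<Longrightarrow> q \<in> K \<Longrightarrow> \<Psi> p q t0 = (if p = q then 1 else 0)"
    using fundamental_pair[where B = B, OF K B t0] by blast
  have rep: "S p q t = (\<Sum>u\<in>K. S p u t0 * \<Psi> u q t)" if t: "t \<in> I" and pq: "p \<in> K" "q \<in> K" for p q t
  proof -
    have \<Psi>R: "(\<Sum>r\<in>K. \<Psi> u r t * R r w t) = R u w t0" if "u \<in> K" "w \<in> K" for u w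
    proof -
      have "(\<Sum>r\<in>K. \<Psi> u r t * R r w t) = (\<Sum>r\<in>K. \<Psi> u r t0 * R r w t0)"
        by (rule pairing_constant[OF K B R[OF that(2)] \<Psi>(1)[OF that(1)] t t0])
      also have "\<dots> = R u w t0"
        using K that by (simp add: \<Psi>(2) if_distrib[of "\<lambda>x. x * _"] cong: if_cong)
      finally show ?thesis .
    qed
    have \<Psi>e: "\<Psi> u q t = (\<Sum>w\<in>K. R u w t0 * S w q t)" if u: "u \<in> K" for u
    proof -
      have "\<Psi> u q t = (\<Sum>r\<in>K. \<Psi> u r t * (\<Sum>w\<in>K. R r w t * S w q t))"
        using K pq t by (simp add: RS if_distrib[of "\<lambda>x. _ * x"] cong: if_cong)
      also have "\<dots> = (\<Sum>w\<in>K. \<Sum>r\<in>K. \<Psi> u r t * R r w t * S w q t)"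
        by (subst sum.swap) (simp add: sum_distrib_left mult.assoc)
      also have "\<dots> = (\<Sum>w\<in>K. R u w t0 * S w q t)"
        using \<Psi>R[OF u] by (simp flip: sum_distrib_right)
      finally show ?thesis .
    qed
    have "(\<Sum>u\<in>K. S p u t0 * \<Psi> u q t) = (\<Sum>u\<in>K. S p u t0 * (\<Sum>w\<in>K. R u w t0 * S w q t))"
      using \<Psi>e by simp
    also have "\<dots> = (\<Sum>w\<in>K. (\<Sum>u\<in>K. S p u t0 * R u w t0) * S w q t)"
      unfolding sum_distrib_left sum_distrib_right by (subst sum.swap) (simp add: mult.assoc)
    also have "\<dots> = S p q t"
      using K pq t0 by (simp add: SR if_distrib[of "\<lambda>x. x * _"] cong: if_cong)
    finally show ?thesis by simp
  qed
  define W where "W = (\<lambda>p q s. \<Sum>u\<in>K. S p u t0 * \<Psi> u q s)"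
  have W: "S p q t = W p q t" if "t \<in> I" "p \<in> K" "q \<in> K" for p q t using rep that by (simp add: W_def)
  have Wc: "continuous_on I (W p q)" if "q \<in> K" for p q
    unfolding W_def using that by (intro continuous_intros solves_continuous[OF \<Psi>(1)])
  have Sc: "continuous_on I (S p q)" if "p \<in> K" "q \<in> K" for p q
    using Wc[OF that(2)] W that by (simp cong: continuous_on_cong)
  have sW: "smooth (W p q)" if "q \<in> K" for p q
    unfolding W_def using that by (intro smooth_sum smooth_mult smooth_const solves_smooth[OF \<Psi>(1)] adj)
  show "continuous_on I (S p q)" by (rule Sc[OF pq])
  show "smooth (S p q)" by (rule smooth_cong[OF sW[OF pq(2)] _ regulated_continuous(1)[OF Sc[OF pq]]]) (use W pq in auto)
  have dW: "der (W p q) (\<lambda>s. \<Sum>u\<in>K. S p u t0 * (\<Sum>r\<in>K. adj B q r s * \<Psi> u r s))"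
    unfolding W_def by (intro der_sum der_cmult solves_der[OF \<Psi>(1)] smooth_regulated[OF adj] pq)
  have "(\<Sum>u\<in>K. S p u t0 * (\<Sum>r\<in>K. adj B q r s * \<Psi> u r s)) = (\<Sum>r\<in>K. adj B q r s * W p r s)" for s
    unfolding W_def sum_distrib_left by (subst sum.swap) (simp add: mult_ac)
  then have dW: "der (W p q) (\<lambda>s. \<Sum>r\<in>K. adj B q r s * W p r s)" using dW by simp
  show "der (S p q) (\<lambda>s. \<Sum>r\<in>K. adj B q r s * S p r s)"
  proof (rule der_cong[OF dW])
    show "regulated (S p q)" by (rule regulated_continuous(1)[OF Sc[OF pq]])
    show "regulated (\<lambda>s. \<Sum>r\<in>K. adj B q r s * S p r s)"
      by (intro regulated_sum regulated_mult smooth_regulated[OF adj] regulated_continuous(1)[OF Sc] pq)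
  qed (use W pq in auto)
qed

end

section \<open>Reduction of the matrix equation to a scalar system\<close>

text \<open>A scalar component is indexed by the order of differentiation and the row.\<close>

definition state :: "nat \<Rightarrow> (nat \<times> 'n::finite) set" where
  "state m = {..<m} \<times> UNIV"

text \<open>The block companion matrix. No matrix column appears in the index, because every column
  of the unknown matrix satisfies the same scalar system.\<close>

definition companion ::
  "nat \<Rightarrow> (nat \<Rightarrow> real \<Rightarrow> complex^'n::finite^'n) \<Rightarrow> nat \<times> 'n \<Rightarrow> nat \<times> 'n \<Rightarrow> real \<Rightarrow> complex" where
  "companion m A p q = (if Suc (fst p) < m then (\<lambda>s. if q = (Suc (fst p), snd p) then 1 else 0)
     else (\<lambda>s. A (fst q) s $ snd p $ snd q))"

lemma finite_state [simp]: "finite (state m)"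
  by (simp add: state_def)

lemma state_iff [simp]: "(k, x) \<in> state m \<longleftrightarrow> k < m"
  by (simp add: state_def)

lemma sum_state: "(\<Sum>r\<in>state m. f r) = (\<Sum>l<m. \<Sum>y\<in>UNIV. f (l, y))"
  unfolding state_def by (simp add: sum.cartesian_product)

lemma companion_sum:
  "Suc k < m \<Longrightarrow> (\<Sum>q\<in>state m. companion m A (k, x) q s * y q) = y (Suc k, x)"
  "\<not> Suc k < m \<Longrightarrow> (\<Sum>q\<in>state m. companion m A (k, x) q s * y q) = (\<Sum>l<m. \<Sum>z\<in>UNIV. A l s $ x $ z * y (l, z))"
proof -
  assume "Suc k < m"
  then have "(\<Sum>q\<in>state m. companion m A (k, x) q s * y q) = (\<Sum>q\<in>state m. if q = (Suc k, x) then y q else 0)"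
    by (intro sum.cong) (auto simp: companion_def)
  also have "\<dots> = y (Suc k, x)" using \<open>Suc k < m\<close> by (subst sum.delta) auto
  finally show "(\<Sum>q\<in>state m. companion m A (k, x) q s * y q) = y (Suc k, x)" .
next
  assume "\<not> Suc k < m"
  then show "(\<Sum>q\<in>state m. companion m A (k, x) q s * y q) = (\<Sum>l<m. \<Sum>z\<in>UNIV. A l s $ x $ z * y (l, z))"
    by (simp add: sum_state companion_def)
qed

lemma tendsto_vec_iff: "(f \<longlongrightarrow> l) F \<longleftrightarrow> (\<forall>i. ((\<lambda>x. f x $ i) \<longlongrightarrow> l $ i) F)"
  by (metis tendsto_vec_nth vec_tendstoI)

lemma matrix_vector_derivative_iff:
  fixes f :: "real \<Rightarrow> complex^'n::finite^'n"
  shows "(f has_vector_derivative l) (at x within S) \<longleftrightarrow>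
    (\<forall>i j. ((\<lambda>s. (f s $ i $ j - f x $ i $ j) / of_real (s - x)) \<longlongrightarrow> l $ i $ j) (at x within S))"
proof -
  have "((f s - f x) /\<^sub>R (s - x)) $ i $ j = (f s $ i $ j - f x $ i $ j) / of_real (s - x)" for s i j
    by (simp only: vector_scaleR_component vector_minus_component)
       (simp add: scaleR_conv_of_real divide_inverse mult.commute)
  then show ?thesis unfolding has_vector_derivative_scaleR_quotient tendsto_vec_iff by simp
qed

lemma matrix_side_derivative_iff:
  fixes f :: "real \<Rightarrow> complex^'n::finite^'n"
  shows "(f has_vector_derivative l) (at_side b x) \<longleftrightarrow>
    (\<forall>i j. ((\<lambda>s. (f s $ i $ j - f x $ i $ j) / of_real (s - x)) \<longlongrightarrow> l $ i $ j) (at_side b x))"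
  by (cases b) (simp_all add: at_side_def matrix_vector_derivative_iff)

lemma nderiv_Suc: "nderiv (Suc k) X t = vector_derivative (nderiv k X) (at t)"
  by (simp add: nderiv_def)

lemma sides_at: "(f \<longlongrightarrow> l) (at x) \<longleftrightarrow> (\<forall>b. (f \<longlongrightarrow> l) (at_side b x))" for x :: real
  by (auto simp: all_bool_eq at_side_def filterlim_at_split)

lemma block_product_entry:
  fixes R :: "nat \<Rightarrow> nat \<Rightarrow> complex^'n::finite^'n"
  shows "(\<Sum>l<m. R i l ** S l j) $ x $ y = (\<Sum>r\<in>state m. R i (fst r) $ x $ snd r * S (fst r) j $ snd r $ y)"
  by (simp add: sum_state matrix_matrix_mult_def)

lemma block_inverse_entries:
  fixes R :: "nat \<Rightarrow> nat \<Rightarrow> complex^'n::finite^'n"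
  shows "is_block_inverse m R S \<longleftrightarrow> (\<forall>p\<in>state m. \<forall>q\<in>state m.
    (\<Sum>r\<in>state m. R (fst p) (fst r) $ snd p $ snd r * S (fst r) (fst q) $ snd r $ snd q) = (if p = q then 1 else 0) \<and>
    (\<Sum>r\<in>state m. S (fst p) (fst r) $ snd p $ snd r * R (fst r) (fst q) $ snd r $ snd q) = (if p = q then 1 else 0))"
proof -
  have id: "((if i = j then mat 1 else 0) :: complex^'n^'n) $ x $ y = (if (i, x) = (j, y) then 1 else 0)" for i j :: nat and x y
    by (simp add: mat_def)
  have eq: "M = (if i = j then mat 1 else 0) \<longleftrightarrow> (\<forall>x y. M $ x $ y = (if (i, x) = (j, y) then 1 else 0))"
    for M :: "complex^'n^'n" and i j :: nat
    by (simp only: vec_eq_iff id)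
  show ?thesis unfolding is_block_inverse_def eq block_product_entry
    by (auto simp: state_def)
qed

context open_interval
begin

section \<open>Classical solutions and the scalar system\<close>

lemma matrix_limits:
  assumes "A \<in> mat_G_inf I" "t \<in> I"
  shows "rlim A t $ x $ y = slim True (\<lambda>s. A s $ x $ y) t" "llim A t $ x $ y = slim False (\<lambda>s. A s $ x $ y) t"
proof -
  have "Lim (es b t) A = (\<chi> x y. slim b (\<lambda>s. A s $ x $ y) t)" for b
  proof (rule tendsto_Lim)
    have "smooth (\<lambda>s. A s $ x $ y)" for x y using assms(1) G_inf_smooth by (simp add: mat_G_inf_def)
    then show "(A \<longlongrightarrow> (\<chi> x y. slim b (\<lambda>s. A s $ x $ y) t)) (es b t)"
      unfolding tendsto_vec_iff using regulated_lim[OF smooth_regulated assms(2)] by simp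
  qed simp
  from this[of True] this[of False] show "rlim A t $ x $ y = slim True (\<lambda>s. A s $ x $ y) t"
    "llim A t $ x $ y = slim False (\<lambda>s. A s $ x $ y) t"
    by (simp_all add: rlim_def llim_def es_def)
qed

lemma companion_smooth:
  assumes "\<And>k. k < m \<Longrightarrow> A k \<in> mat_G_inf I" "p \<in> state m" "q \<in> state m"
  shows "smooth (companion m A p q)"
proof (cases "Suc (fst p) < m")
  case True
  then show ?thesis using smooth_const by (simp add: companion_def)
next
  case False
  have "A (fst q) \<in> mat_G_inf I" using assms by (auto simp: state_def)
  then show ?thesis using False G_inf_smooth by (simp add: companion_def mat_G_inf_def)
qed

text \<open>The components are continuous, so only the coefficients contribute one-sided limits;
  this yields the right-hand sides demanded of a classical solution.\<close>

lemma slim_top_row: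
  assumes A: "\<And>k. k < m \<Longrightarrow> A k \<in> mat_G_inf I" and y: "\<And>p. p \<in> state m \<Longrightarrow> continuous_on I (y p)" and t: "t \<in> I"
    and Y: "\<And>l z. l < m \<Longrightarrow> Y l $ z $ j = y (l, z) t"
  shows "slim True (\<lambda>s. \<Sum>l<m. \<Sum>z\<in>UNIV. A l s $ x $ z * y (l, z) s) t = (\<Sum>l<m. rlim (A l) t ** Y l) $ x $ j"
    "slim False (\<lambda>s. \<Sum>l<m. \<Sum>z\<in>UNIV. A l s $ x $ z * y (l, z) s) t = (\<Sum>l<m. llim (A l) t ** Y l) $ x $ j"
proof -
  have "slim b (\<lambda>s. \<Sum>l<m. \<Sum>z\<in>UNIV. A l s $ x $ z * y (l, z) s) t
      = (\<Sum>l<m. \<Sum>z\<in>UNIV. slim b (\<lambda>s. A l s $ x $ z) t * y (l, z) t)" for b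
  proof (rule slimI, intro tendsto_sum tendsto_mult)
    fix l z assume l: "l \<in> {..<m}"
    have "smooth (\<lambda>s. A l s $ x $ z)" using A l G_inf_smooth by (simp add: mat_G_inf_def)
    then show "((\<lambda>s. A l s $ x $ z) \<longlongrightarrow> slim b (\<lambda>s. A l s $ x $ z) t) (es b t)" using regulated_lim[OF smooth_regulated t] by blast
    have c: "continuous_on I (y (l, z))" using y l by simp
    show "((\<lambda>s. y (l, z) s) \<longlongrightarrow> y (l, z) t) (es b t)"
      using regulated_lim[OF regulated_continuous(1)[OF c] t, of b] regulated_continuous(2)[OF c t] by simp
  qed
  then show "slim True (\<lambda>s. \<Sum>l<m. \<Sum>z\<in>UNIV. A l s $ x $ z * y (l, z) s) t = (\<Sum>l<m. rlim (A l) t ** Y l) $ x $ j"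
    "slim False (\<lambda>s. \<Sum>l<m. \<Sum>z\<in>UNIV. A l s $ x $ z * y (l, z) s) t = (\<Sum>l<m. llim (A l) t ** Y l) $ x $ j"
    using matrix_limits[OF A t] Y by (simp_all add: matrix_matrix_mult_def)
qed

lemma classical_solution_solves:
  assumes A: "\<And>k. k < m \<Longrightarrow> A k \<in> mat_G_inf I" and m: "m \<ge> 1" and X: "classical_solution I m A X"
  shows "solves (state m) (companion m A) (\<lambda>p t. nderiv (fst p) X t $ snd p $ j)"
proof -
  define y where "y = (\<lambda>p t. nderiv (fst p) X t $ snd p $ j)"
  have d: "(nderiv k X has_vector_derivative nderiv (Suc k) X t) (at t)" if "Suc k < m" "t \<in> I" for k t
    using X that unfolding nderiv_Suc classical_solution_def by (simp add: vector_derivative_works)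
  have top: "(nderiv (m - 1) X has_vector_derivative (\<Sum>k<m. (if b then rlim (A k) t else llim (A k) t) ** nderiv k X t)) (at_side b t)"
    if "t \<in> I" for t b
    using X that unfolding classical_solution_def at_side_def by simp
  \<comment> \<open>At order \<open>m - 1\<close> only one-sided derivatives are available, so
    continuity is collected from the two sides.\<close>
  have isc: "isCont (nderiv k X) t" if k: "k < m" and t: "t \<in> I" for k t
  proof (cases "Suc k < m")
    case True
    then show ?thesis using d[OF True t] has_vector_derivative_continuous by blast
  next
    case False
    then have "k = m - 1" using k by simp
    then have "continuous (at_right t) (nderiv k X)" "continuous (at_left t) (nderiv k X)"
      using top[OF t, of True] top[OF t, of False] has_vector_derivative_continuous
      by (auto simp: at_side_def)
    then show ?thesis by (simp add: continuous_at_split)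
  qed
  have c: "continuous_on I (y p)" if "p \<in> state m" for p
    unfolding y_def using isc that
    by (intro continuous_on_component continuous_at_imp_continuous_on) (auto simp: state_def)
  have "((\<lambda>s. (y (k, x) s - y (k, x) t) / of_real (s - t)) \<longlongrightarrow>
      slim b (\<lambda>s. \<Sum>q\<in>state m. companion m A (k, x) q s * y q s) t) (at_side b t)"
    if k: "k < m" and t: "t \<in> I" for k x t b
  proof (cases "Suc k < m")
    case True
    have "((\<lambda>s. (y (k, x) s - y (k, x) t) / of_real (s - t)) \<longlongrightarrow> y (Suc k, x) t) (at t)"
      using d[OF True t] unfolding matrix_vector_derivative_iff by (simp add: y_def)
    moreover have "at_side b t \<le> at t" by (simp add: at_side_def at_le)
    ultimately show ?thesis
      using regulated_continuous(2)[OF c t, of "(Suc k, x)"] True by (simp add: companion_sum tendsto_mono)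
  next
    case False
    then have km: "k = m - 1" using k by simp
    have "slim b (\<lambda>s. \<Sum>q\<in>state m. companion m A (k, x) q s * y q s) t
       = (\<Sum>l<m. (if b then rlim (A l) t else llim (A l) t) ** nderiv l X t) $ x $ j"
      unfolding companion_sum(2)[OF False]
      using slim_top_row[where A = A and y = y and Y = "\<lambda>l. nderiv l X t" and j = j and x = x, OF A c t]
      by (cases b) (simp_all add: y_def)
    then show ?thesis using top[OF t, of b] unfolding matrix_side_derivative_iff by (simp add: y_def km)
  qed
  then have "solves (state m) (companion m A) y" unfolding solves_def using c by (auto simp: state_def)
  then show ?thesis by (simp only: y_def)
qed

lemma solves_classical_solution:
  fixes A :: "nat \<Rightarrow> real \<Rightarrow> complex^'n::finite^'n"
  assumes A: "\<And>k. k < m \<Longrightarrow> A k \<in> mat_G_inf I" and m: "m \<ge> 1"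
    and y: "\<And>j. solves (state m) (companion m A) (y j)" and X: "X = (\<lambda>t. \<chi> x j. y j (0, x) t)"
  shows "classical_solution I m A X" "k < m \<Longrightarrow> t \<in> I \<Longrightarrow> nderiv k X t = (\<chi> x j. y j (k, x) t)"
proof -
  define M where "M = (\<lambda>k t. \<chi> x j. y j (k, x) t)"
  have c: "continuous_on I (y j p)" if "p \<in> state m" for j p using solves_continuous[OF y that] .
  have q: "\<And>k x t b j. k < m \<Longrightarrow> t \<in> I \<Longrightarrow> ((\<lambda>s. (y j (k, x) s - y j (k, x) t) / of_real (s - t)) \<longlongrightarrow>
      slim b (\<lambda>s. \<Sum>q\<in>state m. companion m A (k, x) q s * y j q s) t) (at_side b t)"
    using y unfolding solves_def by simp
  have d: "(M k has_vector_derivative M (Suc k) t) (at t)" if k: "Suc k < m" and t: "t \<in> I" for k t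
    unfolding matrix_vector_derivative_iff sides_at
  proof (intro allI)
    fix x j b
    have "slim b (\<lambda>s. \<Sum>q\<in>state m. companion m A (k, x) q s * y j q s) t = y j (Suc k, x) t"
      unfolding companion_sum(1)[OF k] using regulated_continuous(2)[OF c t, of "(Suc k, x)"] k by simp
    then show "((\<lambda>s. (M k s $ x $ j - M k t $ x $ j) / of_real (s - t)) \<longlongrightarrow> M (Suc k) t $ x $ j) (at_side b t)"
      using q[of k t j x b] k t by (simp add: M_def)
  qed
  have top: "(M (m - 1) has_vector_derivative (\<Sum>k<m. (if b then rlim (A k) t else llim (A k) t) ** M k t)) (at_side b t)"
    if t: "t \<in> I" for t b
    unfolding matrix_side_derivative_iff
  proof (intro allI)
    fix x j
    have nm: "\<not> Suc (m - 1) < m" by simp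
    have "slim b (\<lambda>s. \<Sum>q\<in>state m. companion m A (m - 1, x) q s * y j q s) t
       = (\<Sum>l<m. (if b then rlim (A l) t else llim (A l) t) ** M l t) $ x $ j"
      unfolding companion_sum(2)[OF nm]
      using slim_top_row[where A = A and y = "y j" and Y = "\<lambda>l. M l t" and j = j and x = x, OF A c t]
      by (cases b) (simp_all add: M_def)
    then show "((\<lambda>s. (M (m - 1) s $ x $ j - M (m - 1) t $ x $ j) / of_real (s - t)) \<longlongrightarrow>
        (\<Sum>k<m. (if b then rlim (A k) t else llim (A k) t) ** M k t) $ x $ j) (at_side b t)"
      using q[of "m - 1" t j x b] m t by (simp add: M_def)
  qed
  \<comment> \<open>The identification of \<open>nderiv k X\<close> with \<open>M k\<close> holds on
    \<open>I\<close> only; as \<open>I\<close> is open, derivatives at its points do not see the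
    rest of the line.\<close>
  have transfer: "(f has_vector_derivative l) F" if "(g has_vector_derivative l) F" "t \<in> I" "\<And>s. s \<in> I \<Longrightarrow> f s = g s"
    "F = at t within S" for f g :: "real \<Rightarrow> complex^'n^'n" and l F t S
  proof -
    have "eventually (\<lambda>s. s \<in> I) (at t within S)" using that(2) opn by (simp add: eventually_at_topological) blast
    then have "\<forall>\<^sub>F s in at t within S. (g s - g t) /\<^sub>R (s - t) = (f s - f t) /\<^sub>R (s - t)"
      by eventually_elim (use that in simp)
    then show ?thesis using that(1) unfolding that(4) has_vector_derivative_scaleR_quotient
      by (rule Lim_transform_eventually[rotated])
  qed
  have n: "nderiv k X t = M k t" if "k < m" "t \<in> I" for k t
    using that
  proof (induction k arbitrary: t)
    case 0 then show ?case by (simp add: nderiv_def X M_def)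
  next
    case (Suc k)
    have "(nderiv k X has_vector_derivative M (Suc k) t) (at t)"
      by (rule transfer[OF d[OF Suc.prems] Suc.prems(2)]) (use Suc in auto)
    then show ?case unfolding nderiv_Suc by (rule vector_derivative_at)
  qed
  show "k < m \<Longrightarrow> t \<in> I \<Longrightarrow> nderiv k X t = (\<chi> x j. y j (k, x) t)" using n by (simp add: M_def)
  show "classical_solution I m A X" unfolding classical_solution_def
  proof (intro ballI conjI allI impI)
    fix t assume t: "t \<in> I"
    show "nderiv k X differentiable at t" if k: "Suc k < m" for k
      by (rule differentiableI_vector[OF transfer[OF d[OF k t] t]]) (use n k in auto)
    have sum: "(\<Sum>k<m. L k ** nderiv k X t) = (\<Sum>k<m. L k ** M k t)" for L :: "nat \<Rightarrow> complex^'n^'n"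
      using n t by simp
    have m1: "nderiv (m - 1) X s = M (m - 1) s" if "s \<in> I" for s using n m that by simp
    show "(nderiv (m - 1) X has_vector_derivative (\<Sum>k<m. rlim (A k) t ** nderiv k X t)) (at_right t)"
      unfolding sum using top[OF t, of True] by (intro transfer[OF _ t m1 refl]) (simp_all add: at_side_def)
    show "(nderiv (m - 1) X has_vector_derivative (\<Sum>k<m. llim (A k) t ** nderiv k X t)) (at_left t)"
      unfolding sum using top[OF t, of False] by (intro transfer[OF _ t m1 refl]) (simp_all add: at_side_def)
  qed
qed

lemma fundamental_system_exists:
  assumes A: "\<And>k. k < m \<Longrightarrow> A k \<in> mat_G_inf I" and m: "m \<ge> 1"
  shows "\<exists>Xs. fundamental_system I m A Xs"
proof -
  have "\<exists>\<Phi> \<Psi>. (\<forall>q\<in>state m. solves (state m) (companion m A) (\<lambda>p. \<Phi> p q)) \<and>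
      (\<forall>p\<in>state m. solves (state m) (adj (companion m A)) (\<Psi> p)) \<and>
      (\<forall>p\<in>state m. \<forall>q\<in>state m. \<Psi> p q t0 = (if p = q then 1 else 0)) \<and>
      (\<forall>t\<in>I. \<forall>p\<in>state m. \<forall>q\<in>state m. (\<Sum>r\<in>state m. \<Psi> p r t * \<Phi> r q t) = (if p = q then 1 else 0) \<and>
        (\<Sum>r\<in>state m. \<Phi> p r t * \<Psi> r q t) = (if p = q then 1 else 0))"
    by (rule fundamental_pair[OF finite_state companion_smooth[OF A] t0])
  then obtain \<Phi> \<Psi> where *: "\<forall>q\<in>state m. solves (state m) (companion m A) (\<lambda>p. \<Phi> p q)"
    "\<forall>t\<in>I. \<forall>p\<in>state m. \<forall>q\<in>state m. (\<Sum>r\<in>state m. \<Psi> p r t * \<Phi> r q t) = (if p = q then 1 else 0) \<and>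
        (\<Sum>r\<in>state m. \<Phi> p r t * \<Psi> r q t) = (if p = q then 1 else 0)"
    by (elim exE conjE)
  have \<Phi>: "solves (state m) (companion m A) (\<lambda>p. \<Phi> p q)" if "q \<in> state m" for q using * that by simp
  have inv: "(\<Sum>r\<in>state m. \<Psi> p r t * \<Phi> r q t) = (if p = q then 1 else 0) \<and>
      (\<Sum>r\<in>state m. \<Phi> p r t * \<Psi> r q t) = (if p = q then 1 else 0)"
    if "t \<in> I" "p \<in> state m" "q \<in> state m" for t p q using * that by blast
  \<comment> \<open>The rows of order zero in column \<open>(i, j)\<close> of \<Phi> form column
    \<open>j\<close> of \<open>Xs i\<close>, and the remaining rows are its derivatives. So the
    Wronski matrix is \<Phi>, with inverse \<Psi>.\<close>
  define Xs where "Xs = (\<lambda>i t. \<chi> x j. \<Phi> (0, x) (i, j) t)"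
  have s: "classical_solution I m A (Xs i)" "\<And>k t. k < m \<Longrightarrow> t \<in> I \<Longrightarrow> nderiv k (Xs i) t = (\<chi> x j. \<Phi> (k, x) (i, j) t)"
    if "i < m" for i
    using solves_classical_solution[where A = A and y = "\<lambda>j p. \<Phi> p (i, j)" and X = "Xs i", OF A m \<Phi>] that
    by (simp_all add: Xs_def)
  have "is_block_inverse m (wronski Xs t) (\<lambda>l i. \<chi> x y. \<Psi> (l, x) (i, y) t)" if t: "t \<in> I" for t
    unfolding block_inverse_entries
  proof (intro ballI)
    fix p q :: "nat \<times> 'a" assume pq: "p \<in> state m" "q \<in> state m"
    have w: "wronski Xs t (fst p) (fst q) $ snd p $ snd q = \<Phi> p q t" if "p \<in> state m" "q \<in> state m" for p q
      using that s(2) t by (auto simp: wronski_def state_def)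
    show "(\<Sum>r\<in>state m. wronski Xs t (fst p) (fst r) $ snd p $ snd r * (\<chi> x y. \<Psi> (fst r, x) (fst q, y) t) $ snd r $ snd q)
        = (if p = q then 1 else 0) \<and>
      (\<Sum>r\<in>state m. (\<chi> x y. \<Psi> (fst p, x) (fst r, y) t) $ snd p $ snd r * wronski Xs t (fst r) (fst q) $ snd r $ snd q)
        = (if p = q then 1 else 0)"
      using inv[OF t pq] pq by (simp add: w)
  qed
  then have "fundamental_system I m A Xs"
    unfolding fundamental_system_def block_invertible_def using s(1) by blast
  then show ?thesis by blast
qed

lemma fundamental_system_entries:
  assumes A: "\<And>k. k < m \<Longrightarrow> A k \<in> mat_G_inf I" and m: "m \<ge> 1" and X: "fundamental_system I m A Xs"
    and R: "R = (\<lambda>p q t. nderiv (fst p) (Xs (fst q)) t $ snd p $ snd q)"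
    and S: "S = (\<lambda>p q t. block_inverse m (wronski Xs t) (fst p) (fst q) $ snd p $ snd q)"
    and pq: "p \<in> state m" "q \<in> state m"
  shows "smooth (R p q)" "smooth (S p q)"
    "t \<in> I \<Longrightarrow> (\<Sum>r\<in>state m. R p r t * S r q t) = (if p = q then 1 else 0)"
    "jump_free (R p q)" "der (R p q) (\<lambda>s. \<Sum>r\<in>state m. companion m A p r s * R r q s)"
    "jump_free (S p q)" "der (S p q) (\<lambda>s. \<Sum>r\<in>state m. adj (companion m A) q r s * S p r s)"
proof -
  have sR: "solves (state m) (companion m A) (\<lambda>p. R p q)" if "q \<in> state m" for q
    unfolding R using X that
    by (intro classical_solution_solves[OF A m]) (auto simp: fundamental_system_def state_def)
  note B = companion_smooth[OF A]
  show "smooth (R p q)" using solves_smooth[OF sR[OF pq(2)] B pq(1)] .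
  show "jump_free (R p q)" using jump_free_continuous[OF solves_continuous[OF sR[OF pq(2)] pq(1)]] .
  show "der (R p q) (\<lambda>s. \<Sum>r\<in>state m. companion m A p r s * R r q s)"
    using solves_der[OF sR[OF pq(2)] smooth_regulated[OF B] pq(1)] .
  have inv: "(\<Sum>r\<in>state m. R p r t * S r q t) = (if p = q then 1 else 0) \<and> (\<Sum>r\<in>state m. S p r t * R r q t) = (if p = q then 1 else 0)"
    if "t \<in> I" "p \<in> state m" "q \<in> state m" for t p q
  proof -
    have "\<exists>S. is_block_inverse m (wronski Xs t) S"
      using X that(1) by (simp add: fundamental_system_def block_invertible_def)
    then have "is_block_inverse m (wronski Xs t) (block_inverse m (wronski Xs t))"
      unfolding block_inverse_def by (rule someI_ex)
    then show ?thesis using that(2,3) unfolding block_inverse_entries by (simp add: R S wronski_def)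
  qed
  show "t \<in> I \<Longrightarrow> (\<Sum>r\<in>state m. R p r t * S r q t) = (if p = q then 1 else 0)" using inv pq by blast
  note i = inverse_solves[where B = "companion m A" and R = R and S = S, OF finite_state B sR
      inv[THEN conjunct1] inv[THEN conjunct2] pq]
  show "smooth (S p q)" by (rule i(2))
  show "jump_free (S p q)" by (rule jump_free_continuous[OF i(1)])
  show "der (S p q) (\<lambda>s. \<Sum>r\<in>state m. adj (companion m A) q r s * S p r s)" by (rule i(3))
qed

section \<open>The Cauchy problem as a system of distributions\<close>

definition rhs :: "nat \<Rightarrow> 'n::finite mat_dist \<Rightarrow> 'n \<Rightarrow> nat \<times> 'n \<Rightarrow> (real \<Rightarrow> complex) \<Rightarrow> complex" where
  "rhs m F j p = (if Suc (fst p) = m then F $ snd p $ j else 0)"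

lemma companion_dist:
  assumes "\<And>q. q \<in> state m \<Longrightarrow> v q \<in> distributions I"
  shows "Suc k < m \<Longrightarrow> (\<Sum>q\<in>state m. dist_mult I (companion m A (k, x) q) (v q)) = v (Suc k, x)"
    "\<not> Suc k < m \<Longrightarrow> (\<Sum>q\<in>state m. dist_mult I (companion m A (k, x) q) (v q))
      = (\<Sum>l<m. \<Sum>z\<in>UNIV. dist_mult I (\<lambda>s. A l s $ x $ z) (v (l, z)))"
proof -
  assume k: "Suc k < m"
  have "(\<Sum>q\<in>state m. dist_mult I (companion m A (k, x) q) (v q)) = (\<Sum>q\<in>state m. if q = (Suc k, x) then v q else 0)"
    by (intro sum.cong refl) (simp only: companion_def fst_conv snd_conv k if_True dist_mult_if[OF assms])
  also have "\<dots> = v (Suc k, x)" using k by (subst sum.delta) auto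
  finally show "(\<Sum>q\<in>state m. dist_mult I (companion m A (k, x) q) (v q)) = v (Suc k, x)" .
next
  assume "\<not> Suc k < m"
  then show "(\<Sum>q\<in>state m. dist_mult I (companion m A (k, x) q) (v q))
      = (\<Sum>l<m. \<Sum>z\<in>UNIV. dist_mult I (\<lambda>s. A l s $ x $ z) (v (l, z)))"
    by (simp add: sum_state companion_def)
qed

text \<open>Below the highest order the system says only that the next component is a derivative of
  the present one; at the highest order the differential equation expresses \<open>DX m\<close>
  through the lower derivatives and \<open>F\<close>. The columns \<open>j\<close> decouple.\<close>

lemma cauchy_solution_iff:
  fixes X :: "'n::finite mat_dist"
  assumes m: "m \<ge> 1"
  shows "cauchy_solution I m t0 A F X \<longleftrightarrow> (\<exists>v. (\<forall>j. \<forall>p\<in>state m. v j p \<in> distributions I \<and>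
      zero_before I t0 (v j p) \<and>
      (\<Sum>q\<in>state m. dist_mult I (companion m A p q) (v j q)) + rhs m F j p \<in> D I (v j p)) \<and>
      (\<forall>x j. X $ x $ j = v j (0, x)))" (is "_ \<longleftrightarrow> (\<exists>v. ?P v)")
proof
  assume "cauchy_solution I m t0 A F X"
  then obtain DX where X: "X \<in> mat_distributions I" "DX 0 = X"
    and d: "\<And>k. k < m \<Longrightarrow> DX (Suc k) \<in> mat_D I (DX k)"
    and e: "DX m - (\<Sum>k<m. mat_mult I (A k) (DX k)) = F" and z: "\<And>k. k < m \<Longrightarrow> mat_zero_before I t0 (DX k)"
    unfolding cauchy_solution_def by blast
  have dist: "DX k $ x $ j \<in> distributions I" if "k < m" for k x j
    using that
  proof (induction k arbitrary: x j)
    case 0 then show ?case using X by (simp add: mat_distributions_def)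
  next
    case (Suc k)
    then have "DX (Suc k) $ x $ j \<in> D I (DX k $ x $ j)" using d[of k] by (simp add: mat_D_def)
    then show ?case using D_iff[OF Suc.IH] Suc.prems by simp
  qed
  define v where "v = (\<lambda>j p. DX (fst p) $ snd p $ j)"
  have vd: "v j p \<in> distributions I" if "p \<in> state m" for j p using dist that by (auto simp: v_def state_def)
  have "(\<Sum>q\<in>state m. dist_mult I (companion m A (k, x) q) (v j q)) + rhs m F j (k, x) \<in> D I (v j (k, x))"
    if k: "k < m" for j k x
  proof -
    have "(\<Sum>q\<in>state m. dist_mult I (companion m A (k, x) q) (v j q)) + rhs m F j (k, x) = DX (Suc k) $ x $ j"
    proof (cases "Suc k < m")
      case True
      then show ?thesis using companion_dist(1)[where v = "v j", OF vd True] by (simp add: rhs_def v_def)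
    next
      case False
      then have km: "Suc k = m" using k by simp
      have "DX m = (\<Sum>k<m. mat_mult I (A k) (DX k)) + F" using e by (metis diff_add_cancel add.commute)
      then have "DX m $ x $ j = (\<Sum>l<m. mat_mult I (A l) (DX l) $ x $ j) + F $ x $ j" by simp
      then show ?thesis using companion_dist(2)[where v = "v j" and A = A and x = x, OF vd False]
        by (simp add: rhs_def v_def km mat_mult_def)
    qed
    then show ?thesis using d[OF k] by (simp add: mat_D_def v_def)
  qed
  then have "?P v" using vd z X(2) by (auto simp: state_def mat_zero_before_def v_def)
  then show "\<exists>v. ?P v" by blast
next
  assume "\<exists>v. ?P v"
  then obtain v where v: "\<And>j p. p \<in> state m \<Longrightarrow> v j p \<in> distributions I" "\<And>j p. p \<in> state m \<Longrightarrow> zero_before I t0 (v j p)"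
    "\<And>j p. p \<in> state m \<Longrightarrow> (\<Sum>q\<in>state m. dist_mult I (companion m A p q) (v j q)) + rhs m F j p \<in> D I (v j p)"
    "\<And>x j. X $ x $ j = v j (0, x)" by blast
  define W where "W = (\<lambda>k. (\<chi> x j. v j (k, x)) :: 'n mat_dist)"
  \<comment> \<open>The system has no component for the derivative of order \<open>m\<close>; the
    differential equation supplies it.\<close>
  define DX where "DX = (\<lambda>k. if k < m then W k else (\<Sum>l<m. mat_mult I (A l) (W l)) + F)"
  have "X \<in> mat_distributions I" using v(1,4) m by (simp add: mat_distributions_def)
  moreover have "DX 0 = X" using m v(4) by (simp add: DX_def W_def vec_eq_iff)
  moreover have "DX (Suc k) \<in> mat_D I (DX k)" if k: "k < m" for k
  proof -
    have "DX (Suc k) $ x $ j \<in> D I (W k $ x $ j)" for x j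
    proof -
      have "(\<Sum>q\<in>state m. dist_mult I (companion m A (k, x) q) (v j q)) + rhs m F j (k, x) = DX (Suc k) $ x $ j"
      proof (cases "Suc k < m")
        case True
        then show ?thesis using companion_dist(1)[where v = "v j", OF v(1) True] by (simp add: rhs_def DX_def W_def)
      next
        case False
        then have km: "Suc k = m" using k by simp
        show ?thesis using companion_dist(2)[where v = "v j" and A = A and x = x, OF v(1) False]
          by (simp add: rhs_def DX_def W_def km mat_mult_def)
      qed
      then show ?thesis using v(3)[of "(k, x)" j] k by (simp add: W_def)
    qed
    then show ?thesis using k by (simp add: mat_D_def DX_def)
  qed
  moreover have "DX m - (\<Sum>k<m. mat_mult I (A k) (DX k)) = F" by (simp add: DX_def)
  moreover have "mat_zero_before I t0 (DX k)" if "k < m" for k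
    using that v(2) by (simp add: DX_def W_def mat_zero_before_def)
  ultimately show "cauchy_solution I m t0 A F X" unfolding cauchy_solution_def by blast
qed

text \<open>The inhomogeneity sits in the block row of order \<open>m - 1\<close>, so applying the
  inverse matrix to it involves the last block column only.\<close>

lemma Zcoef_entries:
  assumes m: "m \<ge> 1"
    and S: "S = (\<lambda>p q t. block_inverse m (wronski Xs t) (fst p) (fst q) $ snd p $ snd q)"
  shows "mat_mult I (Zcoef m Xs i) F $ x $ j = (\<Sum>q\<in>state m. dist_mult I (S (i, x) q) (rhs m F j q))"
proof -
  have "(\<Sum>q\<in>state m. dist_mult I (S (i, x) q) (rhs m F j q))
      = (\<Sum>l<m. if l = m - 1 then (\<Sum>y\<in>UNIV. dist_mult I (S (i, x) (l, y)) (F $ y $ j)) else 0)"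
    unfolding sum_state
  proof (rule sum.cong[OF refl])
    fix l assume l: "l \<in> {..<m}"
    show "(\<Sum>y\<in>UNIV. dist_mult I (S (i, x) (l, y)) (rhs m F j (l, y)))
        = (if l = m - 1 then (\<Sum>y\<in>UNIV. dist_mult I (S (i, x) (l, y)) (F $ y $ j)) else 0)"
    proof (cases "Suc l = m")
      case True
      then show ?thesis by (auto simp: rhs_def)
    next
      case False
      then have "l \<noteq> m - 1" using m by simp
      then show ?thesis
        using False by (simp only: rhs_def fst_conv if_False dist_mult_zero_right sum.neutral_const)
    qed
  qed
  also have "\<dots> = (\<Sum>y\<in>UNIV. dist_mult I (S (i, x) (m - 1, y)) (F $ y $ j))"
    using m by (subst sum.delta) auto
  finally show ?thesis by (simp add: mat_mult_def Zcoef_def S)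
qed

lemma cauchy_solution_representation:
  fixes X :: "'n::finite mat_dist"
  assumes A: "\<And>k. k < m \<Longrightarrow> A k \<in> mat_G_inf I" and m: "m \<ge> 1" and F: "F \<in> mat_distributions I"
    and X: "cauchy_solution I m t0 A F X" and Xs: "fundamental_system I m A Xs"
    and T: "\<And>i. i < m \<Longrightarrow> primitive_from I t0 (mat_mult I (Zcoef m Xs i) F) (T i)"
  shows "X = (\<Sum>i<m. mat_mult I (Xs i) (T i))"
proof -
  define R where R: "R = (\<lambda>p q t. nderiv (fst p) (Xs (fst q)) t $ snd p $ snd q)"
  define S where S: "S = (\<lambda>p q t. block_inverse m (wronski Xs t) (fst p) (fst q) $ snd p $ snd q)"
  note fs = fundamental_system_entries[OF A m Xs R S]
  obtain v where v: "\<And>j p. p \<in> state m \<Longrightarrow> v j p \<in> distributions I" "\<And>j p. p \<in> state m \<Longrightarrow> zero_before I t0 (v j p)"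
    "\<And>j p. p \<in> state m \<Longrightarrow> (\<Sum>q\<in>state m. dist_mult I (companion m A p q) (v j q)) + rhs m F j p \<in> D I (v j p)"
    "\<And>x j. X $ x $ j = v j (0, x)"
    using X unfolding cauchy_solution_iff[OF m] by blast
  have f: "rhs m F j p \<in> distributions I" for j p
    using F dist_zero by (simp add: rhs_def mat_distributions_def)
  have T': "T (fst p) $ snd p $ j \<in> distributions I" "zero_before I t0 (T (fst p) $ snd p $ j)"
    "(\<Sum>q\<in>state m. dist_mult I (S p q) (rhs m F j q)) \<in> D I (T (fst p) $ snd p $ j)" if p: "p \<in> state m" for p j
  proof -
    have "primitive_from I t0 (mat_mult I (Zcoef m Xs (fst p)) F) (T (fst p))" using T p by (auto simp: state_def)
    moreover have eq: "(\<Sum>q\<in>state m. dist_mult I (S p q) (rhs m F j q)) = mat_mult I (Zcoef m Xs (fst p)) F $ snd p $ j"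
      using Zcoef_entries[OF m S, of "fst p" F "snd p" j] by simp
    ultimately show "T (fst p) $ snd p $ j \<in> distributions I" "zero_before I t0 (T (fst p) $ snd p $ j)"
      "(\<Sum>q\<in>state m. dist_mult I (S p q) (rhs m F j q)) \<in> D I (T (fst p) $ snd p $ j)"
      unfolding primitive_from_def mat_distributions_def mat_zero_before_def mat_D_def eq by simp_all
  qed
  have "X $ x $ j = (\<Sum>i<m. mat_mult I (Xs i) (T i)) $ x $ j" for x j
  proof -
    have "v j (0, x) = (\<Sum>q\<in>state m. dist_mult I (R (0, x) q) (T (fst q) $ snd q $ j))"
      by (rule system_dist_unique[where B = "companion m A" and S = S and f = "rhs m F j" and v = "v j",
            OF finite_state companion_smooth[OF A] fs(1,2) fs(3) fs(6,7) f v(1-3) T'])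
         (use m in auto)
    \<comment> \<open>The block row of order zero in \<open>R\<close> consists of the functions
      \<open>Xs i\<close> themselves.\<close>
    also have "\<dots> = (\<Sum>i<m. mat_mult I (Xs i) (T i)) $ x $ j"
      by (simp add: sum_state R mat_mult_def nderiv_def)
    finally show ?thesis using v(4) by simp
  qed
  then show ?thesis by (simp add: vec_eq_iff)
qed

lemma cauchy_solution_exists:
  fixes F :: "'n::finite mat_dist"
  assumes A: "\<And>k. k < m \<Longrightarrow> A k \<in> mat_G_inf I" and m: "m \<ge> 1" and F: "F \<in> mat_distributions I"
    and Xs: "fundamental_system I m A Xs"
    and T: "\<And>i. i < m \<Longrightarrow> primitive_from I t0 (mat_mult I (Zcoef m Xs i) F) (T i)"
  shows "\<exists>X. cauchy_solution I m t0 A F X"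
proof -
  define R where R: "R = (\<lambda>p q t. nderiv (fst p) (Xs (fst q)) t $ snd p $ snd q)"
  define S where S: "S = (\<lambda>p q t. block_inverse m (wronski Xs t) (fst p) (fst q) $ snd p $ snd q)"
  note fs = fundamental_system_entries[OF A m Xs R S]
  have f: "rhs m F j p \<in> distributions I" for j p
    using F dist_zero by (simp add: rhs_def mat_distributions_def)
  have T': "T (fst p) $ snd p $ j \<in> distributions I" "zero_before I t0 (T (fst p) $ snd p $ j)"
    "(\<Sum>q\<in>state m. dist_mult I (S p q) (rhs m F j q)) \<in> D I (T (fst p) $ snd p $ j)" if p: "p \<in> state m" for p j
  proof -
    have "primitive_from I t0 (mat_mult I (Zcoef m Xs (fst p)) F) (T (fst p))" using T p by (auto simp: state_def)
    moreover have eq: "(\<Sum>q\<in>state m. dist_mult I (S p q) (rhs m F j q)) = mat_mult I (Zcoef m Xs (fst p)) F $ snd p $ j"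
      using Zcoef_entries[OF m S, of "fst p" F "snd p" j] by simp
    ultimately show "T (fst p) $ snd p $ j \<in> distributions I" "zero_before I t0 (T (fst p) $ snd p $ j)"
      "(\<Sum>q\<in>state m. dist_mult I (S p q) (rhs m F j q)) \<in> D I (T (fst p) $ snd p $ j)"
      unfolding primitive_from_def mat_distributions_def mat_zero_before_def mat_D_def eq by simp_all
  qed
  define v where "v = (\<lambda>j p. \<Sum>q\<in>state m. dist_mult I (R p q) (T (fst q) $ snd q $ j))"
  have "v j p \<in> distributions I \<and> zero_before I t0 (v j p) \<and>
      (\<Sum>q\<in>state m. dist_mult I (companion m A p q) (v j q)) + rhs m F j p \<in> D I (v j p)" if p: "p \<in> state m" for j p
    using system_dist_exists[where B = "companion m A" and R = R and S = S and f = "rhs m F j" and v = "v j"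
        and T = "\<lambda>p. T (fst p) $ snd p $ j",
        OF finite_state companion_smooth[OF A] fs(1,2) fs(3) fs(4,5) f T' _ p]
    by (simp add: v_def)
  then have "cauchy_solution I m t0 A F (\<chi> x j. v j (0, x))"
    unfolding cauchy_solution_iff[OF m] by (intro exI[of _ v]) simp
  then show ?thesis ..
qed

text \<open>\<open>Zcoef\<close> has smooth entries as part of the inverse matrix, so its product
  with \<open>F\<close> again consists of distributions vanishing before \<open>t0\<close>, and the
  scalar statements on primitives apply entry by entry.\<close>

lemma Zcoef_primitive:
  fixes F :: "'n::finite mat_dist"
  assumes A: "\<And>k. k < m \<Longrightarrow> A k \<in> mat_G_inf I" and m: "m \<ge> 1"
    and F: "F \<in> mat_distributions I" "mat_zero_before I t0 F"
    and Xs: "fundamental_system I m A Xs" and i: "i < m"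
  shows "\<exists>!T. primitive_from I t0 (mat_mult I (Zcoef m Xs i) F) T"
proof -
  define H where "H = mat_mult I (Zcoef m Xs i) F"
  define S where S: "S = (\<lambda>p q t. block_inverse m (wronski Xs t) (fst p) (fst q) $ snd p $ snd q)"
  have sS: "smooth (S p q)" if "p \<in> state m" "q \<in> state m" for p q
    by (rule fundamental_system_entries(2)[OF A m Xs refl S that])
  have f: "rhs m F j p \<in> distributions I" "zero_before I t0 (rhs m F j p)" for j p
    using F dist_zero by (simp_all add: rhs_def mat_distributions_def mat_zero_before_def)
      (simp_all add: zero_before_def)
  have H: "H $ x $ j \<in> distributions I" "zero_before I t0 (H $ x $ j)" for x j
    unfolding H_def Zcoef_entries[OF m S]
    by (intro dist_sum dist_mult_dist zero_before_sum zero_before_mult f sS; use i in simp)+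
  have "\<forall>x j. \<exists>T. T \<in> distributions I \<and> H $ x $ j \<in> D I T \<and> zero_before I t0 T"
    using primitive_exists[OF H] by blast
  then obtain T where T: "\<And>x j. T x j \<in> distributions I \<and> H $ x $ j \<in> D I (T x j) \<and> zero_before I t0 (T x j)"
    by metis
  have pf: "primitive_from I t0 H T' \<longleftrightarrow>
      (\<forall>x j. T' $ x $ j \<in> distributions I \<and> H $ x $ j \<in> D I (T' $ x $ j) \<and> zero_before I t0 (T' $ x $ j))" for T'
    by (auto simp: primitive_from_def mat_distributions_def mat_D_def mat_zero_before_def)
  have "primitive_from I t0 H (\<chi> x j. T x j)" unfolding pf using T by simp
  moreover have "U = V" if "primitive_from I t0 H U" "primitive_from I t0 H V" for U V
    using that primitive_unique unfolding pf vec_eq_iff by blast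
  ultimately show ?thesis unfolding H_def[symmetric] by blast
qed

end

theorem theorem3p3:
  fixes I :: "real set" and m :: nat and t0 :: real
    and A :: "nat \<Rightarrow> real \<Rightarrow> complex^'n::finite^'n" and F :: "'n mat_dist"
  assumes "open I" and "is_interval I" and "t0 \<in> I" and "m \<ge> 1"
    and "\<And>k. k < m \<Longrightarrow> A k \<in> mat_G_inf I"
    and "F \<in> mat_distributions I" and "mat_zero_before I t0 F"
  shows "(\<exists>!X. cauchy_solution I m t0 A F X) \<and>
    (\<exists>Xs. fundamental_system I m A Xs) \<and>
    (\<forall>X Xs. cauchy_solution I m t0 A F X \<and> fundamental_system I m A Xs \<longrightarrow>
       (\<forall>i<m. \<exists>!T. primitive_from I t0 (mat_mult I (Zcoef m Xs i) F) T) \<and>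
       (\<forall>T. (\<forall>i<m. primitive_from I t0 (mat_mult I (Zcoef m Xs i) F) (T i)) \<longrightarrow>
          X = (\<Sum>i<m. mat_mult I (Xs i) (T i))))"
proof -
  interpret open_interval I t0
    using assms(1-3) by unfold_locales
  have rep: "X = (\<Sum>i<m. mat_mult I (Xs i) (T i))"
    if "cauchy_solution I m t0 A F X" "fundamental_system I m A Xs"
      "\<forall>i<m. primitive_from I t0 (mat_mult I (Zcoef m Xs i) F) (T i)" for X Xs T
    by (rule cauchy_solution_representation[where A = A, OF assms(5,4,6) that(1,2)]) (use that(3) in blast)+
  have prim: "\<exists>!T. primitive_from I t0 (mat_mult I (Zcoef m Xs i) F) T"
    if "fundamental_system I m A Xs" "i < m" for Xs i
    by (rule Zcoef_primitive[where A = A, OF assms(5,4,6,7) that])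
  obtain Xs where Xs: "fundamental_system I m A Xs"
    using fundamental_system_exists[where A = A, OF assms(5,4)] by blast
  define T where "T = (\<lambda>i. THE T. primitive_from I t0 (mat_mult I (Zcoef m Xs i) F) T)"
  have T: "primitive_from I t0 (mat_mult I (Zcoef m Xs i) F) (T i)" if "i < m" for i
    unfolding T_def by (rule theI'[OF prim[OF Xs that]])
  obtain X where X: "cauchy_solution I m t0 A F X"
    using cauchy_solution_exists[where A = A, OF assms(5,4,6) Xs T] by blast
  have "\<exists>!X. cauchy_solution I m t0 A F X"
  proof (rule ex1I[of _ X], rule X)
    fix Y assume Y: "cauchy_solution I m t0 A F Y"
    have "\<forall>i<m. primitive_from I t0 (mat_mult I (Zcoef m Xs i) F) (T i)" using T by simp
    \<comment> \<open>The formula expresses both solutions through one and the same family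
      \<open>T\<close>.\<close>
    from rep[OF Y Xs this] rep[OF X Xs this] show "Y = X" by simp
  qed
  moreover have "\<exists>Xs. fundamental_system I m A Xs" by (rule exI[of _ Xs], rule Xs)
  moreover have "\<forall>X Xs. cauchy_solution I m t0 A F X \<and> fundamental_system I m A Xs \<longrightarrow>
       (\<forall>i<m. \<exists>!T. primitive_from I t0 (mat_mult I (Zcoef m Xs i) F) T) \<and>
       (\<forall>T. (\<forall>i<m. primitive_from I t0 (mat_mult I (Zcoef m Xs i) F) (T i)) \<longrightarrow>
          X = (\<Sum>i<m. mat_mult I (Xs i) (T i)))"
  proof (intro allI impI)
    fix X Xs assume *: "cauchy_solution I m t0 A F X \<and> fundamental_system I m A Xs"
    show "(\<forall>i<m. \<exists>!T. primitive_from I t0 (mat_mult I (Zcoef m Xs i) F) T) \<and>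
       (\<forall>T. (\<forall>i<m. primitive_from I t0 (mat_mult I (Zcoef m Xs i) F) (T i)) \<longrightarrow>
          X = (\<Sum>i<m. mat_mult I (Xs i) (T i)))"
    proof (intro conjI allI impI)
      show "\<exists>!T. primitive_from I t0 (mat_mult I (Zcoef m Xs i) F) T" if "i < m" for i
        by (rule prim[OF conjunct2[OF *] that])
      show "X = (\<Sum>i<m. mat_mult I (Xs i) (T i))"
        if "\<forall>i<m. primitive_from I t0 (mat_mult I (Zcoef m Xs i) F) (T i)" for T
        by (rule rep[OF conjunct1[OF *] conjunct2[OF *] that])
    qed
  qed
  ultimately show ?thesis by (intro conjI)
qed

end
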